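(* Let $X$ be an infinite, connected, vertex-transitive graph with polynomial growth and let $N$ be a finitely generated, torsion-free, nilpotent group which has the same growth rate as $X$ and such that $\mathcal LN$ and $\mathcal PN$ are bi-Lipschitz-equivalent to $\mathcal LX$ and $\mathcal PX$, respectively. Then the linear boundary $\mathcal LX$ is homeomorphic to a disjoint union of spheres: \[ \mathcal LX\cong\mathbb S^{\nu(1)-1}\uplus\mathbb S^{\nu(2)-1}\uplus\dotsb\uplus\mathbb S^{\nu(c)-1}, \] where $c$ is the nilpotency class of $N$ and $\nu(i)$ is the torsion-free rank of the $i$-th quotient $\gamma_i(N)/\gamma_{i+1}(N)$ in the descending central series of $N$. Analogously, the projective boundary $\mathcal PX$ is homeomorphic to a disjoint union of projective spaces: \[ \mathcal PX\cong\mathbb P^{\nu(1)-1}\uplus\mathbb P^{\nu(2)-1}\uplus\dotsb\uplus\mathbb P^{\nu(c)-1}. \]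
   Context: Metric setting. Let $(M,d)$ be a metric space with a reference point $o$ and closed balls $B(x,r)$. For $R\subseteq M$ and $\alpha,a\ge0$ put $\alpha R+a=\bigcup_{x\in R}B(x,\alpha d(o,x)+a)$. For unbounded $R,S\subseteq M$ let $s^+(R,S)$ be the infimum of all $\alpha\ge0$ such that $S\subseteq\alpha R+a$ for some $a\ge0$; put $s(R,S)=\max\{s^+(R,S),s^+(S,R)\}$ and $t(R,S)=\sqrt{s(R,S)}$. Let $\mathcal U$ be the family of unbounded subsets and write $R\sim S$ if $s(R,S)=0$; this is an equivalence relation and $t$ induces a metric on $\mathcal U/{\sim}$. For $\mathcal E\subseteq\mathcal U$, $\mathcal E/{\sim}$ is the set of classes containing an element of $\mathcal E$ and $\mathrm{cl}$ denotes closure in $(\mathcal U/{\sim},t)$. Boundaries carry the metric $t$. Groups. For a finitely generated group $N$ with a word metric, $\mathcal LN=\mathrm{cl}(\{\langle g\rangle^+ : g\in N,\ \langle g\rangle^+\text{ unbounded}\}/{\sim})$ with $\langle g\rangle^+=\{g^n:n\ge0\}$, and $\mathcal PN=\mathrm{cl}(\{\langle g\rangle: g\in N,\ \langle g\rangle\text{ unbounded}\}/{\sim})$ with $\langle g\rangle=\{g^n:n\in\mathbb Z\}$. Graphs. The vertex set $VX$ of a connected graph $X$ carries the graph metric. Fix $v\in VX$ and let $\mathrm{Unb}\,X$ be the set of $g\in\mathrm{Aut}\,X$ such that $\{g^nv:n\in\mathbb Z\}$ is unbounded. Then $\mathcal LX=\mathrm{cl}(\{g^\infty v: g\in\mathrm{Unb}\,X\}/{\sim})$,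 with $g^\infty v=\{g^nv:n\ge0\}$, and $\mathcal PX=\mathrm{cl}(\{\langle g\rangle v: g\in\mathrm{Unb}\,X\}/{\sim})$, with $\langle g\rangle v=\{g^nv:n\in\mathbb Z\}$ (independent of $v$). Polynomial growth means that the number of vertices at distance at most $n$ from a vertex is bounded by a polynomial in $n$ (so $X$ is locally finite); the growth rate is the degree of growth of the ball sizes, for groups with respect to a word metric. $\mathbb S^k$, $\mathbb P^k$ are the $k$-dimensional sphere and real projective space, $\mathbb S^{-1}=\mathbb P^{-1}=\emptyset$. *)

theory Defs
  imports
    "HOL-Analysis.Analysis"
    "HOL-Library.Landau_Symbols"
    "HOL-Algebra.Bij"
    "HOL-Algebra.Coset"
    "HOL-Algebra.FiniteProduct"
    "HOL-Algebra.Generated_Groups"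
begin

section \<open>Boundaries of a metric space\<close>

text \<open>Throughout, \<open>m\<close> is a metric space and \<open>p\<close> its reference point.\<close>

definition thicken :: "'a metric \<Rightarrow> 'a \<Rightarrow> real \<Rightarrow> 'a set \<Rightarrow> real \<Rightarrow> 'a set" where
  "thicken m p \<alpha> R a = (\<Union>x\<in>R. mcball_of m x (\<alpha> * mdist m p x + a))"

definition unbounded_sets :: "'a metric \<Rightarrow> 'a set set" where
  "unbounded_sets m = {R. R \<subseteq> mspace m \<and> \<not> Metric_space.mbounded (mspace m) (mdist m) R}"

text \<open>For unbounded \<open>R\<close> the set below contains every \<open>\<alpha> > 1\<close>, so the infimum is a
  genuine one.\<close>

definition s_plus :: "'a metric \<Rightarrow> 'a \<Rightarrow> 'a set \<Rightarrow> 'a set \<Rightarrow> real" where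
  "s_plus m p R S = Inf {\<alpha>. 0 \<le> \<alpha> \<and> (\<exists>a\<ge>0. S \<subseteq> thicken m p \<alpha> R a)}"

definition s_dist :: "'a metric \<Rightarrow> 'a \<Rightarrow> 'a set \<Rightarrow> 'a set \<Rightarrow> real" where
  "s_dist m p R S = max (s_plus m p R S) (s_plus m p S R)"

definition t_dist :: "'a metric \<Rightarrow> 'a \<Rightarrow> 'a set \<Rightarrow> 'a set \<Rightarrow> real" where
  "t_dist m p R S = sqrt (s_dist m p R S)"

definition s_equiv :: "'a metric \<Rightarrow> 'a \<Rightarrow> ('a set \<times> 'a set) set" where
  "s_equiv m p =
     {(R, S). R \<in> unbounded_sets m \<and> S \<in> unbounded_sets m \<and> s_dist m p R S = 0}"

text \<open>The metric induced by \<open>t\<close> on classes. The type of abstract metrics wants the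
  distance function to be symmetric and nonnegative also outside the carrier, whence the
  value 0 there.\<close>

definition t_class :: "'a metric \<Rightarrow> 'a \<Rightarrow> 'a set set \<Rightarrow> 'a set set \<Rightarrow> real" where
  "t_class m p P Q =
     (if P \<in> unbounded_sets m // s_equiv m p \<and> Q \<in> unbounded_sets m // s_equiv m p
      then the_elem {t_dist m p R S | R S. R \<in> P \<and> S \<in> Q} else 0)"

definition class_metric :: "'a metric \<Rightarrow> 'a \<Rightarrow> 'a set set metric" where
  "class_metric m p = metric (unbounded_sets m // s_equiv m p, t_class m p)"

definition boundary :: "'a metric \<Rightarrow> 'a \<Rightarrow> 'a set set \<Rightarrow> 'a set set metric" where
  "boundary m p \<E> =
     submetric (class_metric m p)
       (mtopology_of (class_metric m p) closure_of (\<E> // s_equiv m p))"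

definition bilipschitz_equivalent :: "'a metric \<Rightarrow> 'b metric \<Rightarrow> bool" where
  "bilipschitz_equivalent m1 m2 \<longleftrightarrow>
     (\<exists>f C. bij_betw f (mspace m1) (mspace m2) \<and> C \<ge> 1 \<and>
        (\<forall>x\<in>mspace m1. \<forall>y\<in>mspace m1.
           mdist m1 x y / C \<le> mdist m2 (f x) (f y) \<and> mdist m2 (f x) (f y) \<le> C * mdist m1 x y))"

subsection \<open>The quotient is a metric space\<close>

lemma thicken_mono:
  assumes "\<alpha> \<le> \<beta>" "a \<le> b"
  shows "thicken m p \<alpha> R a \<subseteq> thicken m p \<beta> R b"
proof
  fix y assume "y \<in> thicken m p \<alpha> R a"
  then obtain x where "x \<in> R" "y \<in> mcball_of m x (\<alpha> * mdist m p x + a)"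
    by (auto simp: thicken_def)
  moreover have "\<alpha> * mdist m p x + a \<le> \<beta> * mdist m p x + b"
    using assms by (simp add: add_mono mult_right_mono)
  ultimately show "y \<in> thicken m p \<beta> R b"
    by (force simp: thicken_def)
qed

lemma unbounded_sets_far:
  assumes "R \<in> unbounded_sets m" "p \<in> mspace m"
  obtains x where "x \<in> R" "x \<in> mspace m" "mdist m p x > B"
proof -
  interpret Metric_space "mspace m" "mdist m" by simp
  have "\<not> R \<subseteq> mcball p B"
    using assms by (auto simp: unbounded_sets_def mbounded_def)
  then show ?thesis
    using assms that by (force simp: unbounded_sets_def)
qed

lemma s_plus_bdd: "bdd_below {\<alpha>. 0 \<le> \<alpha> \<and> (\<exists>a\<ge>0. S \<subseteq> thicken m p \<alpha> R a)}"
  by (rule bdd_belowI[of _ 0]) auto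

lemma s_plus_le:
  assumes "0 \<le> \<alpha>" "0 \<le> a" "S \<subseteq> thicken m p \<alpha> R a"
  shows "s_plus m p R S \<le> \<alpha>"
  unfolding s_plus_def by (rule cInf_lower[OF _ s_plus_bdd]) (use assms in auto)

lemma thicken_gt_1:
  assumes p: "p \<in> mspace m" and R: "R \<in> unbounded_sets m" and S: "S \<subseteq> mspace m"
    and "\<alpha> > 1"
  shows "S \<subseteq> thicken m p \<alpha> R 0"
proof
  fix y assume y: "y \<in> S"
  obtain x where x: "x \<in> R" "x \<in> mspace m" "mdist m p x > mdist m p y / (\<alpha> - 1)"
    using unbounded_sets_far[OF R p] by metis
  have "mdist m x y \<le> mdist m p x + mdist m p y"
    using mdist_triangle[of x m p y] x y p S by (auto simp: mdist_commute)
  also have "mdist m p y \<le> (\<alpha> - 1) * mdist m p x"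
    using x \<open>\<alpha> > 1\<close> by (simp add: pos_divide_less_eq mult.commute)
  finally have "mdist m x y \<le> \<alpha> * mdist m p x"
    by (simp add: algebra_simps)
  then show "y \<in> thicken m p \<alpha> R 0"
    using x y S by (auto simp: thicken_def)
qed

lemma s_plus_le_1:
  assumes "p \<in> mspace m" "R \<in> unbounded_sets m" "S \<in> unbounded_sets m"
  shows "s_plus m p R S \<le> 1"
proof (rule field_le_epsilon)
  fix e :: real assume "e > 0"
  then show "s_plus m p R S \<le> 1 + e"
    using thicken_gt_1[of p m R S "1 + e"] assms
    by (intro s_plus_le[of _ 0]) (auto simp: unbounded_sets_def)
qed

lemma s_plus_ne:
  assumes "p \<in> mspace m" "R \<in> unbounded_sets m" "S \<in> unbounded_sets m"
  shows "{\<alpha>. 0 \<le> \<alpha> \<and> (\<exists>a\<ge>0. S \<subseteq> thicken m p \<alpha> R a)} \<noteq> {}"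
proof -
  have "S \<subseteq> mspace m"
    using assms(3) by (simp add: unbounded_sets_def)
  then have "S \<subseteq> thicken m p 2 R 0"
    using thicken_gt_1[OF assms(1,2)] by simp
  then have "(2::real) \<in> {\<alpha>. 0 \<le> \<alpha> \<and> (\<exists>a\<ge>0. S \<subseteq> thicken m p \<alpha> R a)}"
    by (intro CollectI conjI exI[of _ 0]) auto
  then show ?thesis
    by blast
qed

lemma s_plus_nonneg:
  assumes "p \<in> mspace m" "R \<in> unbounded_sets m" "S \<in> unbounded_sets m"
  shows "0 \<le> s_plus m p R S"
  unfolding s_plus_def by (rule cInf_greatest[OF s_plus_ne[OF assms]]) auto

lemma s_plus_less:
  assumes "p \<in> mspace m" "R \<in> unbounded_sets m" "S \<in> unbounded_sets m" "s_plus m p R S < \<alpha>"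
  obtains a where "a \<ge> 0" "S \<subseteq> thicken m p \<alpha> R a"
proof -
  obtain \<beta> a where "\<beta> < \<alpha>" "a \<ge> 0" "S \<subseteq> thicken m p \<beta> R a"
    using cInf_lessD[OF s_plus_ne[OF assms(1-3)] assms(4)[unfolded s_plus_def]] by blast
  then show ?thesis
    using that thicken_mono[of \<beta> \<alpha> a a] by (meson less_imp_le order_refl subset_trans)
qed

lemma s_plus_triangle:
  assumes p: "p \<in> mspace m"
    and U: "R \<in> unbounded_sets m" "S \<in> unbounded_sets m" "T \<in> unbounded_sets m"
  shows "s_plus m p R T \<le> s_plus m p R S + s_plus m p S T + s_plus m p R S * s_plus m p S T"
    (is "_ \<le> ?a + ?b + ?a * ?b")
proof -
  have M: "R \<subseteq> mspace m" "S \<subseteq> mspace m" "T \<subseteq> mspace m"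
    using U by (auto simp: unbounded_sets_def)
  have nn: "0 \<le> ?a" "0 \<le> ?b"
    by (intro s_plus_nonneg p U)+
  have *: "s_plus m p R T \<le> \<alpha> + \<beta> + \<alpha> * \<beta>" if ab: "?a < \<alpha>" "?b < \<beta>" for \<alpha> \<beta>
  proof -
    obtain a where a: "a \<ge> 0" "S \<subseteq> thicken m p \<alpha> R a"
      using s_plus_less[OF p U(1,2) ab(1)] by metis
    obtain b where b: "b \<ge> 0" "T \<subseteq> thicken m p \<beta> S b"
      using s_plus_less[OF p U(2,3) ab(2)] by metis
    have pos: "0 \<le> \<alpha>" "0 \<le> \<beta>" using nn ab by auto
    have "T \<subseteq> thicken m p (\<alpha> + \<beta> + \<alpha> * \<beta>) R (a + \<beta> * a + b)"
    proof
      fix y assume "y \<in> T"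
      then obtain x where x: "x \<in> S" "mdist m x y \<le> \<beta> * mdist m p x + b"
        using b by (force simp: thicken_def)
      then obtain z where z: "z \<in> R" "mdist m z x \<le> \<alpha> * mdist m p z + a"
        using a by (force simp: thicken_def)
      have in_M: "x \<in> mspace m" "y \<in> mspace m" "z \<in> mspace m"
        using M x z \<open>y \<in> T\<close> by auto
      have "mdist m p x \<le> mdist m p z + mdist m z x"
        by (rule mdist_triangle) (use p in_M in auto)
      then have "\<beta> * mdist m p x \<le> \<beta> * ((1 + \<alpha>) * mdist m p z + a)"
        using z pos by (intro mult_left_mono) (auto simp: algebra_simps)
      moreover have "mdist m z y \<le> mdist m z x + mdist m x y"
        by (rule mdist_triangle) (use in_M in auto)
      ultimately have "mdist m z y \<le> (\<alpha> + \<beta> + \<alpha> * \<beta>) * mdist m p z + (a + \<beta> * a + b)"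
        using x z by (simp add: algebra_simps)
      then show "y \<in> thicken m p (\<alpha> + \<beta> + \<alpha> * \<beta>) R (a + \<beta> * a + b)"
        using z in_M by (auto simp: thicken_def)
    qed
    then show ?thesis
      using a b pos by (intro s_plus_le[of _ "a + \<beta> * a + b"]) auto
  qed
  have "((\<lambda>e. (?a + e) + (?b + e) + (?a + e) * (?b + e)) \<longlongrightarrow> (?a + 0) + (?b + 0) + (?a + 0) * (?b + 0))
     (at_right 0)"
    by (intro tendsto_intros)
  moreover have "\<forall>\<^sub>F e in at_right 0. s_plus m p R T \<le> (?a + e) + (?b + e) + (?a + e) * (?b + e)"
    using eventually_at_right_less[of "0::real"] by eventually_elim (rule *; simp)
  ultimately show ?thesis
    by (intro tendsto_lowerbound[where F = "at_right (0::real)"]) auto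
qed

lemma s_dist_commute: "s_dist m p R S = s_dist m p S R"
  by (simp add: s_dist_def max.commute)

lemma s_dist_range:
  assumes "p \<in> mspace m" "R \<in> unbounded_sets m" "S \<in> unbounded_sets m"
  shows "0 \<le> s_dist m p R S" "s_dist m p R S \<le> 1"
  using assms s_plus_nonneg[of p m] s_plus_le_1[of p m] by (auto simp: s_dist_def le_max_iff_disj)

lemma s_dist_triangle:
  assumes "p \<in> mspace m" "R \<in> unbounded_sets m" "S \<in> unbounded_sets m" "T \<in> unbounded_sets m"
  shows "s_dist m p R T \<le> s_dist m p R S + s_dist m p S T + s_dist m p R S * s_dist m p S T"
proof -
  have mono: "a + b + a * b \<le> c + d + c * d" if "0 \<le> a" "a \<le> c" "0 \<le> b" "b \<le> d" for a b c d :: real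
    using mult_mono[of a c b d] that by linarith
  have "s_plus m p R T \<le> s_dist m p R S + s_dist m p S T + s_dist m p R S * s_dist m p S T"
    by (rule order_trans[OF s_plus_triangle[OF assms]], rule mono)
       (use assms s_plus_nonneg in \<open>auto simp: s_dist_def\<close>)
  moreover have "s_plus m p T R \<le> s_dist m p S T + s_dist m p R S + s_dist m p S T * s_dist m p R S"
    by (rule order_trans[OF s_plus_triangle[OF assms(1,4,3,2)]], rule mono)
       (use assms s_plus_nonneg in \<open>auto simp: s_dist_def\<close>)
  ultimately show ?thesis
    unfolding s_dist_def[of m p R T] by (simp add: mult.commute add.commute)
qed

lemma t_dist_triangle:
  assumes "p \<in> mspace m" "R \<in> unbounded_sets m" "S \<in> unbounded_sets m" "T \<in> unbounded_sets m"
  shows "t_dist m p R T \<le> t_dist m p R S + t_dist m p S T"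
proof -
  define a b where "a = s_dist m p R S" and "b = s_dist m p S T"
  have ab: "0 \<le> a" "a \<le> 1" "0 \<le> b" "b \<le> 1"
    using assms s_dist_range by (auto simp: a_def b_def)
  have "a * b \<le> sqrt a * sqrt b"
    using ab by (intro mult_mono) (auto simp: real_le_rsqrt power2_eq_square mult_left_le)
  also have "\<dots> \<le> 2 * (sqrt a * sqrt b)"
    using ab by simp
  finally have "a * b \<le> 2 * sqrt a * sqrt b" by simp
  then have "s_dist m p R T \<le> (sqrt a + sqrt b)\<^sup>2"
    using s_dist_triangle[OF assms] ab by (simp add: power2_sum a_def b_def)
  then show ?thesis
    using ab by (simp add: t_dist_def a_def b_def real_le_lsqrt)
qed

lemma s_dist_self:
  assumes "p \<in> mspace m" "R \<in> unbounded_sets m"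
  shows "s_dist m p R R = 0"
proof -
  have "R \<subseteq> mspace m"
    using assms by (simp add: unbounded_sets_def)
  then have "mdist m x x = 0 \<and> x \<in> mspace m" if "x \<in> R" for x
    using that by auto
  then have "x \<in> mcball_of m x (0 * mdist m p x + 0)" if "x \<in> R" for x
    using that by simp
  then have "R \<subseteq> thicken m p 0 R 0"
    unfolding thicken_def by blast
  then have "s_plus m p R R \<le> 0"
    by (intro s_plus_le[of _ 0]) auto
  then show ?thesis
    using s_plus_nonneg[of p m R R] assms by (auto simp: s_dist_def)
qed

lemma equiv_s_equiv:
  assumes "p \<in> mspace m"
  shows "equiv (unbounded_sets m) (s_equiv m p)"
proof (rule equivI)
  show "refl_on (unbounded_sets m) (s_equiv m p)"
    using assms by (auto simp: refl_on_def s_equiv_def s_dist_self)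
  show "sym (s_equiv m p)"
    by (auto simp: sym_def s_equiv_def s_dist_commute)
  show "trans (s_equiv m p)"
  proof (rule transI)
    fix R S T assume "(R, S) \<in> s_equiv m p" "(S, T) \<in> s_equiv m p"
    then show "(R, T) \<in> s_equiv m p"
      using s_dist_triangle[OF assms, of R S T] s_dist_range(1)[OF assms, of R T]
      by (auto simp: s_equiv_def)
  qed
qed (auto simp: s_equiv_def)

lemma t_dist_cong:
  assumes "p \<in> mspace m" "(R, R') \<in> s_equiv m p" "(S, S') \<in> s_equiv m p"
  shows "t_dist m p R S = t_dist m p R' S'"
proof -
  have "t_dist m p R S \<le> t_dist m p R' S'"
    if "(R, R') \<in> s_equiv m p" "(S, S') \<in> s_equiv m p" for R R' S S'
    using t_dist_triangle[OF assms(1), of R R' S] t_dist_triangle[OF assms(1), of R' S' S] that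
    by (auto simp: s_equiv_def t_dist_def s_dist_commute)
  then show ?thesis
    using assms equiv_s_equiv[OF assms(1)] by (meson equiv_def order_antisym symD)
qed

lemma t_class:
  assumes "p \<in> mspace m" "R \<in> unbounded_sets m" "S \<in> unbounded_sets m"
  shows "t_class m p (s_equiv m p `` {R}) (s_equiv m p `` {S}) = t_dist m p R S"
proof -
  note eq = equiv_s_equiv[OF assms(1)]
  have "{t_dist m p R' S' | R' S'. R' \<in> s_equiv m p `` {R} \<and> S' \<in> s_equiv m p `` {S}}
      = {t_dist m p R S}"
  proof (intro subset_antisym subsetI)
    fix x assume "x \<in> {t_dist m p R' S' | R' S'. R' \<in> s_equiv m p `` {R} \<and> S' \<in> s_equiv m p `` {S}}"
    then obtain R' S' where "x = t_dist m p R' S'" "(R, R') \<in> s_equiv m p" "(S, S') \<in> s_equiv m p"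
      by blast
    then show "x \<in> {t_dist m p R S}"
      using t_dist_cong[OF assms(1), of R R' S S'] by simp
  next
    fix x assume "x \<in> {t_dist m p R S}"
    then show "x \<in> {t_dist m p R' S' | R' S'. R' \<in> s_equiv m p `` {R} \<and> S' \<in> s_equiv m p `` {S}}"
      using equiv_class_self[OF eq assms(2)] equiv_class_self[OF eq assms(3)] by blast
  qed
  then show ?thesis
    using assms by (simp add: t_class_def quotientI)
qed

lemma Metric_space_class:
  assumes p: "p \<in> mspace m"
  shows "Metric_space (unbounded_sets m // s_equiv m p) (t_class m p)"
proof
  note eq = equiv_s_equiv[OF p]
  show "0 \<le> t_class m p P Q" for P Q
  proof (cases "P \<in> unbounded_sets m // s_equiv m p \<and> Q \<in> unbounded_sets m // s_equiv m p")
    case True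
    then obtain R S
      where "P = s_equiv m p `` {R}" "R \<in> unbounded_sets m"
        "Q = s_equiv m p `` {S}" "S \<in> unbounded_sets m"
      by (meson quotientE)
    then show ?thesis
      using t_class[OF p] s_dist_range(1)[OF p] by (simp add: t_dist_def)
  next
    case False
    then show ?thesis by (auto simp: t_class_def)
  qed
  have "{t_dist m p R S |R S. R \<in> P \<and> S \<in> Q} = {t_dist m p R S |R S. R \<in> Q \<and> S \<in> P}" for P Q
    unfolding t_dist_def by (subst s_dist_commute) blast
  then show "t_class m p P Q = t_class m p Q P" for P Q
    by (simp add: t_class_def)
  fix P Q W
  assume "P \<in> unbounded_sets m // s_equiv m p" and "Q \<in> unbounded_sets m // s_equiv m p"
  then obtain R S
    where RS: "P = s_equiv m p `` {R}" "R \<in> unbounded_sets m"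
      "Q = s_equiv m p `` {S}" "S \<in> unbounded_sets m"
    by (meson quotientE)
  show "t_class m p P Q = 0 \<longleftrightarrow> P = Q"
  proof -
    have "t_class m p P Q = t_dist m p R S"
      unfolding RS(1,3) by (rule t_class[OF p RS(2,4)])
    moreover have "P = Q \<longleftrightarrow> s_dist m p R S = 0"
      unfolding RS(1,3) eq_equiv_class_iff[OF eq RS(2,4)] using RS(2,4) by (simp add: s_equiv_def)
    ultimately show ?thesis
      by (simp add: t_dist_def)
  qed
  assume "W \<in> unbounded_sets m // s_equiv m p"
  then obtain T where T: "W = s_equiv m p `` {T}" "T \<in> unbounded_sets m"
    by (meson quotientE)
  show "t_class m p P W \<le> t_class m p P Q + t_class m p Q W"
    unfolding RS(1,3) T(1) t_class[OF p RS(2) T(2)] t_class[OF p RS(2,4)] t_class[OF p RS(4) T(2)]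
    by (rule t_dist_triangle[OF p RS(2,4) T(2)])
qed

lemma class_metric_simps:
  assumes "p \<in> mspace m"
  shows "mspace (class_metric m p) = unbounded_sets m // s_equiv m p"
    and "mdist (class_metric m p) = t_class m p"
  using Metric_space_class[OF assms]
  by (simp_all add: class_metric_def Metric_space.mspace_metric Metric_space.mdist_metric)

section \<open>Growth\<close>

definition ball_size :: "'a metric \<Rightarrow> 'a \<Rightarrow> nat \<Rightarrow> nat" where
  "ball_size m x n = card (mcball_of m x (real n))"

definition polynomial_growth :: "'a metric \<Rightarrow> bool" where
  "polynomial_growth m \<longleftrightarrow>
     (\<forall>x\<in>mspace m. \<exists>q::real poly. \<forall>n.
        finite (mcball_of m x (real n)) \<and> real (ball_size m x n) \<le> poly q (real n))"

text \<open>The degree of growth. It is meaningful only if balls are finite and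
  the ball sizes are polynomially bounded.\<close>

definition growth_rate :: "'a metric \<Rightarrow> 'a \<Rightarrow> real" where
  "growth_rate m x =
     Inf {\<alpha>. 0 \<le> \<alpha> \<and> (\<lambda>n. real (ball_size m x n)) \<in> O[sequentially](\<lambda>n. real n powr \<alpha>)}"

section \<open>Groups\<close>

definition word_length :: "('a, 'b) monoid_scheme \<Rightarrow> 'a set \<Rightarrow> 'a \<Rightarrow> nat" where
  "word_length G A g =
     (LEAST n. \<exists>ws. length ws = n \<and> set ws \<subseteq> A \<union> m_inv G ` A \<and> foldr (mult G) ws \<one>\<^bsub>G\<^esub> = g)"

definition word_metric :: "('a, 'b) monoid_scheme \<Rightarrow> 'a set \<Rightarrow> 'a metric" where
  "word_metric G A =
     metric (carrier G, \<lambda>g h. if g \<in> carrier G \<and> h \<in> carrier G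
                              then real (word_length G A (inv\<^bsub>G\<^esub> g \<otimes>\<^bsub>G\<^esub> h)) else 0)"

definition linear_boundary_group ::
  "('a, 'b) monoid_scheme \<Rightarrow> 'a set \<Rightarrow> 'a \<Rightarrow> 'a set set metric" where
  "linear_boundary_group G A p =
     boundary (word_metric G A) p
       ({range (\<lambda>n::nat. g [^]\<^bsub>G\<^esub> n) | g. g \<in> carrier G} \<inter> unbounded_sets (word_metric G A))"

definition projective_boundary_group ::
  "('a, 'b) monoid_scheme \<Rightarrow> 'a set \<Rightarrow> 'a \<Rightarrow> 'a set set metric" where
  "projective_boundary_group G A p =
     boundary (word_metric G A) p
       ({range (\<lambda>n::int. g [^]\<^bsub>G\<^esub> n) | g. g \<in> carrier G} \<inter> unbounded_sets (word_metric G A))"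

definition torsion_free :: "('a, 'b) monoid_scheme \<Rightarrow> bool" where
  "torsion_free G \<longleftrightarrow>
     (\<forall>g\<in>carrier G. \<forall>n::nat. n > 0 \<and> g [^]\<^bsub>G\<^esub> n = \<one>\<^bsub>G\<^esub> \<longrightarrow> g = \<one>\<^bsub>G\<^esub>)"

definition commutator_subgroup :: "('a, 'b) monoid_scheme \<Rightarrow> 'a set \<Rightarrow> 'a set \<Rightarrow> 'a set" where
  "commutator_subgroup G H K =
     generate G (\<Union>h\<in>H. \<Union>k\<in>K. {h \<otimes>\<^bsub>G\<^esub> k \<otimes>\<^bsub>G\<^esub> inv\<^bsub>G\<^esub> h \<otimes>\<^bsub>G\<^esub> inv\<^bsub>G\<^esub> k})"

text \<open>Indexed from 1: \<open>\<gamma>\<^sub>1(G) = G\<close> and \<open>\<gamma>\<^sub>i\<^sub>+\<^sub>1(G) = [\<gamma>\<^sub>i(G), G]\<close>.\<close>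

definition lower_central :: "('a, 'b) monoid_scheme \<Rightarrow> nat \<Rightarrow> 'a set" where
  "lower_central G i = ((\<lambda>H. commutator_subgroup G H (carrier G)) ^^ (i - 1)) (carrier G)"

definition nilpotent :: "('a, 'b) monoid_scheme \<Rightarrow> bool" where
  "nilpotent G \<longleftrightarrow> (\<exists>c. lower_central G (c + 1) = {\<one>\<^bsub>G\<^esub>})"

definition nilpotency_class :: "('a, 'b) monoid_scheme \<Rightarrow> nat" where
  "nilpotency_class G = (LEAST c. lower_central G (c + 1) = {\<one>\<^bsub>G\<^esub>})"

text \<open>The maximal size of a finite subset of the commutative group \<open>G\<close> that is linearly
  independent over the integers. The supremum is meaningful if these sizes are bounded, as they
  are for finitely generated \<open>G\<close>.\<close>

definition torsion_free_rank :: "('a, 'b) monoid_scheme \<Rightarrow> nat" where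
  "torsion_free_rank G =
     Sup {card B | B. finite B \<and> B \<subseteq> carrier G \<and>
            (\<forall>e::'a \<Rightarrow> int. finprod G (\<lambda>b. b [^]\<^bsub>G\<^esub> e b) B = \<one>\<^bsub>G\<^esub> \<longrightarrow> (\<forall>b\<in>B. e b = 0))}"

definition lower_central_rank :: "('a, 'b) monoid_scheme \<Rightarrow> nat \<Rightarrow> nat" where
  "lower_central_rank G i =
     torsion_free_rank ((G\<lparr>carrier := lower_central G i\<rparr>) Mod lower_central G (i + 1))"

subsection \<open>The word metric is a metric\<close>

lemma (in group) foldr_mult_append:
  assumes "set xs \<subseteq> carrier G" "set ys \<subseteq> carrier G"
  shows "foldr (\<otimes>) (xs @ ys) \<one> = foldr (\<otimes>) xs \<one> \<otimes> foldr (\<otimes>) ys \<one>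
     \<and> foldr (\<otimes>) xs \<one> \<in> carrier G"
proof -
  have "foldr (\<otimes>) ys \<one> \<in> carrier G"
    using assms(2) by (induction ys) auto
  then show ?thesis
    using assms(1) by (induction xs) (auto simp: m_assoc)
qed

lemma (in group) foldr_mult_inv:
  assumes "set xs \<subseteq> carrier G"
  shows "inv (foldr (\<otimes>) xs \<one>) = foldr (\<otimes>) (rev (map (m_inv G) xs)) \<one>"
  using assms
proof (induction xs)
  case (Cons x xs)
  then have "set (rev (map (m_inv G) xs)) \<subseteq> carrier G" "foldr (\<otimes>) xs \<one> \<in> carrier G"
    using foldr_mult_append[of xs "[]"] by auto
  then show ?case
    using Cons foldr_mult_append[of "rev (map (m_inv G) xs)" "[inv x]"]
    by (simp add: inv_mult_group)
qed simp

lemma (in group) word_exists: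
  assumes "A \<subseteq> carrier G" "g \<in> generate G A"
  shows "\<exists>ws. set ws \<subseteq> A \<union> m_inv G ` A \<and> foldr (\<otimes>) ws \<one> = g"
  using assms(2)
proof induction
  case one
  show ?case by (intro exI[of _ "[]"]) simp
next
  case (incl h)
  then show ?case using assms(1) by (intro exI[of _ "[h]"]) auto
next
  case (inv h)
  then show ?case using assms(1) by (intro exI[of _ "[inv h]"]) auto
next
  case (eng h k)
  then obtain xs ys where xy: "set xs \<subseteq> A \<union> m_inv G ` A" "foldr (\<otimes>) xs \<one> = h"
     "set ys \<subseteq> A \<union> m_inv G ` A" "foldr (\<otimes>) ys \<one> = k"
    by blast
  have "A \<union> m_inv G ` A \<subseteq> carrier G" using assms(1) by auto
  then have "set xs \<subseteq> carrier G" "set ys \<subseteq> carrier G"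
    using xy(1,3) by (meson subset_trans)+
  then have "foldr (\<otimes>) (xs @ ys) \<one> = h \<otimes> k"
    using foldr_mult_append[of xs ys] unfolding xy(2,4) by simp
  moreover have "set (xs @ ys) \<subseteq> A \<union> m_inv G ` A"
    using xy(1,3) by simp
  ultimately show ?case by blast
qed

lemma (in group) Metric_space_word:
  assumes A: "A \<subseteq> carrier G" "generate G A = carrier G"
  shows "Metric_space (carrier G)
     (\<lambda>g h. if g \<in> carrier G \<and> h \<in> carrier G then real (word_length G A (inv g \<otimes> h)) else 0)"
proof -
  let ?B = "A \<union> m_inv G ` A"
  have B: "?B \<subseteq> carrier G"
    using A(1) by auto
  have B': "inv x \<in> ?B" if "x \<in> ?B" for x
    using that
  proof
    assume "x \<in> m_inv G ` A"
    then obtain a where "a \<in> A" "x = inv a" by blast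
    moreover have "a \<in> carrier G" using A(1) \<open>a \<in> A\<close> by blast
    ultimately show ?thesis by simp
  qed blast
  have word: "\<exists>ws. length ws = word_length G A g \<and> set ws \<subseteq> ?B \<and> foldr (\<otimes>) ws \<one> = g"
    if "g \<in> carrier G" for g
  proof -
    let ?P = "\<lambda>n. \<exists>ws. length ws = n \<and> set ws \<subseteq> ?B \<and> foldr (\<otimes>) ws \<one> = g"
    have "\<exists>n. ?P n"
      using word_exists[OF A(1)] A(2) that by blast
    then have "?P (Least ?P)"
      by (rule LeastI_ex[of ?P])
    then show ?thesis
      by (simp only: word_length_def)
  qed
  have le: "word_length G A (foldr (\<otimes>) ws \<one>) \<le> length ws" if "set ws \<subseteq> ?B" for ws
  proof -
    let ?P = "\<lambda>n. \<exists>vs. length vs = n \<and> set vs \<subseteq> ?B \<and> foldr (\<otimes>) vs \<one> = foldr (\<otimes>) ws \<one>"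
    have "?P (length ws)"
      using that by blast
    then have "Least ?P \<le> length ws"
      by (rule Least_le[of ?P])
    then show ?thesis
      by (simp only: word_length_def)
  qed
  have inv_le: "word_length G A (inv g) \<le> word_length G A g" if g: "g \<in> carrier G" for g
  proof -
    obtain ws where ws: "length ws = word_length G A g" "set ws \<subseteq> ?B" "foldr (\<otimes>) ws \<one> = g"
      using word[OF g] by blast
    have "set (rev (map (m_inv G) ws)) \<subseteq> ?B"
      using ws(2) B' by (simp add: image_subset_iff) blast
    then have "word_length G A (foldr (\<otimes>) (rev (map (m_inv G) ws)) \<one>) \<le> length ws"
      using le[of "rev (map (m_inv G) ws)"] by simp
    moreover have "inv g = foldr (\<otimes>) (rev (map (m_inv G) ws)) \<one>"
      using foldr_mult_inv[of ws] subset_trans[OF ws(2) B] unfolding ws(3) by simp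
    ultimately show ?thesis
      using ws(1) by simp
  qed
  have inv_eq: "word_length G A (inv g) = word_length G A g" if "g \<in> carrier G" for g
    using inv_le[OF that] inv_le[of "inv g"] that by simp
  have mult: "word_length G A (g \<otimes> h) \<le> word_length G A g + word_length G A h"
    if gh: "g \<in> carrier G" "h \<in> carrier G" for g h
  proof -
    obtain xs ys where xy: "length xs = word_length G A g" "set xs \<subseteq> ?B" "foldr (\<otimes>) xs \<one> = g"
      "length ys = word_length G A h" "set ys \<subseteq> ?B" "foldr (\<otimes>) ys \<one> = h"
      using word gh by metis
    then have "foldr (\<otimes>) (xs @ ys) \<one> = g \<otimes> h"
      using foldr_mult_append[of xs ys] subset_trans[OF _ B] by simp
    moreover have "set (xs @ ys) \<subseteq> ?B"
      using xy by simp
    ultimately show ?thesis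
      using le[of "xs @ ys"] xy(1,4) by (metis length_append)
  qed
  have zero: "word_length G A g = 0 \<longleftrightarrow> g = \<one>" if "g \<in> carrier G" for g
  proof
    assume "word_length G A g = 0"
    then show "g = \<one>"
      using word[OF that] by force
  next
    assume "g = \<one>"
    then show "word_length G A g = 0"
      using le[of "[]"] by simp
  qed
  show ?thesis
  proof
    fix g h k
    show "(if g \<in> carrier G \<and> h \<in> carrier G then real (word_length G A (inv g \<otimes> h)) else 0) =
          (if h \<in> carrier G \<and> g \<in> carrier G then real (word_length G A (inv h \<otimes> g)) else 0)"
      using inv_eq[of "inv g \<otimes> h"] by (auto simp: inv_mult_group)
    assume gh: "g \<in> carrier G" "h \<in> carrier G"
    have "inv g \<otimes> h = \<one> \<longleftrightarrow> g = h"
    proof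
      assume "inv g \<otimes> h = \<one>"
      then have "g \<otimes> (inv g \<otimes> h) = g"
        using gh by simp
      then show "g = h"
        using gh by (simp flip: m_assoc)
    qed (use gh in simp)
    then show "(if g \<in> carrier G \<and> h \<in> carrier G then real (word_length G A (inv g \<otimes> h)) else 0) = 0
      \<longleftrightarrow> g = h"
      using zero[of "inv g \<otimes> h"] gh by auto
    assume k: "k \<in> carrier G"
    have "inv g \<otimes> k = (inv g \<otimes> h) \<otimes> (inv h \<otimes> k)"
      using gh k by (metis inv_closed m_assoc m_closed r_inv r_one)
    then show "(if g \<in> carrier G \<and> k \<in> carrier G then real (word_length G A (inv g \<otimes> k)) else 0)
      \<le> (if g \<in> carrier G \<and> h \<in> carrier G then real (word_length G A (inv g \<otimes> h)) else 0)
       + (if h \<in> carrier G \<and> k \<in> carrier G then real (word_length G A (inv h \<otimes> k)) else 0)"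
      using mult[of "inv g \<otimes> h" "inv h \<otimes> k"] gh k by simp
  qed auto
qed

section \<open>Graphs\<close>

text \<open>A simple undirected graph is given by its vertex set \<open>V\<close> and its symmetric, irreflexive
  adjacency relation \<open>E\<close>.\<close>

definition simple_graph :: "'v set \<Rightarrow> ('v \<times> 'v) set \<Rightarrow> bool" where
  "simple_graph V E \<longleftrightarrow> E \<subseteq> V \<times> V \<and> sym E \<and> irrefl E"

definition connected_graph :: "'v set \<Rightarrow> ('v \<times> 'v) set \<Rightarrow> bool" where
  "connected_graph V E \<longleftrightarrow> V \<noteq> {} \<and> (\<forall>u\<in>V. \<forall>v\<in>V. (u, v) \<in> E\<^sup>*)"

text \<open>\<open>(u, v) \<in> E ^^ n\<close> says that there is a walk of length \<open>n\<close> from \<open>u\<close> to \<open>v\<close>.\<close>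

definition graph_metric :: "'v set \<Rightarrow> ('v \<times> 'v) set \<Rightarrow> 'v metric" where
  "graph_metric V E =
     metric (V, \<lambda>u v. if u \<in> V \<and> v \<in> V then real (LEAST n. (u, v) \<in> E ^^ n) else 0)"

definition graph_aut :: "'v set \<Rightarrow> ('v \<times> 'v) set \<Rightarrow> ('v \<Rightarrow> 'v) monoid" where
  "graph_aut V E =
     BijGroup V\<lparr>carrier := {g \<in> Bij V. \<forall>u\<in>V. \<forall>v\<in>V. (g u, g v) \<in> E \<longleftrightarrow> (u, v) \<in> E}\<rparr>"

definition vertex_transitive :: "'v set \<Rightarrow> ('v \<times> 'v) set \<Rightarrow> bool" where
  "vertex_transitive V E \<longleftrightarrow> (\<forall>u\<in>V. \<forall>v\<in>V. \<exists>g\<in>carrier (graph_aut V E). g u = v)"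

definition unb_aut :: "'v set \<Rightarrow> ('v \<times> 'v) set \<Rightarrow> 'v \<Rightarrow> ('v \<Rightarrow> 'v) set" where
  "unb_aut V E v =
     {g \<in> carrier (graph_aut V E).
        range (\<lambda>n::int. (g [^]\<^bsub>graph_aut V E\<^esub> n) v) \<in> unbounded_sets (graph_metric V E)}"

text \<open>For \<open>g \<in> unb_aut V E v\<close> the forward orbit is unbounded too, since \<open>g\<^sup>n v\<close> and
  \<open>g\<^sup>-\<^sup>n v\<close> are equally far from \<open>v\<close>.\<close>

definition linear_boundary_graph ::
  "'v set \<Rightarrow> ('v \<times> 'v) set \<Rightarrow> 'v \<Rightarrow> 'v \<Rightarrow> 'v set set metric" where
  "linear_boundary_graph V E p v =
     boundary (graph_metric V E) p
       {range (\<lambda>n::nat. (g [^]\<^bsub>graph_aut V E\<^esub> n) v) | g. g \<in> unb_aut V E v}"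

definition projective_boundary_graph ::
  "'v set \<Rightarrow> ('v \<times> 'v) set \<Rightarrow> 'v \<Rightarrow> 'v \<Rightarrow> 'v set set metric" where
  "projective_boundary_graph V E p v =
     boundary (graph_metric V E) p
       {range (\<lambda>n::int. (g [^]\<^bsub>graph_aut V E\<^esub> n) v) | g. g \<in> unb_aut V E v}"

lemma Metric_space_graph:
  assumes "simple_graph V E" "connected_graph V E"
  shows "Metric_space V (\<lambda>u v. if u \<in> V \<and> v \<in> V then real (LEAST n. (u, v) \<in> E ^^ n) else 0)"
proof -
  let ?l = "\<lambda>u v. LEAST n. (u, v) \<in> E ^^ n"
  have walk: "(u, v) \<in> E ^^ ?l u v" if "u \<in> V" "v \<in> V" for u v
    using assms(2) that
    by (intro LeastI_ex[of "\<lambda>n. (u, v) \<in> E ^^ n"]) (auto simp: connected_graph_def rtrancl_power)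
  have "sym (E ^^ n)" for n
  proof (induction n)
    case (Suc n)
    have "sym E" using assms(1) by (simp add: simple_graph_def)
    then show ?case
      using Suc relpow_commute[of E n] by (auto simp: sym_def relcomp_unfold) blast
  qed (auto simp: sym_def)
  then have sym: "(u, v) \<in> E ^^ n \<longleftrightarrow> (v, u) \<in> E ^^ n" for u v n
    by (meson symD)
  show ?thesis
  proof
    fix u v w
    show "(if u \<in> V \<and> v \<in> V then real (?l u v) else 0) = (if v \<in> V \<and> u \<in> V then real (?l v u) else 0)"
      using sym[of u v] by auto
    assume uv: "u \<in> V" "v \<in> V"
    show "(if u \<in> V \<and> v \<in> V then real (?l u v) else 0) = 0 \<longleftrightarrow> u = v"
      using walk[OF uv] uv Least_le[of "\<lambda>n. (u, u) \<in> E ^^ n" 0] by auto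
    assume w: "w \<in> V"
    have "(u, w) \<in> E ^^ (?l u v + ?l v w)"
      using walk[OF uv] walk[OF uv(2) w] by (auto simp: relpow_add)
    then have "?l u w \<le> ?l u v + ?l v w"
      by (rule Least_le)
    then show "(if u \<in> V \<and> w \<in> V then real (?l u w) else 0)
        \<le> (if u \<in> V \<and> v \<in> V then real (?l u v) else 0) + (if v \<in> V \<and> w \<in> V then real (?l v w) else 0)"
      using uv w by (simp flip: of_nat_add)
  qed auto
qed

section \<open>Spheres and projective spaces\<close>

definition sphere_space :: "int \<Rightarrow> (nat \<Rightarrow> real) topology" where
  "sphere_space k = (if k < 0 then trivial_topology else nsphere (nat k))"

definition antipodal_class :: "(nat \<Rightarrow> real) \<Rightarrow> (nat \<Rightarrow> real) set" where
  "antipodal_class x = {x, \<lambda>i. - x i}"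

definition projective_space :: "int \<Rightarrow> (nat \<Rightarrow> real) set topology" where
  "projective_space k =
     topology (\<lambda>U. U \<subseteq> antipodal_class ` topspace (sphere_space k) \<and>
                   openin (sphere_space k) {x \<in> topspace (sphere_space k). antipodal_class x \<in> U})"

lemma openin_projective_space:
  "openin (projective_space k) U \<longleftrightarrow>
     U \<subseteq> antipodal_class ` topspace (sphere_space k) \<and>
     openin (sphere_space k) {x \<in> topspace (sphere_space k). antipodal_class x \<in> U}"
proof -
  have 1: "{x \<in> topspace (sphere_space k). antipodal_class x \<in> S \<inter> T} =
      {x \<in> topspace (sphere_space k). antipodal_class x \<in> S} \<inter>
      {x \<in> topspace (sphere_space k). antipodal_class x \<in> T}" for S T
    by auto
  have 2: "{x \<in> topspace (sphere_space k). antipodal_class x \<in> \<Union>\<K>} =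
      (\<Union>K\<in>\<K>. {x \<in> topspace (sphere_space k). antipodal_class x \<in> K})" for \<K>
    by auto
  have "istopology (\<lambda>U. U \<subseteq> antipodal_class ` topspace (sphere_space k) \<and>
     openin (sphere_space k) {x \<in> topspace (sphere_space k). antipodal_class x \<in> U})"
    unfolding istopology_def 1 2 by blast
  then show ?thesis
    by (simp add: projective_space_def)
qed

lemma quotient_map_projective_space:
  "quotient_map (sphere_space k) (projective_space k) antipodal_class"
proof -
  have "{x \<in> topspace (sphere_space k). antipodal_class x \<in> antipodal_class ` topspace (sphere_space k)}
      = topspace (sphere_space k)"
    by auto
  then have "openin (projective_space k) (antipodal_class ` topspace (sphere_space k))"
    by (simp add: openin_projective_space)
  then have "topspace (projective_space k) = antipodal_class ` topspace (sphere_space k)"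
    by (meson openin_projective_space openin_subset openin_topspace subset_antisym)
  then show ?thesis
    by (auto simp: quotient_map_def openin_projective_space)
qed

end

theory Submission
  imports Defs
begin

text \<open>
Bi-Lipschitz maps are homeomorphisms, so everything happens in the torsion-free nilpotent group
\<open>N\<close>. Write \<open>\<parallel>g\<parallel>\<close> for the word length and \<open>\<gamma>\<^sub>i\<close> for the lower central series. The quotient
\<open>\<gamma>\<^sub>i/\<gamma>\<^sub>i\<^sub>+\<^sub>1\<close> is a lattice up to torsion, which gives a homomorphism \<open>\<lambda>\<^sub>i\<close> from \<open>\<gamma>\<^sub>i\<close> to
\<open>\<real>\<^sup>r\<close> with \<open>r = \<nu>(i)\<close>. Every \<open>g \<noteq> 1\<close> has a positive power in exactly one stratum, that is, in some
\<open>\<gamma>\<^sub>i\<close> with \<open>\<lambda>\<^sub>i \<noteq> 0\<close>; powers do not change the class of the orbit. The theorem says that the class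
of \<open>\<langle>g\<rangle>\<^sup>+\<close> remembers the stratum and the direction \<open>\<lambda>\<^sub>i(g)/|\<lambda>\<^sub>i(g)|\<close>, a point of a sphere,
that it forgets everything else, and that it depends continuously on the direction. For \<open>\<langle>g\<rangle>\<close> the
direction matters only up to sign. As directions are dense in the spheres, taking
closures then completes the rational points to all of the sphere or projective space.

All metric information comes from one device. Choose commutators of the generators as letters,
a commutator of \<open>j\<close> generators having weight \<open>j\<close>, and let a letter of weight \<open>j\<close> contribute
\<open>L\<^sup>-\<^sup>j\<close> to the length of a word at the scale \<open>L \<ge> 1\<close>. Since the commutator of two letters
contributes at most a multiple of the product of their contributions, conjugation by a word of
bounded weighted length changes weighted lengths by bounded factors only (\<open>light_conj\<close>), and
words can be collected into normal form at bounded cost (\<open>light_collect\<close>). This has three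
consequences.

\<^item> If \<open>\<parallel>g\<parallel> = L\<close>, then \<open>g\<close> has bounded weighted length at the scale \<open>L\<close>. If moreover
  \<open>g \<in> \<gamma>\<^sub>i\<close>, then letters of weight at least \<open>i\<close> suffice (\<open>light_tail\<close>), and counting those of
  weight \<open>i\<close> gives \<open>|\<lambda>\<^sub>i(g)| \<le> C \<parallel>g\<parallel>\<^sup>i\<close> (\<open>nrm_ge_functional\<close>).
\<^item> Conversely, bounded weighted length at the scale \<open>L\<close> implies \<open>\<parallel>g\<parallel> \<le> C L\<close>
  (\<open>nrm_le_of_light\<close>), because high powers of commutators are commutators of powers. Hence
  \<open>\<parallel>g\<^sup>n\<parallel>\<close> grows like \<open>(n |\<lambda>\<^sub>i(g)|)\<^sup>1\<^sup>/\<^sup>i\<close>.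
\<^item> If \<open>\<lambda>\<^sub>i(g)\<close> and \<open>\<lambda>\<^sub>i(h)\<close> are close, then \<open>g\<^sup>-\<^sup>n h\<^sup>n\<close>, a product of \<open>n\<close> conjugates
  of \<open>g\<^sup>-\<^sup>1 h\<close>, has small weighted length at the scale of \<open>\<parallel>g\<^sup>n\<parallel>\<close>
  (\<open>good_quotient_nrm\<close>).

The first two items keep orbits of different strata or directions apart
(\<open>separated_powers\<close>), the third makes orbits with nearby directions close (\<open>shadow_powers\<close>).
The space of classes of unbounded sets is complete (\<open>mcomplete_class_metric\<close>), so
the map from directions to classes extends to the spheres, which are compact, and its image is
the boundary (\<open>dense_map_closure_homeomorphic\<close>).
\<close>

section \<open>The lower central series\<close>

definition (in monoid) comm :: "'a \<Rightarrow> 'a \<Rightarrow> 'a" where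
  "comm h k = h \<otimes> k \<otimes> inv h \<otimes> inv k"

context group
begin

lemma inv_cancel [simp]:
  assumes "x \<in> carrier G" "y \<in> carrier G"
  shows "inv x \<otimes> (x \<otimes> y) = y" "x \<otimes> (inv x \<otimes> y) = y"
  using assms by (simp_all flip: m_assoc)

lemma comm_closed [simp]: "h \<in> carrier G \<Longrightarrow> k \<in> carrier G \<Longrightarrow> comm h k \<in> carrier G"
  by (simp add: comm_def)

text \<open>Rewriting with these rules decides identities that hold in free groups.\<close>

lemmas group_word = comm_def m_assoc inv_mult_group

lemma lower_central_1 [simp]: "lower_central G (Suc 0) = carrier G"
  by (simp add: lower_central_def)

lemma lower_central_0 [simp]: "lower_central G 0 = carrier G"
  by (simp add: lower_central_def)

lemma lower_central_Suc:
  assumes "i \<ge> 1"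
  shows "lower_central G (Suc i) = generate G {comm h k | h k. h \<in> lower_central G i \<and> k \<in> carrier G}"
proof -
  obtain j where i: "i = Suc j" using assms by (cases i) auto
  have "(\<Union>h\<in>H. \<Union>k\<in>K. {h \<otimes> k \<otimes> inv h \<otimes> inv k}) = {comm h k | h k. h \<in> H \<and> k \<in> K}" for H K
    by (auto simp: comm_def)
  then show ?thesis by (simp add: i lower_central_def commutator_subgroup_def)
qed

lemma lower_central_props: "subgroup (lower_central G i) G \<and> lower_central G (Suc i) \<subseteq> lower_central G i
   \<and> (\<forall>h\<in>lower_central G i. \<forall>k\<in>carrier G. k \<otimes> h \<otimes> inv k \<in> lower_central G i)"
proof (induction i)
  case 0
  then show ?case by (simp add: subgroup_self)
next
  case (Suc i)
  show ?case
  proof (cases "i = 0")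
    case True
    have "lower_central G (Suc (Suc 0)) \<subseteq> carrier G"
      by (subst lower_central_Suc) (auto intro!: generate_incl)
    with True show ?thesis by (simp add: subgroup_self)
  next
    case False
    then have S: "lower_central G (Suc i) = generate G {comm h k | h k. h \<in> lower_central G i \<and> k \<in> carrier G}"
      by (simp add: lower_central_Suc)
    have sub: "lower_central G i \<subseteq> carrier G" "subgroup (lower_central G i) G"
      using Suc by (auto simp: subgroup.subset)
    let ?C = "{comm h k | h k. h \<in> lower_central G i \<and> k \<in> carrier G}"
    have C: "?C \<subseteq> carrier G" using sub by auto
    have sg: "subgroup (lower_central G (Suc i)) G"
      unfolding S by (rule generate_is_subgroup[OF C])
    have le: "lower_central G (Suc (Suc i)) \<subseteq> lower_central G (Suc i)"
      unfolding lower_central_Suc[of "Suc i", simplified]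
    proof (subst S, rule mono_generate)
      show "{comm h k |h k. h \<in> lower_central G (Suc i) \<and> k \<in> carrier G} \<subseteq> ?C"
        using Suc by blast
    qed
    have "k \<otimes> h \<otimes> inv k \<in> generate G ?C" if "h \<in> generate G ?C" "k \<in> carrier G" for h k
      using that
    proof (induction)
      case one
      then show ?case by (simp add: generate.one)
    next
      case (incl h)
      then obtain a b where ab: "h = comm a b" "a \<in> lower_central G i" "b \<in> carrier G" by blast
      then have "a \<in> carrier G" using sub by blast
      then have "k \<otimes> h \<otimes> inv k = comm (k \<otimes> a \<otimes> inv k) (k \<otimes> b \<otimes> inv k)"
        using ab incl by (simp add: group_word)
      moreover have "k \<otimes> a \<otimes> inv k \<in> lower_central G i" using ab incl Suc by blast
      moreover have "k \<otimes> b \<otimes> inv k \<in> carrier G" using ab incl by simp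
      ultimately show ?case by (auto intro!: generate.incl)
    next
      case (inv h)
      then obtain a b where ab: "h = comm a b" "a \<in> lower_central G i" "b \<in> carrier G" by blast
      then have a: "a \<in> carrier G" using sub by blast
      then have "k \<otimes> inv h \<otimes> inv k = inv (comm (k \<otimes> a \<otimes> inv k) (k \<otimes> b \<otimes> inv k))"
        using ab inv by (simp add: group_word)
      moreover have "k \<otimes> a \<otimes> inv k \<in> lower_central G i" using ab inv Suc by blast
      moreover have "k \<otimes> b \<otimes> inv k \<in> carrier G" using ab inv by simp
      ultimately show ?case by (auto intro!: generate.inv)
    next
      case (eng h1 h2)
      have "h1 \<in> carrier G" "h2 \<in> carrier G" using eng generate_in_carrier[OF C] by auto
      then have "k \<otimes> (h1 \<otimes> h2) \<otimes> inv k = (k \<otimes> h1 \<otimes> inv k) \<otimes> (k \<otimes> h2 \<otimes> inv k)"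
        using eng by (simp add: group_word)
      then show ?case using eng by (simp add: generate.eng)
    qed
    then show ?thesis using sg le S by simp
  qed
qed

lemma lower_central_subgroup: "subgroup (lower_central G i) G"
  using lower_central_props by blast

lemma lower_central_carrier: "h \<in> lower_central G i \<Longrightarrow> h \<in> carrier G"
  using lower_central_subgroup subgroup.subset by blast

lemma lower_central_conj:
  "h \<in> lower_central G i \<Longrightarrow> k \<in> carrier G \<Longrightarrow> k \<otimes> h \<otimes> inv k \<in> lower_central G i"
  using lower_central_props by blast

lemma lower_central_conj':
  "h \<in> lower_central G i \<Longrightarrow> k \<in> carrier G \<Longrightarrow> inv k \<otimes> h \<otimes> k \<in> lower_central G i"
  using lower_central_conj[of h i "inv k"] by simp

lemma lower_central_mult:
  "h \<in> lower_central G i \<Longrightarrow> k \<in> lower_central G i \<Longrightarrow> h \<otimes> k \<in> lower_central G i"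
  using lower_central_subgroup subgroup.m_closed by metis

lemma lower_central_inv: "h \<in> lower_central G i \<Longrightarrow> inv h \<in> lower_central G i"
  using lower_central_subgroup subgroup.m_inv_closed by metis

lemma lower_central_one: "\<one> \<in> lower_central G i"
  using lower_central_subgroup subgroup.one_closed by metis

lemma lower_central_antimono: "i \<le> j \<Longrightarrow> lower_central G j \<subseteq> lower_central G i"
proof (induction rule: dec_induct)
  case (step n)
  then show ?case using lower_central_props[of n] by blast
qed simp

lemma lower_central_normal: "lower_central G i \<lhd> G"
  using normal_inv_iff lower_central_subgroup lower_central_conj by blast

lemma lower_central_pow: "h \<in> lower_central G i \<Longrightarrow> h [^] (n::nat) \<in> lower_central G i"
  by (induction n) (auto simp: lower_central_one intro: lower_central_mult)

lemma lower_central_int_pow: "h \<in> lower_central G i \<Longrightarrow> h [^] (n::int) \<in> lower_central G i"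
proof (cases "n < 0")
  case True
  assume h: "h \<in> lower_central G i"
  show ?thesis
    unfolding int_pow_def2 if_P[OF True] by (intro lower_central_inv lower_central_pow h)
next
  case False
  assume h: "h \<in> lower_central G i"
  show ?thesis
    unfolding int_pow_def2 if_not_P[OF False] by (intro lower_central_pow h)
qed

lemma comm_lower_central_1:
  assumes "h \<in> lower_central G i" "k \<in> carrier G" "i \<ge> 1"
  shows "comm h k \<in> lower_central G (Suc i)"
  unfolding lower_central_Suc[OF assms(3)] using assms by (blast intro: generate.incl)

lemma comm_swap: "h \<in> carrier G \<Longrightarrow> k \<in> carrier G \<Longrightarrow> inv (comm h k) = comm k h"
  by (simp add: group_word)

text \<open>The Hall--Witt identity, for the convention \<open>[h, k] = h k h\<^sup>-\<^sup>1 k\<^sup>-\<^sup>1\<close>.\<close>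

lemma hall_witt:
  assumes "x \<in> carrier G" "y \<in> carrier G" "z \<in> carrier G"
  shows "comm (comm x y) (y \<otimes> z \<otimes> inv y) \<otimes> (comm (comm y z) (z \<otimes> x \<otimes> inv z)
    \<otimes> comm (comm z x) (x \<otimes> y \<otimes> inv x)) = \<one>"
  using assms by (simp add: group_word)

lemma comm_mult_right:
  "h \<in> carrier G \<Longrightarrow> k \<in> carrier G \<Longrightarrow> l \<in> carrier G \<Longrightarrow>
    comm h (k \<otimes> l) = comm h k \<otimes> (k \<otimes> comm h l \<otimes> inv k)"
  by (simp add: group_word)

lemma comm_mult_left:
  "h \<in> carrier G \<Longrightarrow> k \<in> carrier G \<Longrightarrow> l \<in> carrier G \<Longrightarrow>
    comm (h \<otimes> k) l = (h \<otimes> comm k l \<otimes> inv h) \<otimes> comm h l"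
  by (simp add: group_word)

lemma comm_inv_right:
  "h \<in> carrier G \<Longrightarrow> k \<in> carrier G \<Longrightarrow> comm h (inv k) = inv k \<otimes> inv (comm h k) \<otimes> k"
  by (simp add: group_word)

lemma comm_inv_left:
  "h \<in> carrier G \<Longrightarrow> k \<in> carrier G \<Longrightarrow> comm (inv h) k = inv h \<otimes> inv (comm h k) \<otimes> h"
  by (simp add: group_word)

lemma comm_generate_right:
  assumes "h \<in> carrier G" "C \<subseteq> carrier G" "\<And>k. k \<in> C \<Longrightarrow> comm h k \<in> lower_central G i"
    and "k \<in> generate G C"
  shows "comm h k \<in> lower_central G i"
  using assms(4)
proof induction
  case one
  then show ?case using assms(1) by (simp add: comm_def lower_central_one)
next
  case (inv k)
  then have "k \<in> carrier G" using assms(2) by blast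
  then show ?case
    using assms(1) assms(3)[OF inv] by (simp add: comm_inv_right lower_central_inv lower_central_conj')
next
  case (eng k l)
  then have "k \<in> carrier G" "l \<in> carrier G" using generate_in_carrier[OF assms(2)] by auto
  then show ?case
    using eng assms(1) by (simp add: comm_mult_right lower_central_mult lower_central_conj)
qed (rule assms(3))

text \<open>For \<open>k = [b, c]\<close> with \<open>b \<in> \<gamma>\<^sub>j\<close>, the Hall--Witt identity trades \<open>[h, [b, c]]\<close> for
  commutators of \<open>b\<close> with an element of \<open>\<gamma>\<^sub>i\<^sub>+\<^sub>1\<close> and of \<open>c\<close> with an element of \<open>\<gamma>\<^sub>i\<^sub>+\<^sub>j\<close>.\<close>

lemma comm_lower_central:
  assumes "i \<ge> 1" "j \<ge> 1" "h \<in> lower_central G i" "k \<in> lower_central G j"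
  shows "comm h k \<in> lower_central G (i + j)"
  using assms(2,1,3,4)
proof (induction j arbitrary: i h k rule: nat_induct_at_least)
  case base
  then show ?case using comm_lower_central_1[of h i k] by simp
next
  case (Suc j)
  let ?K = "lower_central G (i + Suc j)"
  have h: "h \<in> carrier G" using Suc.prems lower_central_carrier by blast
  let ?C = "{comm b c | b c. b \<in> lower_central G j \<and> c \<in> carrier G}"
  have C: "?C \<subseteq> carrier G" using lower_central_carrier by auto
  have key: "comm h (comm b c) \<in> ?K" if b: "b \<in> lower_central G j" and c: "c \<in> carrier G" for b c
  proof -
    \<comment> \<open>conjugated so that \<open>h\<close> itself appears in the Hall--Witt identity for \<open>b, c, z\<close>\<close>
    define z where "z = inv c \<otimes> h \<otimes> c"
    have z: "z \<in> lower_central G i"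
      using Suc.prems c by (simp add: z_def lower_central_conj')
    have car: "b \<in> carrier G" "z \<in> carrier G" using b z lower_central_carrier by auto
    have h_eq: "c \<otimes> z \<otimes> inv c = h" using h c by (simp add: z_def m_assoc)
    have "comm c z \<in> lower_central G (Suc i)"
      using comm_lower_central_1[OF z c] Suc.prems lower_central_inv c car by (metis comm_swap)
    moreover have "z \<otimes> b \<otimes> inv z \<in> lower_central G j"
      using b car by (simp add: lower_central_conj)
    ultimately have 1: "comm (comm c z) (z \<otimes> b \<otimes> inv z) \<in> ?K"
      using Suc.IH[of "Suc i"] by fastforce
    have "comm z b \<in> lower_central G (i + j)"
      using Suc.IH Suc.prems z b by blast
    then have 2: "comm (comm z b) (b \<otimes> c \<otimes> inv b) \<in> ?K"
      using comm_lower_central_1[of _ "i + j" "b \<otimes> c \<otimes> inv b"] Suc.prems c car by simp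
    have 3: "comm (comm b c) h \<otimes> (comm (comm c z) (z \<otimes> b \<otimes> inv z) \<otimes> comm (comm z b) (b \<otimes> c \<otimes> inv b)) = \<one>"
      using hall_witt[of b c z] car c by (simp add: h_eq)
    have "comm h (comm b c) = inv (comm (comm b c) h)"
      using h c car by (simp add: comm_swap)
    also have "\<dots> = comm (comm c z) (z \<otimes> b \<otimes> inv z) \<otimes> comm (comm z b) (b \<otimes> c \<otimes> inv b)"
      by (rule inv_equality[OF inv_comm[OF 3]]) (use 3 h c car in auto)
    finally show ?thesis using 1 2 lower_central_mult by simp
  qed
  show ?case
    using comm_generate_right[OF h C] key Suc.prems(3) lower_central_Suc[OF Suc.hyps] by auto
qed

end

section \<open>Commutators of generators as letters\<close>

context group
begin

text \<open>Left-normed commutators of \<open>j + 1\<close> generators; they lie in \<open>\<gamma>\<^sub>j\<^sub>+\<^sub>1\<close>.\<close>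

fun level :: "'a set \<Rightarrow> nat \<Rightarrow> 'a set" where
  "level A 0 = A"
| "level A (Suc j) = (\<lambda>(y, z). comm y z) ` (level A j \<times> A)"

lemma finite_level: "finite A \<Longrightarrow> finite (level A j)"
  by (induction j) auto

lemma level_lower_central:
  assumes "A \<subseteq> carrier G"
  shows "level A j \<subseteq> lower_central G (Suc j)"
proof (induction j)
  case (Suc j)
  show ?case
  proof
    fix g assume "g \<in> level A (Suc j)"
    then obtain y z where "g = comm y z" "y \<in> level A j" "z \<in> A" by auto
    then show "g \<in> lower_central G (Suc (Suc j))"
      using Suc assms comm_lower_central_1[of y "Suc j" z] by auto
  qed
qed (use assms in simp)

text \<open>Modulo \<open>\<gamma>\<^sub>j\<^sub>+\<^sub>2\<close>, the commutator of \<open>h \<in> \<gamma>\<^sub>j\<close> and \<open>k\<close> is multiplicative in both arguments,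
  so \<open>\<gamma>\<^sub>j\<^sub>+\<^sub>1\<close> is generated modulo \<open>\<gamma>\<^sub>j\<^sub>+\<^sub>2\<close> by the commutators of generators.\<close>

lemma lower_central_level:
  assumes A: "A \<subseteq> carrier G" "generate G A = carrier G"
  shows "lower_central G (Suc j) = generate G (level A j \<union> lower_central G (Suc (Suc j)))"
proof (induction j)
  case 0
  have "carrier G \<subseteq> generate G (A \<union> lower_central G (Suc (Suc 0)))"
    using A mono_generate[of A "A \<union> lower_central G (Suc (Suc 0))"] by auto
  moreover have "generate G (A \<union> lower_central G (Suc (Suc 0))) \<subseteq> carrier G"
    using A lower_central_carrier by (intro generate_incl) auto
  ultimately show ?case by simp
next
  case (Suc j)
  let ?D = "level A (Suc j) \<union> lower_central G (Suc (Suc (Suc j)))"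
  let ?H = "generate G ?D"
  have D: "?D \<subseteq> lower_central G (Suc (Suc j))"
    using level_lower_central[OF A(1), of "Suc j"] lower_central_antimono[of "Suc (Suc j)" "Suc (Suc (Suc j))"] by auto
  have H_le: "?H \<subseteq> lower_central G (Suc (Suc j))"
    by (rule generate_subgroup_incl[OF D lower_central_subgroup])
  have H: "subgroup ?H G"
    using D lower_central_carrier by (intro generate_is_subgroup) blast
  have deep: "u \<in> ?H" if "u \<in> lower_central G (Suc (Suc (Suc j)))" for u
    using that by (auto intro: generate.incl)
  note Hm = subgroup.m_closed[OF H] and Hi = subgroup.m_inv_closed[OF H]
  \<comment> \<open>The conjugate differs from \<open>u\<close> by a commutator that lies one step deeper.\<close>
  have conjH: "k \<otimes> u \<otimes> inv k \<in> ?H" if "u \<in> ?H" "k \<in> carrier G" for u k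
  proof -
    have u: "u \<in> carrier G" using that subgroup.mem_carrier[OF H] by blast
    have "comm k u \<in> lower_central G (Suc (Suc (Suc j)))"
      using comm_lower_central[of 1 "Suc (Suc j)" k u] that H_le by auto
    then have "comm k u \<otimes> u \<in> ?H" using that deep Hm by blast
    moreover have "comm k u \<otimes> u = k \<otimes> u \<otimes> inv k" using u that by (simp add: group_word)
    ultimately show ?thesis by simp
  qed
  have conjH': "inv k \<otimes> u \<otimes> k \<in> ?H" if "u \<in> ?H" "k \<in> carrier G" for u k
    using conjH[of u "inv k"] that by simp
  have step1: "comm a k \<in> ?H" if "a \<in> level A j" "k \<in> carrier G" for a k
  proof -
    have a: "a \<in> carrier G" using that level_lower_central[OF A(1)] lower_central_carrier by blast
    have "k \<in> generate G A" using that A by simp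
    then show ?thesis
    proof induction
      case one
      then show ?case using a by (simp add: comm_def generate.one)
    next
      case (incl k)
      then show ?case using that by (auto intro!: generate.incl)
    next
      case (inv k)
      then have "comm a k \<in> ?H" using that by (auto intro!: generate.incl)
      moreover have "k \<in> carrier G" using inv A by blast
      ultimately show ?case using a conjH'[OF Hi] by (simp only: comm_inv_right)
    next
      case (eng k l)
      then show ?case using a A by (simp add: comm_mult_right Hm conjH del: level.simps)
    qed
  qed
  have step2: "comm h k \<in> ?H" if "h \<in> lower_central G (Suc j)" "k \<in> carrier G" for h k
  proof -
    have lc: "level A j \<union> lower_central G (Suc (Suc j)) \<subseteq> carrier G"
      using level_lower_central[OF A(1)] lower_central_carrier by blast
    have base: "comm h k \<in> ?H" if "h \<in> level A j \<union> lower_central G (Suc (Suc j))" for h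
      using that step1[OF _ \<open>k \<in> carrier G\<close>] deep comm_lower_central_1[of h "Suc (Suc j)" k] \<open>k \<in> carrier G\<close>
      by auto
    have "h \<in> generate G (level A j \<union> lower_central G (Suc (Suc j)))"
      using that Suc by simp
    then show ?thesis
    proof induction
      case one
      then show ?case using \<open>k \<in> carrier G\<close> by (simp add: comm_def generate.one)
    next
      case (incl h)
      then show ?case using base by blast
    next
      case (inv h)
      moreover have "h \<in> carrier G" using inv lc by blast
      ultimately show ?case using base \<open>k \<in> carrier G\<close> by (simp add: comm_inv_left Hi conjH' del: level.simps)
    next
      case (eng h l)
      then have "h \<in> carrier G" "l \<in> carrier G" using generate_in_carrier[OF lc] by auto
      then show ?case using eng \<open>k \<in> carrier G\<close> by (simp add: comm_mult_left Hm conjH del: level.simps)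
    qed
  qed
  have "lower_central G (Suc (Suc j)) \<subseteq> ?H"
    using lower_central_Suc[of "Suc j"] generate_subgroup_incl[OF _ H, of "{comm h k | h k. h \<in> lower_central G (Suc j) \<and> k \<in> carrier G}"] step2
    by auto
  then show ?case using H_le by blast
qed

lemma lower_central_levels:
  assumes A: "A \<subseteq> carrier G" "generate G A = carrier G" and c: "lower_central G (Suc c) = {\<one>}"
  shows "lower_central G (Suc j) = generate G (\<Union>k\<in>{j..<c}. level A k)"
proof (cases "j \<le> c")
  case True
  then show ?thesis
  proof (induction rule: inc_induct)
    case base
    then show ?case using c generate_empty by simp
  next
    case (step n)
    let ?U = "\<Union>k\<in>{n..<c}. level A k"
    have U: "?U \<subseteq> lower_central G (Suc n)"
    proof
      fix y assume "y \<in> ?U"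
      then obtain k where "n \<le> k" "y \<in> level A k" by auto
      then show "y \<in> lower_central G (Suc n)"
        using level_lower_central[OF A(1), of k] lower_central_antimono[of "Suc n" "Suc k"] by auto
    qed
    have sg: "subgroup (generate G ?U) G"
      using U lower_central_carrier by (intro generate_is_subgroup) blast
    have "level A n \<subseteq> generate G ?U"
      using step by (auto intro!: generate.incl)
    moreover have "lower_central G (Suc (Suc n)) \<subseteq> generate G ?U"
      unfolding step.IH by (rule mono_generate, rule UN_mono) auto
    ultimately have "lower_central G (Suc n) \<subseteq> generate G ?U"
      by (subst lower_central_level[OF A]) (intro generate_subgroup_incl[OF _ sg]; blast)
    moreover have "generate G ?U \<subseteq> lower_central G (Suc n)"
      by (rule generate_subgroup_incl[OF U lower_central_subgroup])
    ultimately show ?case by blast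
  qed
next
  case False
  then have "lower_central G (Suc j) = {\<one>}"
    using lower_central_antimono[of "Suc c" "Suc j"] c lower_central_one by auto
  then show ?thesis using False generate_empty by simp
qed

end

text \<open>The letters are sorted by weight, so that the commutator of a letter with any other letter is a
  word in later letters. That every letter of weight \<open>j + 1\<close> is the commutator of a letter of
  weight \<open>j\<close> with one of weight 1 is what bounds the word length of its powers.\<close>

locale weighted_letters = group +
  fixes x :: "nat \<Rightarrow> 'a" and w :: "nat \<Rightarrow> nat" and M c :: nat
  assumes w_mono: "s \<le> t \<Longrightarrow> t < M \<Longrightarrow> w s \<le> w t"
    and w_pos: "t < M \<Longrightarrow> 1 \<le> w t" and w_le: "t < M \<Longrightarrow> w t \<le> c"
    and letter_in: "t < M \<Longrightarrow> x t \<in> lower_central G (w t)"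
    and lower_central_letters: "j \<ge> 1 \<Longrightarrow> lower_central G j = generate G (x ` {t. t < M \<and> j \<le> w t})"
    and letter_comm: "t < M \<Longrightarrow> 1 < w t \<Longrightarrow>
      \<exists>s r. s < M \<and> r < M \<and> w s = w t - 1 \<and> w r = 1 \<and> x t = comm (x s) (x r)"

lemma (in group) weighted_letters_exist:
  assumes A: "finite A" "A \<subseteq> carrier G" "generate G A = carrier G"
    and c: "lower_central G (Suc c) = {\<one>}"
  shows "\<exists>x w M. weighted_letters G x w M c"
proof -
  let ?P = "\<Union>k<c. Pair (Suc k) ` level A k"
  have "finite ?P" using finite_level[OF A(1)] by auto
  then obtain qs where "set qs = ?P" using finite_list by metis
  then obtain ps where ps: "set ps = ?P" "sorted (map fst ps)"
    using sorted_sort_key[of fst qs] set_sort by metis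
  define x where "x t = snd (ps ! t)" for t
  define w where "w t = fst (ps ! t)" for t
  have letter: "\<exists>k<c. w t = Suc k \<and> x t \<in> level A k" if "t < length ps" for t
    using nth_mem[OF that] unfolding ps(1) by (auto simp: x_def w_def)
  have idx: "\<exists>t<length ps. w t = Suc k \<and> x t = y" if "k < c" "y \<in> level A k" for k y
  proof -
    have "(Suc k, y) \<in> set ps" unfolding ps(1) using that by blast
    then show ?thesis by (auto simp: in_set_conv_nth x_def w_def)
  qed
  have "weighted_letters G x w (length ps) c"
  proof (unfold_locales)
    show "w s \<le> w t" if "s \<le> t" "t < length ps" for s t
      using sorted_nth_mono[OF ps(2), of s t] that by (simp add: w_def)
    show "1 \<le> w t" "w t \<le> c" if "t < length ps" for t
      using letter[OF that] by auto
    show "x t \<in> lower_central G (w t)" if "t < length ps" for t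
    proof -
      obtain k where "w t = Suc k" "x t \<in> level A k" using letter[OF \<open>t < length ps\<close>] by blast
      then show ?thesis using level_lower_central[OF A(2), of k] by auto
    qed
    show "lower_central G j = generate G (x ` {t. t < length ps \<and> j \<le> w t})" if "j \<ge> 1" for j
    proof -
      obtain i where j: "j = Suc i" using \<open>j \<ge> 1\<close> by (cases j) auto
      have "x ` {t. t < length ps \<and> j \<le> w t} = (\<Union>k\<in>{i..<c}. level A k)"
        using letter idx unfolding j by (fastforce simp: image_iff)
      then show ?thesis using lower_central_levels[OF A(2,3) c] j by simp
    qed
    show "\<exists>s r. s < length ps \<and> r < length ps \<and> w s = w t - 1 \<and> w r = 1 \<and> x t = comm (x s) (x r)"
      if t: "t < length ps" "1 < w t" for t
    proof -
      obtain k where k: "k < c" "w t = Suc (Suc k)" "x t \<in> level A (Suc k)" "Suc k < c"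
        using letter[OF t(1)] t(2) by (metis Suc_lessD One_nat_def Suc_less_eq gr0_implies_Suc)
      then obtain y z where "y \<in> level A k" "z \<in> level A 0" "x t = comm y z" by auto
      then show ?thesis using idx[of k y] idx[of 0 z] k by fastforce
    qed
  qed
  then show ?thesis by blast
qed

section \<open>Words of small weighted length\<close>

text \<open>Merges the constants for finitely many letters into one, by summing them.\<close>

lemma uniform_constant:
  fixes P :: "'i \<Rightarrow> real \<Rightarrow> bool"
  assumes "finite I" and ex: "\<And>i. i \<in> I \<Longrightarrow> \<exists>C\<ge>0. P i C"
    and mono: "\<And>i C D. i \<in> I \<Longrightarrow> P i C \<Longrightarrow> C \<le> D \<Longrightarrow> P i D"
  shows "\<exists>C\<ge>0. \<forall>i\<in>I. P i C"
proof -
  obtain F where F: "\<And>i. i \<in> I \<Longrightarrow> F i \<ge> 0" "\<And>i. i \<in> I \<Longrightarrow> P i (F i)"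
    using ex by metis
  have "F i \<le> sum F I" if "i \<in> I" for i
    by (rule member_le_sum) (use that F \<open>finite I\<close> in auto)
  moreover have "sum F I \<ge> 0" using F(1) by (rule sum_nonneg)
  ultimately show ?thesis using F(2) mono by blast
qed

context weighted_letters
begin

text \<open>Weighted word length at the scale \<open>L\<close>: the element is a product of letters with
  index at least \<open>t\<close> and their inverses for which the sum of \<open>1 / L ^ weight\<close> is at most \<open>\<mu>\<close>.
  The slack in \<open>\<mu>\<close> makes the predicate monotone.\<close>

inductive light :: "nat \<Rightarrow> real \<Rightarrow> 'a \<Rightarrow> real \<Rightarrow> bool" for t L where
  light_one: "0 \<le> \<mu> \<Longrightarrow> light t L \<one> \<mu>"
| light_snoc: "light t L g \<mu> \<Longrightarrow> t \<le> s \<Longrightarrow> s < M \<Longrightarrow> e \<in> {x s, inv (x s)} \<Longrightarrow>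
    \<mu> + 1 / L ^ w s \<le> \<nu> \<Longrightarrow> light t L (g \<otimes> e) \<nu>"

lemma letter_closed [simp]: "t < M \<Longrightarrow> x t \<in> carrier G"
  using letter_in lower_central_carrier by blast

lemma light_carrier: "light t L g \<mu> \<Longrightarrow> g \<in> carrier G"
  by (induction rule: light.induct) auto

lemma light_mono: "light t L g \<mu> \<Longrightarrow> \<mu> \<le> \<nu> \<Longrightarrow> light t L g \<nu>"
proof (induction arbitrary: \<nu> rule: light.induct)
  case (light_one \<mu>)
  then show ?case by (intro light.light_one) simp
next
  case (light_snoc g \<mu> s e \<nu> \<nu>')
  then show ?case by (meson light.light_snoc order_trans)
qed

lemma light_nonneg: "light t L g \<mu> \<Longrightarrow> 0 < L \<Longrightarrow> 0 \<le> \<mu>"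
proof (induction rule: light.induct)
  case (light_snoc g \<mu> s e \<nu>)
  moreover have "0 < 1 / L ^ w s" using light_snoc by simp
  ultimately show ?case by linarith
qed

lemma light_letter:
  assumes "t \<le> s" "s < M" "e \<in> {x s, inv (x s)}"
  shows "light t L e (1 / L ^ w s)"
proof -
  have "light t L (\<one> \<otimes> e) (1 / L ^ w s)"
    by (rule light_snoc[OF light_one[of 0]]) (use assms in auto)
  then show ?thesis using assms by auto
qed

lemma light_mult:
  assumes "light t L g \<mu>" "light t L h \<nu>"
  shows "light t L (g \<otimes> h) (\<mu> + \<nu>)"
  using assms(2)
proof (induction rule: light.induct)
  case (light_one \<nu>)
  then show ?case using assms(1) light_carrier by (auto intro: light_mono)
next
  case (light_snoc h \<nu> s e \<nu>')
  have "g \<otimes> (h \<otimes> e) = (g \<otimes> h) \<otimes> e"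
    using light_snoc light_carrier[OF assms(1)] light_carrier[OF light_snoc(1)] by (auto simp: m_assoc)
  then show ?case using light_snoc by (auto intro: light.light_snoc)
qed

lemma light_inv: "light t L g \<mu> \<Longrightarrow> light t L (inv g) \<mu>"
proof (induction rule: light.induct)
  case (light_one \<mu>)
  then show ?case by (auto intro: light.light_one)
next
  case (light_snoc g \<mu> s e \<nu>)
  have g: "g \<in> carrier G" "e \<in> carrier G"
    using light_carrier[OF light_snoc(1)] light_snoc by auto
  have "light t L (inv e) (1 / L ^ w s)"
    using light_snoc by (intro light_letter) auto
  from light_mult[OF this light_snoc(6)] show ?case
    using g light_snoc(5) by (auto simp: inv_mult_group intro: light_mono)
qed

lemma light_pow: "light t L g \<mu> \<Longrightarrow> light t L (g [^] (n::nat)) (real n * \<mu>)"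
proof (induction n)
  case (Suc n)
  then show ?case using light_mult[of t L "g [^] n" "real n * \<mu>" g \<mu>] by (simp add: algebra_simps)
qed (simp add: light_one)

lemma light_int_pow: 
  assumes "light t L g \<mu>"
  shows "light t L (g [^] (n::int)) (real_of_int \<bar>n\<bar> * \<mu>)"
proof (cases "n < 0")
  case True
  have "light t L (inv (g [^] nat (- n))) (nat (- n) * \<mu>)"
    by (intro light_inv light_pow assms)
  with True show ?thesis unfolding int_pow_def2 if_P[OF True] by simp
next
  case False
  have "light t L (g [^] nat n) (nat n * \<mu>)"
    by (intro light_pow assms)
  with False show ?thesis unfolding int_pow_def2 if_not_P[OF False] by simp
qed

lemma light_rescale:
  assumes "light t L g \<mu>" "0 \<le> \<kappa>" "\<And>s. t \<le> s \<Longrightarrow> s < M \<Longrightarrow> 1 / L' ^ w s \<le> \<kappa> * (1 / L ^ w s)"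
  shows "light t L' g (\<kappa> * \<mu>)"
  using assms(1)
proof (induction rule: light.induct)
  case (light_one \<mu>)
  then show ?case using assms(2) by (auto intro: light.light_one)
next
  case (light_snoc g \<mu> s e \<nu>)
  have "\<kappa> * \<mu> + 1 / L' ^ w s \<le> \<kappa> * \<mu> + \<kappa> * (1 / L ^ w s)"
    using assms(3) light_snoc by simp
  also have "\<dots> = \<kappa> * (\<mu> + 1 / L ^ w s)" by (simp add: algebra_simps)
  also have "\<dots> \<le> \<kappa> * \<nu>" using light_snoc assms(2) by (intro mult_left_mono) auto
  finally show ?case using light_snoc by (intro light.light_snoc) auto
qed

text \<open>As weights are at least 1, enlarging the scale by \<open>K\<close> divides the weighted length by \<open>K\<close> or more.\<close>

lemma light_enlarge:
  assumes "light t L g K" "1 \<le> K" "1 \<le> L"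
  shows "light t (K * L) g 1"
proof -
  have "light t (K * L) g (1 / K * K)"
  proof (rule light_rescale[OF assms(1)])
    show "1 / (K * L) ^ w q \<le> 1 / K * (1 / L ^ w q)" if "q < M" for q
    proof -
      have "K ^ 1 \<le> K ^ w q" using w_pos[OF that] assms by (intro power_increasing) auto
      then have "K * L ^ w q \<le> (K * L) ^ w q" using assms by (simp add: power_mult_distrib)
      moreover have "0 < K * L ^ w q" using assms by simp
      ultimately show ?thesis by (simp add: frac_le)
    qed
  qed (use assms in auto)
  then show ?thesis using assms by simp
qed

text \<open>The constant does not depend on the scale: at scales above 1, a letter of weight more
  than \<open>j\<close> contributes even less than one of weight \<open>j\<close>.\<close>

lemma light_generate:
  assumes "y \<in> generate G (x ` S)" "S \<subseteq> {t..<M}" "\<And>s. s \<in> S \<Longrightarrow> j \<le> w s"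
  shows "\<exists>C\<ge>0. \<forall>L\<ge>1. light t L y (C / L ^ j)"
  using assms(1)
proof induction
  case one
  show ?case by (rule exI[of _ 0]) (simp add: light_one)
next
  case (incl h)
  then obtain s where s: "h = x s" "s \<in> S" by blast
  have "light t L h (1 / L ^ j)" if "L \<ge> 1" for L
  proof (rule light_mono[OF light_letter])
    show "1 / L ^ w s \<le> 1 / L ^ j"
      using that assms(3)[OF s(2)] by (intro divide_left_mono power_increasing) auto
  qed (use s assms(2) in auto)
  then show ?case by (intro exI[of _ 1]) simp
next
  case (inv h)
  then obtain s where s: "h = x s" "s \<in> S" by blast
  have "light t L (inv h) (1 / L ^ j)" if "L \<ge> 1" for L
  proof (rule light_mono[OF light_letter])
    show "1 / L ^ w s \<le> 1 / L ^ j"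
      using that assms(3)[OF s(2)] by (intro divide_left_mono power_increasing) auto
  qed (use s assms(2) in auto)
  then show ?case by (intro exI[of _ 1]) simp
next
  case (eng g h)
  then obtain C D where "C \<ge> 0" "\<forall>L\<ge>1. light t L g (C / L ^ j)" "D \<ge> 0" "\<forall>L\<ge>1. light t L h (D / L ^ j)"
    by blast
  then show ?case
    using light_mult by (intro exI[of _ "C + D"]) (auto simp: add_divide_distrib)
qed

lemma light_lower_central:
  assumes "y \<in> lower_central G j" "j \<ge> 1" "\<And>s. s < M \<Longrightarrow> j \<le> w s \<Longrightarrow> t \<le> s"
  shows "\<exists>C\<ge>0. \<forall>L\<ge>1. light t L y (C / L ^ j)"
  using assms by (intro light_generate[where S = "{s. s < M \<and> j \<le> w s}"])
    (auto simp: lower_central_letters)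

text \<open>This is where the weights pay off: the commutator of two letters contributes at most a
  multiple of the product of their contributions, so conjugation by a letter multiplies the
  weighted length of \<^emph>\<open>every\<close> word by at most one plus a multiple of the contribution of
  that letter.\<close>

lemma light_conj_letter:
  assumes "t < M" and later: "\<And>s. s < M \<Longrightarrow> w t < w s \<Longrightarrow> u \<le> s"
  shows "\<exists>C\<ge>0. \<forall>e\<in>{x t, inv (x t)}. \<forall>L\<ge>1. \<forall>g \<mu>. light u L g \<mu> \<longrightarrow>
    light u L (inv e \<otimes> g \<otimes> e) ((1 + C / L ^ w t) * \<mu>)"
proof (rule uniform_constant)
  fix e assume e: "e \<in> {x t, inv (x t)}"
  have ec: "e \<in> carrier G" and e_in: "inv e \<in> lower_central G (w t)"
    using e assms(1) letter_in lower_central_inv by auto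
  let ?P = "\<lambda>(s, f) C. \<forall>L\<ge>1. light u L (comm (inv e) f) (C / L ^ (w t + w s))"
  let ?I = "SIGMA s:{..<M}. {x s, inv (x s)}"
  have "\<exists>C\<ge>0. \<forall>sf\<in>?I. ?P sf C"
  proof (rule uniform_constant)
    fix sf assume "sf \<in> ?I"
    then obtain s f where sf: "sf = (s, f)" "s < M" "f \<in> {x s, inv (x s)}" by blast
    have "\<exists>C\<ge>0. \<forall>L\<ge>1. light u L (comm (inv e) f) (C / L ^ (w t + w s))"
    proof (rule light_lower_central)
      have "f \<in> lower_central G (w s)" using sf letter_in lower_central_inv by auto
      then show "comm (inv e) f \<in> lower_central G (w t + w s)"
        using comm_lower_central[OF w_pos[OF assms(1)] w_pos[OF sf(2)] e_in] by blast
      show "1 \<le> w t + w s" using w_pos[OF assms(1)] by simp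
      show "u \<le> r" if "r < M" "w t + w s \<le> w r" for r
        using later[OF that(1)] that(2) w_pos[OF \<open>s < M\<close>] by linarith
    qed
    then show "\<exists>C\<ge>0. ?P sf C" by (simp add: sf(1))
  next
    fix sf :: "nat \<times> 'a" and C D :: real assume "?P sf C" "C \<le> D"
    moreover have "C / L ^ n \<le> D / L ^ n" if "L \<ge> 1" for L :: real and n
      using \<open>C \<le> D\<close> that by (intro divide_right_mono) auto
    ultimately show "?P sf D" unfolding case_prod_beta by (meson light_mono)
  qed auto
  then obtain C where C0: "C \<ge> 0" and C: "\<And>s f L. s < M \<Longrightarrow> f \<in> {x s, inv (x s)} \<Longrightarrow> L \<ge> 1 \<Longrightarrow>
    light u L (comm (inv e) f) (C / L ^ (w t + w s))" by fastforce
  \<comment> \<open>Each letter \<open>f\<close> of the word turns into \<open>[e\<^sup>-\<^sup>1, f] f\<close>.\<close>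
  have "light u L (inv e \<otimes> g \<otimes> e) ((1 + C / L ^ w t) * \<mu>)" if "L \<ge> 1" "light u L g \<mu>" for L g \<mu>
    using that(2)
  proof (induction rule: light.induct)
    case (light_one \<mu>)
    have "inv e \<otimes> \<one> \<otimes> e = \<one>" using ec by simp
    then show ?case using light_one C0 \<open>L \<ge> 1\<close> by (simp add: light.light_one)
  next
    case (light_snoc g \<mu> s f \<nu>)
    have fg: "f \<in> carrier G" "g \<in> carrier G" using light_snoc light_carrier by auto
    have f: "light u L f (1 / L ^ w s)" using light_snoc by (intro light_letter) auto
    have "light u L ((inv e \<otimes> g \<otimes> e) \<otimes> (comm (inv e) f \<otimes> f))
       ((1 + C / L ^ w t) * \<mu> + (C / L ^ (w t + w s) + 1 / L ^ w s))"
      by (intro light_mult light_snoc C \<open>L \<ge> 1\<close> f)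
    moreover have "(inv e \<otimes> g \<otimes> e) \<otimes> (comm (inv e) f \<otimes> f) = inv e \<otimes> (g \<otimes> f) \<otimes> e"
      using ec fg by (simp add: group_word)
    moreover have "(1 + C / L ^ w t) * \<mu> + (C / L ^ (w t + w s) + 1 / L ^ w s)
       = (1 + C / L ^ w t) * (\<mu> + 1 / L ^ w s)"
      using \<open>L \<ge> 1\<close> by (simp add: field_simps power_add)
    moreover have "\<dots> \<le> (1 + C / L ^ w t) * \<nu>"
      using light_snoc C0 \<open>L \<ge> 1\<close> by (intro mult_left_mono) auto
    ultimately show ?case using light_mono by metis
  qed
  then show "\<exists>C\<ge>0. \<forall>L\<ge>1. \<forall>g \<mu>. light u L g \<mu> \<longrightarrow> light u L (inv e \<otimes> g \<otimes> e) ((1 + C / L ^ w t) * \<mu>)"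
    using C0 by blast
next
  fix e and C D :: real
  assume C: "\<forall>L\<ge>1. \<forall>g \<mu>. light u L g \<mu> \<longrightarrow> light u L (inv e \<otimes> g \<otimes> e) ((1 + C / L ^ w t) * \<mu>)" "C \<le> D"
  have "light u L (inv e \<otimes> g \<otimes> e) ((1 + D / L ^ w t) * \<mu>)" if "L \<ge> 1" "light u L g \<mu>" for L g \<mu>
  proof (rule light_mono)
    show "light u L (inv e \<otimes> g \<otimes> e) ((1 + C / L ^ w t) * \<mu>)" using C(1) that by blast
    show "(1 + C / L ^ w t) * \<mu> \<le> (1 + D / L ^ w t) * \<mu>"
      using C(2) that light_nonneg[OF that(2)] by (intro mult_right_mono) (auto intro: divide_right_mono)
  qed
  then show "\<forall>L\<ge>1. \<forall>g \<mu>. light u L g \<mu> \<longrightarrow> light u L (inv e \<otimes> g \<otimes> e) ((1 + D / L ^ w t) * \<mu>)" by blast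
qed simp

text \<open>The bound for one letter in exponential form, which multiplies along a conjugating word.\<close>

lemma light_conj_letter_exp:
  assumes "t < M" and later: "\<And>s. s < M \<Longrightarrow> w t < w s \<Longrightarrow> u \<le> s"
  shows "\<exists>C\<ge>0. \<forall>e\<in>{x t, inv (x t)}. \<forall>L\<ge>1. \<forall>g \<mu>. light u L g \<mu> \<longrightarrow>
    light u L (inv e \<otimes> g \<otimes> e) (exp (C / L ^ w t) * \<mu>)"
proof -
  obtain C where C0: "C \<ge> 0" and C: "\<And>e L g \<mu>. e \<in> {x t, inv (x t)} \<Longrightarrow> L \<ge> 1 \<Longrightarrow> light u L g \<mu> \<Longrightarrow>
    light u L (inv e \<otimes> g \<otimes> e) ((1 + C / L ^ w t) * \<mu>)"
    using light_conj_letter[OF assms] by blast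
  have "light u L (inv e \<otimes> g \<otimes> e) (exp (C / L ^ w t) * \<mu>)"
    if "e \<in> {x t, inv (x t)}" "L \<ge> 1" "light u L g \<mu>" for e L g \<mu>
  proof (rule light_mono[OF C[OF that]])
    show "(1 + C / L ^ w t) * \<mu> \<le> exp (C / L ^ w t) * \<mu>"
      using exp_ge_add_one_self light_nonneg[OF that(3)] that(2) by (intro mult_right_mono) auto
  qed
  then show ?thesis using C0 by blast
qed

lemma light_conj:
  "\<exists>C\<ge>0. \<forall>L\<ge>1. \<forall>g \<mu> h \<nu>. light 0 L h \<nu> \<longrightarrow> light 0 L g \<mu> \<longrightarrow>
     light 0 L (inv h \<otimes> g \<otimes> h) (exp (C * \<nu>) * \<mu>)"
proof -
  let ?P = "\<lambda>t C. \<forall>e\<in>{x t, inv (x t)}. \<forall>L\<ge>1. \<forall>g \<mu>. light 0 L g \<mu> \<longrightarrow>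
    light 0 L (inv e \<otimes> g \<otimes> e) (exp (C / L ^ w t) * \<mu>)"
  have "\<exists>C\<ge>0. \<forall>t\<in>{..<M}. ?P t C"
  proof (rule uniform_constant)
    show "\<exists>C\<ge>0. ?P t C" if "t \<in> {..<M}" for t
      using light_conj_letter_exp[of t 0] that by blast
    fix t and C D :: real assume P: "?P t C" "C \<le> D"
    have "light 0 L (inv e \<otimes> g \<otimes> e) (exp (D / L ^ w t) * \<mu>)"
      if "e \<in> {x t, inv (x t)}" "L \<ge> 1" "light 0 L g \<mu>" for e L g \<mu>
    proof (rule light_mono)
      show "light 0 L (inv e \<otimes> g \<otimes> e) (exp (C / L ^ w t) * \<mu>)" using P(1) that by blast
      show "exp (C / L ^ w t) * \<mu> \<le> exp (D / L ^ w t) * \<mu>"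
        using P(2) that light_nonneg[OF that(3)] by (intro mult_right_mono) (auto intro: divide_right_mono)
    qed
    then show "?P t D" by blast
  qed simp
  then obtain C where C0: "C \<ge> 0" and C: "\<And>t e L g \<mu>. t < M \<Longrightarrow> e \<in> {x t, inv (x t)} \<Longrightarrow> L \<ge> 1 \<Longrightarrow>
    light 0 L g \<mu> \<Longrightarrow> light 0 L (inv e \<otimes> g \<otimes> e) (exp (C / L ^ w t) * \<mu>)"
    by blast
  have "light 0 L (inv h \<otimes> g \<otimes> h) (exp (C * \<nu>) * \<mu>)" if L: "L \<ge> 1" and g: "light 0 L g \<mu>" and h: "light 0 L h \<nu>"
    for L g \<mu> h \<nu>
    using h
  proof (induction rule: light.induct)
    case (light_one \<nu>)
    have "\<mu> \<le> exp (C * \<nu>) * \<mu>"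
      using light_nonneg[OF g] L light_one C0 by (simp add: mult_le_cancel_right1)
    then show ?case using g light_carrier[OF g] light_mono by auto
  next
    case (light_snoc h \<nu> s f \<nu>')
    have car: "f \<in> carrier G" "h \<in> carrier G" "g \<in> carrier G" using light_snoc light_carrier g by auto
    have "light 0 L (inv f \<otimes> (inv h \<otimes> g \<otimes> h) \<otimes> f) (exp (C / L ^ w s) * (exp (C * \<nu>) * \<mu>))"
      using C[OF \<open>s < M\<close> light_snoc(4) L] light_snoc by blast
    moreover have "exp (C / L ^ w s) * (exp (C * \<nu>) * \<mu>) \<le> exp (C * \<nu>') * \<mu>"
    proof -
      have "exp (C / L ^ w s) * (exp (C * \<nu>) * \<mu>) = exp (C * (\<nu> + 1 / L ^ w s)) * \<mu>"
        by (simp add: exp_add[symmetric] algebra_simps)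
      also have "\<dots> \<le> exp (C * \<nu>') * \<mu>"
        using light_snoc C0 light_nonneg[OF g] L by (intro mult_right_mono) (auto simp: mult_left_mono)
      finally show ?thesis .
    qed
    moreover have "inv f \<otimes> (inv h \<otimes> g \<otimes> h) \<otimes> f = inv (h \<otimes> f) \<otimes> g \<otimes> (h \<otimes> f)"
      using car by (simp add: group_word)
    ultimately show ?case using light_mono by metis
  qed
  then show ?thesis using C0 by blast
qed

text \<open>Collection of the first letter: each of its occurrences is moved to the front, which
  conjugates what it passes. There are at most \<open>\<mu> L\<^sup>w\<close> occurrences and each costs a factor
  \<open>exp (C / L\<^sup>w)\<close>, so that the total cost depends on \<open>\<mu>\<close> but not on the scale.\<close>

lemma light_collect:
  assumes "t < M"
  shows "\<exists>C\<ge>0. \<forall>L\<ge>1. \<forall>g \<mu>. light t L g \<mu> \<longrightarrow>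
    (\<exists>p::int. \<exists>h. g = x t [^] p \<otimes> h \<and> real_of_int \<bar>p\<bar> / L ^ w t \<le> \<mu> \<and> light (Suc t) L h (exp (C * \<mu>) * \<mu>))"
proof -
  have "Suc t \<le> s" if "s < M" "w t < w s" for s
    using w_mono[of s t] that assms by (meson leD not_less_eq_eq)
  then obtain C where C0: "C \<ge> 0" and conj: "\<And>e L g \<mu>. e \<in> {x t, inv (x t)} \<Longrightarrow> L \<ge> 1 \<Longrightarrow>
    light (Suc t) L g \<mu> \<Longrightarrow> light (Suc t) L (inv e \<otimes> g \<otimes> e) (exp (C / L ^ w t) * \<mu>)"
    using light_conj_letter_exp[OF assms, of "Suc t"] by blast
  have xt: "x t \<in> carrier G" using assms by simp
  have "\<exists>p::int. \<exists>h. g = x t [^] p \<otimes> h \<and> real_of_int \<bar>p\<bar> / L ^ w t \<le> \<mu> \<and> light (Suc t) L h (exp (C * \<mu>) * \<mu>)"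
    if L: "L \<ge> 1" and "light t L g \<mu>" for L g \<mu>
    using that(2)
  proof (induction rule: light.induct)
    case (light_one \<mu>)
    then show ?case
      by (intro exI[of _ "0::int"] exI[of _ "\<one>"]) (simp add: light.light_one int_pow_def2)
  next
    case (light_snoc g \<mu> s f \<nu>)
    then obtain p :: int and h where ph: "g = x t [^] p \<otimes> h" "real_of_int \<bar>p\<bar> / L ^ w t \<le> \<mu>"
      "light (Suc t) L h (exp (C * \<mu>) * \<mu>)" by blast
    have \<mu>: "0 \<le> \<mu>" using light_nonneg[OF light_snoc(1)] L by simp
    have Lw: "0 < 1 / L ^ w s" using L by simp
    have \<mu>_le: "\<mu> \<le> \<nu>" using Lw light_snoc(5) by linarith
    have h: "h \<in> carrier G" using ph(3) light_carrier by blast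
    have f: "f \<in> carrier G" using light_snoc by auto
    show ?case
    proof (cases "s = t")
      case True
      obtain q :: int where q: "f = x t [^] q" "\<bar>q\<bar> = 1"
      proof (cases "f = x t")
        case True
        then show ?thesis using that[of 1] xt by simp
      next
        case False
        then have "f = inv (x t)" using light_snoc(4) \<open>s = t\<close> by simp
        then show ?thesis using that[of "-1"] xt by (simp add: int_pow_neg)
      qed
      have "light (Suc t) L (inv f \<otimes> h \<otimes> f) (exp (C / L ^ w t) * (exp (C * \<mu>) * \<mu>))"
        using conj[of f L h] light_snoc(4) True L ph(3) by simp
      moreover have "exp (C / L ^ w t) * (exp (C * \<mu>) * \<mu>) \<le> exp (C * \<nu>) * \<nu>"
      proof -
        have "exp (C / L ^ w t) * (exp (C * \<mu>) * \<mu>) = exp (C * (\<mu> + 1 / L ^ w t)) * \<mu>"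
          by (simp add: exp_add[symmetric] algebra_simps)
        also have "\<dots> \<le> exp (C * \<nu>) * \<nu>"
          using light_snoc(5) True C0 \<mu> \<mu>_le by (intro mult_mono) (auto intro: mult_left_mono)
        finally show ?thesis .
      qed
      moreover have "g \<otimes> f = x t [^] (p + q) \<otimes> (inv f \<otimes> h \<otimes> f)"
      proof -
        have "x t [^] (p + q) = x t [^] p \<otimes> f" using q xt by (simp add: int_pow_mult)
        then show ?thesis using ph(1) h f xt by (simp add: m_assoc)
      qed
      moreover have "\<bar>p + q\<bar> / L ^ w t \<le> \<nu>"
      proof -
        have "real_of_int \<bar>p + q\<bar> \<le> \<bar>p\<bar> + 1" using q(2) by linarith
        then have "\<bar>p + q\<bar> / L ^ w t \<le> (\<bar>p\<bar> + 1) / L ^ w t"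
          using L by (intro divide_right_mono) auto
        also have "\<dots> \<le> \<nu>" using ph(2) light_snoc(5) True by (simp add: add_divide_distrib)
        finally show ?thesis .
      qed
      ultimately show ?thesis using light_mono by blast
    next
      case False
      have "light (Suc t) L (h \<otimes> f) (exp (C * \<nu>) * \<nu>)"
      proof (rule light.light_snoc[OF ph(3) _ _ light_snoc(4)])
        have "exp (C * \<mu>) * \<mu> + 1 / L ^ w s \<le> exp (C * \<nu>) * \<mu> + exp (C * \<nu>) * (1 / L ^ w s)"
        proof (rule add_mono)
          show "exp (C * \<mu>) * \<mu> \<le> exp (C * \<nu>) * \<mu>"
            using \<mu> \<mu>_le C0 by (intro mult_right_mono) (auto intro: mult_left_mono)
          have "1 \<le> exp (C * \<nu>)" using \<mu> \<mu>_le C0 by simp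
          then have "1 * (1 / L ^ w s) \<le> exp (C * \<nu>) * (1 / L ^ w s)"
            using Lw by (intro mult_right_mono) auto
          then show "1 / L ^ w s \<le> exp (C * \<nu>) * (1 / L ^ w s)" by simp
        qed
        also have "\<dots> = exp (C * \<nu>) * (\<mu> + 1 / L ^ w s)" by (simp add: algebra_simps)
        also have "\<dots> \<le> exp (C * \<nu>) * \<nu>" using light_snoc(5) by (intro mult_left_mono) auto
        finally show "exp (C * \<mu>) * \<mu> + 1 / L ^ w s \<le> exp (C * \<nu>) * \<nu>" .
      qed (use False light_snoc in auto)
      moreover have "g \<otimes> f = x t [^] p \<otimes> (h \<otimes> f)" using ph(1) h f xt by (simp add: m_assoc)
      moreover have "real_of_int \<bar>p\<bar> / L ^ w t \<le> \<nu>" using ph(2) light_snoc(5) Lw by linarith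
      ultimately show ?thesis by blast
    qed
  qed
  then show ?thesis using C0 by blast
qed

end

section \<open>Congruences modulo the lower central series\<close>

context group
begin

definition cong_lc :: "nat \<Rightarrow> 'a \<Rightarrow> 'a \<Rightarrow> bool" where
  "cong_lc k a b \<longleftrightarrow> a \<in> carrier G \<and> b \<in> carrier G \<and> inv a \<otimes> b \<in> lower_central G k"

lemma cong_lc_refl: "a \<in> carrier G \<Longrightarrow> cong_lc k a a"
  by (simp add: cong_lc_def lower_central_one)

lemma cong_lc_sym: "cong_lc k a b \<Longrightarrow> cong_lc k b a"
  unfolding cong_lc_def using lower_central_inv[of "inv a \<otimes> b" k] by (auto simp: inv_mult_group)

lemma cong_lc_trans [trans]: "cong_lc k a b \<Longrightarrow> cong_lc k b c \<Longrightarrow> cong_lc k a c"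
  unfolding cong_lc_def using lower_central_mult[of "inv a \<otimes> b" k "inv b \<otimes> c"] by (auto simp: m_assoc)

lemma cong_lc_mult: 
  assumes "cong_lc k a b" "cong_lc k c d"
  shows "cong_lc k (a \<otimes> c) (b \<otimes> d)"
proof -
  have car: "a \<in> carrier G" "b \<in> carrier G" "c \<in> carrier G" "d \<in> carrier G"
    using assms by (auto simp: cong_lc_def)
  have "inv c \<otimes> (inv a \<otimes> b) \<otimes> c \<in> lower_central G k"
    using assms by (auto simp: cong_lc_def intro: lower_central_conj')
  then have "(inv c \<otimes> (inv a \<otimes> b) \<otimes> c) \<otimes> (inv c \<otimes> d) \<in> lower_central G k"
    using assms(2) by (auto simp: cong_lc_def intro: lower_central_mult)
  moreover have "(inv c \<otimes> (inv a \<otimes> b) \<otimes> c) \<otimes> (inv c \<otimes> d) = inv (a \<otimes> c) \<otimes> (b \<otimes> d)"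
    using car by (simp add: group_word)
  ultimately show ?thesis using car by (simp add: cong_lc_def)
qed

lemma cong_lc_inv:
  assumes "cong_lc k a b" shows "cong_lc k (inv a) (inv b)"
proof -
  have car: "a \<in> carrier G" "b \<in> carrier G" and "inv b \<otimes> a \<in> lower_central G k"
    using assms cong_lc_sym[OF assms] by (auto simp: cong_lc_def)
  then have "b \<otimes> (inv b \<otimes> a) \<otimes> inv b \<in> lower_central G k" using lower_central_conj by blast
  then show ?thesis using car by (simp add: cong_lc_def group_word)
qed

lemma cong_lc_pow: "cong_lc k a b \<Longrightarrow> cong_lc k (a [^] (n::nat)) (b [^] n)"
  by (induction n) (auto intro: cong_lc_mult cong_lc_refl)

lemma cong_lc_one: "d \<in> lower_central G k \<Longrightarrow> cong_lc k \<one> d"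
  using lower_central_carrier by (auto simp: cong_lc_def)

lemma cong_lc_swap:
  assumes "a \<in> lower_central G j" "b \<in> carrier G" "1 \<le> j"
  shows "cong_lc (Suc j) (a \<otimes> b) (b \<otimes> a)"
proof -
  have a: "a \<in> carrier G" using assms lower_central_carrier by blast
  have "comm (inv a) (inv b) \<in> lower_central G (Suc j)"
    using assms by (intro comm_lower_central_1) (auto intro: lower_central_inv)
  then have "inv (comm (inv a) (inv b)) \<in> lower_central G (Suc j)"
    by (rule lower_central_inv)
  moreover have "inv (comm (inv a) (inv b)) = inv (a \<otimes> b) \<otimes> (b \<otimes> a)"
    using a assms by (simp add: group_word)
  ultimately show ?thesis using a assms by (simp add: cong_lc_def)
qed

lemma cong_lc_conj:
  assumes "a \<in> lower_central G j" "b \<in> carrier G" "1 \<le> j"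
  shows "cong_lc (Suc j) (b \<otimes> a \<otimes> inv b) a"
proof -
  have a: "a \<in> carrier G" using assms lower_central_carrier by blast
  have "cong_lc (Suc j) (b \<otimes> a \<otimes> inv b) (a \<otimes> b \<otimes> inv b)"
    by (rule cong_lc_mult[OF cong_lc_sym[OF cong_lc_swap[OF assms]] cong_lc_refl]) (use assms(2) in simp)
  then show ?thesis using a assms by (simp add: m_assoc)
qed

context
  fixes j :: nat assumes j: "1 \<le> j"
begin

lemma comm_mult_right_cong:
  assumes "y \<in> lower_central G j" "k \<in> carrier G" "l \<in> carrier G"
  shows "cong_lc (Suc (Suc j)) (comm y (k \<otimes> l)) (comm y k \<otimes> comm y l)"
proof -
  have y: "y \<in> carrier G" using assms lower_central_carrier by blast
  show ?thesis unfolding comm_mult_right[OF y assms(2,3)]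
    using assms y j by (intro cong_lc_mult cong_lc_refl cong_lc_conj comm_lower_central_1) auto
qed

lemma comm_mult_left_cong:
  assumes "y \<in> lower_central G j" "y' \<in> lower_central G j" "k \<in> carrier G"
  shows "cong_lc (Suc (Suc j)) (comm (y \<otimes> y') k) (comm y k \<otimes> comm y' k)"
proof -
  have y: "y \<in> carrier G" "y' \<in> carrier G" using assms lower_central_carrier by auto
  have "cong_lc (Suc (Suc j)) (comm (y \<otimes> y') k) (comm y' k \<otimes> comm y k)"
    unfolding comm_mult_left[OF y assms(3)]
    using assms y j by (intro cong_lc_mult cong_lc_refl cong_lc_conj comm_lower_central_1) auto
  also have "cong_lc (Suc (Suc j)) (comm y' k \<otimes> comm y k) (comm y k \<otimes> comm y' k)"
    using assms y j by (intro cong_lc_swap comm_lower_central_1) auto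
  finally show ?thesis .
qed

lemma comm_pow_right_cong:
  assumes "y \<in> lower_central G j" "k \<in> carrier G"
  shows "cong_lc (Suc (Suc j)) (comm y (k [^] (n::nat))) (comm y k [^] n)"
proof (induction n)
  case 0
  have "y \<in> carrier G" using assms lower_central_carrier by blast
  then show ?case using cong_lc_refl by (simp add: comm_def)
next
  case (Suc n)
  have y: "y \<in> carrier G" using assms lower_central_carrier by blast
  have "cong_lc (Suc (Suc j)) (comm y (k [^] n \<otimes> k)) (comm y (k [^] n) \<otimes> comm y k)"
    using assms by (intro comm_mult_right_cong) auto
  also have "cong_lc (Suc (Suc j)) (comm y (k [^] n) \<otimes> comm y k) (comm y k [^] n \<otimes> comm y k)"
    using assms y by (intro cong_lc_mult Suc cong_lc_refl) auto
  finally show ?case by simp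
qed

lemma comm_pow_left_cong:
  assumes "y \<in> lower_central G j" "k \<in> carrier G"
  shows "cong_lc (Suc (Suc j)) (comm (y [^] (n::nat)) k) (comm y k [^] n)"
proof (induction n)
  case 0
  show ?case using assms cong_lc_refl by (simp add: comm_def)
next
  case (Suc n)
  have y: "y \<in> carrier G" using assms lower_central_carrier by blast
  have "cong_lc (Suc (Suc j)) (comm (y [^] n \<otimes> y) k) (comm (y [^] n) k \<otimes> comm y k)"
    using assms by (intro comm_mult_left_cong lower_central_pow) auto
  also have "cong_lc (Suc (Suc j)) (comm (y [^] n) k \<otimes> comm y k) (comm y k [^] n \<otimes> comm y k)"
    using assms y by (intro cong_lc_mult Suc cong_lc_refl) auto
  finally show ?case by simp
qed

text \<open>A power \<open>[y, z]\<^sup>a\<^sup>Q\<^sup>+\<^sup>b\<close> costs only a commutator in \<open>u \<equiv> y\<^sup>a\<close> and \<open>z\<^sup>Q\<close> and a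
  commutator in \<open>y\<close> and \<open>z\<^sup>b\<close>.\<close>

lemma comm_pow_cong:
  fixes a b Q :: nat
  assumes y: "y \<in> lower_central G j" and z: "z \<in> carrier G" and u: "u \<in> carrier G"
    and d: "inv u \<otimes> y [^] a \<in> lower_central G (Suc j)"
  shows "cong_lc (Suc (Suc j)) (comm u (z [^] Q) \<otimes> comm y (z [^] b)) (comm y z [^] (a * Q + b))"
proof -
  define e where "e = inv (inv u \<otimes> y [^] a)"
  have yc: "y \<in> carrier G" using y lower_central_carrier by blast
  have e: "e \<in> lower_central G (Suc j)" unfolding e_def using d by (rule lower_central_inv)
  have ec: "e \<in> carrier G" using e lower_central_carrier by blast
  have u_eq: "u = y [^] a \<otimes> e" using u yc by (simp add: e_def group_word)
  have ej: "e \<in> lower_central G j" using e lower_central_antimono[of j "Suc j"] by auto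
  have "cong_lc (Suc (Suc j)) (comm u (z [^] Q)) (comm (y [^] a) (z [^] Q) \<otimes> comm e (z [^] Q))"
    unfolding u_eq using y ej z by (intro comm_mult_left_cong lower_central_pow) auto
  also have "cong_lc (Suc (Suc j)) (comm (y [^] a) (z [^] Q) \<otimes> comm e (z [^] Q)) (comm (y [^] a) (z [^] Q) \<otimes> \<one>)"
    using e yc z by (intro cong_lc_mult cong_lc_refl cong_lc_sym[OF cong_lc_one] comm_lower_central_1) auto
  also have "comm (y [^] a) (z [^] Q) \<otimes> \<one> = comm (y [^] a) (z [^] Q)" using yc z by simp
  also have "cong_lc (Suc (Suc j)) (comm (y [^] a) (z [^] Q)) (comm (y [^] a) z [^] Q)"
    using y z by (intro comm_pow_right_cong lower_central_pow) auto
  also have "cong_lc (Suc (Suc j)) (comm (y [^] a) z [^] Q) ((comm y z [^] a) [^] Q)"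
    using y z by (intro cong_lc_pow comm_pow_left_cong) auto
  also have "(comm y z [^] a) [^] Q = comm y z [^] (a * Q)" using yc z by (simp add: nat_pow_pow)
  finally have "cong_lc (Suc (Suc j)) (comm u (z [^] Q) \<otimes> comm y (z [^] b)) (comm y z [^] (a * Q) \<otimes> comm y z [^] b)"
    using y z by (intro cong_lc_mult comm_pow_right_cong) auto
  then show ?thesis using yc z by (simp add: nat_pow_mult)
qed

end
end

section \<open>Word length and weighted length\<close>

context weighted_letters
begin

text \<open>These subgroups refine the lower central series to a series with cyclic factors.\<close>

definition tail :: "nat \<Rightarrow> 'a set" where
  "tail t = generate G (x ` {t..<M})"

lemma tail_subgroup: "subgroup (tail t) G"
  unfolding tail_def by (rule generate_is_subgroup) auto

lemma tail_M: "tail M = {\<one>}"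
  by (simp add: tail_def generate_empty)

lemma tail_antimono: "s \<le> t \<Longrightarrow> tail t \<subseteq> tail s"
  unfolding tail_def by (rule mono_generate) auto

lemma light_in_tail: "light t L g \<mu> \<Longrightarrow> g \<in> tail t"
proof (induction rule: light.induct)
  case (light_one \<mu>)
  then show ?case by (simp add: tail_def generate.one)
next
  case (light_snoc g \<mu> s e \<nu>)
  then have "e \<in> tail t" unfolding tail_def by (auto intro: generate.incl generate.inv)
  then show ?case using light_snoc subgroup.m_closed[OF tail_subgroup] by blast
qed

definition first :: "nat \<Rightarrow> nat" where
  "first j = (LEAST t. t \<ge> M \<or> j \<le> w t)"

lemma first_iff: "s < M \<Longrightarrow> first j \<le> s \<longleftrightarrow> j \<le> w s"
proof
  assume s: "s < M"
  have F: "first j \<ge> M \<or> j \<le> w (first j)"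
    unfolding first_def by (rule LeastI[of _ M]) simp
  show "j \<le> w s" if "first j \<le> s"
    using F w_mono[OF that s] that s by linarith
  show "first j \<le> s" if "j \<le> w s"
    unfolding first_def by (rule Least_le) (use that in simp)
qed

lemma first_le: "first j \<le> M"
  unfolding first_def by (rule Least_le) simp

lemma tail_first: "j \<ge> 1 \<Longrightarrow> tail (first j) = lower_central G j"
proof -
  assume "j \<ge> 1"
  moreover have "{first j..<M} = {t. t < M \<and> j \<le> w t}" using first_iff by auto
  ultimately show ?thesis by (simp add: tail_def lower_central_letters)
qed

lemma tail_0: "tail 0 = carrier G"
proof -
  have "first 1 = 0" using first_iff[of 0 1] w_pos[of 0] first_le[of 1] by (cases "M = 0") auto
  then show ?thesis using tail_first[of 1] by simp
qed

lemma tail_le_lower_central: "t < M \<Longrightarrow> tail t \<subseteq> lower_central G (w t)"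
  using tail_antimono[of "first (w t)" t] first_iff[of t "w t"] tail_first[of "w t"] w_pos[of t] by simp

lemma lower_central_le_tail: "t < M \<Longrightarrow> lower_central G (Suc (w t)) \<subseteq> tail (Suc t)"
proof -
  assume t: "t < M"
  have "Suc t \<le> first (Suc (w t))"
  proof (rule ccontr)
    assume "\<not> Suc t \<le> first (Suc (w t))"
    then have "first (Suc (w t)) \<le> t" by simp
    then show False using first_iff[OF t] by auto
  qed
  then show ?thesis using tail_antimono tail_first[of "Suc (w t)"] by auto
qed

text \<open>Split off the power \<open>x\<^sub>t\<^sup>p\<close> that collection produces. It lies in the next subgroup as well,
  so \<open>p\<close> is a multiple of the order \<open>m\<close> of \<open>x\<^sub>t\<close> modulo that subgroup (or zero, if the order is
  infinite), and \<open>x\<^sub>t\<^sup>m\<close> can be replaced by a fixed word in later letters. These weigh no more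
  than \<open>x\<^sub>t\<close> because the letters are sorted.\<close>

lemma light_tail_step:
  assumes t: "t < M"
  shows "\<exists>C\<ge>0. \<forall>L\<ge>1. \<forall>g \<mu>. light t L g \<mu> \<longrightarrow> \<mu> \<le> K \<longrightarrow> g \<in> tail (Suc t) \<longrightarrow> light (Suc t) L g (C * \<mu>)"
proof -
  obtain C where C: "C \<ge> 0" "\<And>L g \<mu>. L \<ge> 1 \<Longrightarrow> light t L g \<mu> \<Longrightarrow>
    (\<exists>p::int. \<exists>h. g = x t [^] p \<otimes> h \<and> real_of_int \<bar>p\<bar> / L ^ w t \<le> \<mu> \<and> light (Suc t) L h (exp (C * \<mu>) * \<mu>))"
    using light_collect[OF t] by blast
  have xt: "x t \<in> carrier G" using t by simp
  note sg = tail_subgroup[of "Suc t"]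
  obtain C' where C': "C' \<ge> 0" "\<And>L p \<mu>. L \<ge> 1 \<Longrightarrow> x t [^] (p::int) \<in> tail (Suc t) \<Longrightarrow>
    real_of_int \<bar>p\<bar> / L ^ w t \<le> \<mu> \<Longrightarrow> light (Suc t) L (x t [^] p) (C' * \<mu>)"
  proof (cases "\<exists>m>0. x t [^] (m::nat) \<in> tail (Suc t)")
    case True
    define m where "m = (LEAST m. 0 < m \<and> x t [^] (m::nat) \<in> tail (Suc t))"
    have m: "0 < m" "x t [^] m \<in> tail (Suc t)"
      using LeastI_ex[OF True] unfolding m_def by auto
    have dvd: "int m dvd p" if p: "x t [^] p \<in> tail (Suc t)" for p :: int
    proof (rule ccontr)
      assume nd: "\<not> int m dvd p"
      define r where "r = nat (p mod int m)"
      have "p mod int m \<noteq> 0" "0 \<le> p mod int m" "p mod int m < int m"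
        using nd m(1) by (simp_all add: dvd_eq_mod_eq_0)
      then have r: "0 < r" "r < m" "int r = p mod int m"
        unfolding r_def by linarith+
      have "x t [^] (int m * (- (p div int m))) = (x t [^] int m) [^] (- (p div int m))"
        using xt by (simp add: int_pow_pow)
      also have "\<dots> \<in> tail (Suc t)"
        using m(2) subgroup_int_pow_closed[OF sg] by (simp add: int_pow_int)
      finally have "x t [^] p \<otimes> x t [^] (int m * (- (p div int m))) \<in> tail (Suc t)"
        using p subgroup.m_closed[OF sg] by blast
      moreover have "x t [^] p \<otimes> x t [^] (int m * (- (p div int m))) = x t [^] r"
      proof -
        have "p + int m * (- (p div int m)) = int r" using r(3) by (simp add: minus_mult_div_eq_mod)
        then show ?thesis using xt by (metis int_pow_mult int_pow_int)
      qed
      ultimately have "x t [^] r \<in> tail (Suc t)" by simp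
      then have "m \<le> r" unfolding m_def using r(1) by (intro Least_le) auto
      with r(2) show False by simp
    qed
    have "\<exists>C\<ge>0. \<forall>L\<ge>1. light (Suc t) L (x t [^] m) (C / L ^ w t)"
      using m(2) w_mono by (intro light_generate[where S = "{Suc t..<M}"]) (auto simp: tail_def)
    then obtain D where D: "D \<ge> 0" "\<And>L. L \<ge> 1 \<Longrightarrow> light (Suc t) L (x t [^] m) (D / L ^ w t)" by blast
    show thesis
    proof (rule that[OF D(1)])
      fix L :: real and p \<mu> assume L: "L \<ge> 1" and p: "x t [^] (p::int) \<in> tail (Suc t)" "real_of_int \<bar>p\<bar> / L ^ w t \<le> \<mu>"
      obtain q where q: "p = int m * q" using dvd[OF p(1)] by blast
      have "\<bar>q\<bar> \<le> \<bar>p\<bar>" using m(1) q by (cases "q = 0") (auto simp: abs_mult)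
      have "light (Suc t) L ((x t [^] m) [^] q) (real_of_int \<bar>q\<bar> * (D / L ^ w t))"
        by (rule light_int_pow[OF D(2)[OF L]])
      moreover have "(x t [^] m) [^] q = x t [^] p" 
        using xt by (simp add: q int_pow_pow flip: int_pow_int)
      moreover have "real_of_int \<bar>q\<bar> * (D / L ^ w t) \<le> real_of_int \<bar>p\<bar> * (D / L ^ w t)"
        using \<open>\<bar>q\<bar> \<le> \<bar>p\<bar>\<close> D(1) L by (intro mult_right_mono) auto
      moreover have "real_of_int \<bar>p\<bar> * (D / L ^ w t) = D * (real_of_int \<bar>p\<bar> / L ^ w t)" by simp
      moreover have "\<dots> \<le> D * \<mu>" using p(2) D(1) by (intro mult_left_mono)
      ultimately show "light (Suc t) L (x t [^] p) (D * \<mu>)" by (metis light_mono order_trans)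
    qed
  next
    case False
    have p0: "p = 0" if p: "x t [^] p \<in> tail (Suc t)" for p :: int
    proof (rule ccontr)
      assume "p \<noteq> 0"
      have "x t [^] int (nat \<bar>p\<bar>) \<in> tail (Suc t)"
        using p subgroup.m_inv_closed[OF sg p] xt by (auto simp: abs_if int_pow_neg)
      then have "x t [^] nat \<bar>p\<bar> \<in> tail (Suc t)" by (simp only: int_pow_int)
      moreover have "0 < nat \<bar>p\<bar>" using \<open>p \<noteq> 0\<close> by simp
      ultimately show False using False by blast
    qed
    show thesis
    proof (rule that[of 0])
      fix L :: real and p \<mu> assume "x t [^] (p::int) \<in> tail (Suc t)"
      from p0[OF this] show "light (Suc t) L (x t [^] p) (0 * \<mu>)" by (simp add: light_one)
    qed simp
  qed
  have "light (Suc t) L g ((C' + exp (C * K)) * \<mu>)"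
    if L: "L \<ge> 1" and g: "light t L g \<mu>" "\<mu> \<le> K" "g \<in> tail (Suc t)" for L g \<mu>
  proof -
    obtain p :: int and h where ph: "g = x t [^] p \<otimes> h" "real_of_int \<bar>p\<bar> / L ^ w t \<le> \<mu>"
      "light (Suc t) L h (exp (C * \<mu>) * \<mu>)" using C(2)[OF L g(1)] by blast
    have h: "h \<in> tail (Suc t)" "h \<in> carrier G" using light_in_tail ph(3) light_carrier by auto
    have "x t [^] p = g \<otimes> inv h" using ph(1) h xt by (simp add: m_assoc)
    then have "x t [^] p \<in> tail (Suc t)"
      using g(3) h subgroup.m_closed[OF sg] subgroup.m_inv_closed[OF sg] by simp
    then have "light (Suc t) L g (C' * \<mu> + exp (C * \<mu>) * \<mu>)"
      unfolding ph(1) by (intro light_mult C'(2) L ph)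
    moreover have "exp (C * \<mu>) * \<mu> \<le> exp (C * K) * \<mu>"
      using g(2) C(1) light_nonneg[OF g(1)] L by (intro mult_right_mono) (auto intro: mult_left_mono)
    ultimately show ?thesis by (auto simp: distrib_right intro: light_mono)
  qed
  then show ?thesis using C'(1) by (intro exI[of _ "C' + exp (C * K)"]) auto
qed

lemma light_tail:
  assumes "t \<le> M" "0 \<le> K"
  shows "\<exists>C\<ge>0. \<forall>L\<ge>1. \<forall>g \<mu>. light 0 L g \<mu> \<longrightarrow> \<mu> \<le> K \<longrightarrow> g \<in> tail t \<longrightarrow> light t L g (C * \<mu>)"
  using assms(1)
proof (induction t)
  case 0
  show ?case by (intro exI[of _ 1]) simp
next
  case (Suc t)
  then obtain C where C: "C \<ge> 0" "\<forall>L\<ge>1. \<forall>g \<mu>. light 0 L g \<mu> \<longrightarrow> \<mu> \<le> K \<longrightarrow> g \<in> tail t \<longrightarrow> light t L g (C * \<mu>)"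
    by auto
  obtain D where D: "D \<ge> 0" "\<forall>L\<ge>1. \<forall>g \<mu>. light t L g \<mu> \<longrightarrow> \<mu> \<le> C * K \<longrightarrow> g \<in> tail (Suc t) \<longrightarrow> light (Suc t) L g (D * \<mu>)"
    using light_tail_step[of t "C * K"] Suc by auto
  have "light (Suc t) L g (D * C * \<mu>)" if "L \<ge> 1" "light 0 L g \<mu>" "\<mu> \<le> K" "g \<in> tail (Suc t)" for L g \<mu>
  proof -
    have "light t L g (C * \<mu>)" using C that tail_antimono[of t "Suc t"] by auto
    moreover have "C * \<mu> \<le> C * K" using C that by (intro mult_left_mono)
    ultimately show ?thesis using D that by (simp add: mult.assoc)
  qed
  then show ?case using C(1) D(1) by (intro exI[of _ "D * C"]) auto
qed

text \<open>Only the letters of weight exactly \<open>i\<close> contribute to \<open>f\<close>, and a word of weighted length \<open>\<mu>\<close>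
  contains at most \<open>\<mu> L\<^sup>i\<close> of them.\<close>

lemma light_functional_bound:
  assumes f_add: "\<And>g h. g \<in> lower_central G i \<Longrightarrow> h \<in> lower_central G i \<Longrightarrow> f (g \<otimes> h) = f g + (f h :: real)"
    and f_0: "\<And>g. g \<in> lower_central G (Suc i) \<Longrightarrow> f g = 0" and i: "i \<ge> 1" and L: "L \<ge> 1"
    and g: "light (first i) L g \<mu>"
  shows "\<bar>f g\<bar> \<le> (\<Sum>s<M. \<bar>f (x s)\<bar>) * \<mu> * L ^ i"
  using g
proof (induction rule: light.induct)
  case (light_one \<mu>)
  then show ?case using f_0[OF lower_central_one] L by (simp add: sum_nonneg)
next
  case (light_snoc g \<mu> s e \<nu>)
  let ?F = "\<Sum>s<M. \<bar>f (x s)\<bar>"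
  have ws: "i \<le> w s" using light_snoc first_iff by auto
  have xs: "x s \<in> lower_central G i" 
    using letter_in[OF \<open>s < M\<close>] lower_central_antimono[OF ws] by blast
  then have e: "e \<in> lower_central G i" using light_snoc(4) lower_central_inv by auto
  have g: "g \<in> lower_central G i" using light_in_tail[OF light_snoc(1)] tail_first[OF i] by simp
  have fe: "\<bar>f e\<bar> = \<bar>f (x s)\<bar>"
  proof -
    have "f (inv (x s) \<otimes> x s) = f (inv (x s)) + f (x s)" using xs f_add lower_central_inv by blast
    moreover have "f (inv (x s) \<otimes> x s) = 0" using light_snoc f_0[OF lower_central_one] by simp
    ultimately show ?thesis using light_snoc(4) by auto
  qed
  have F0: "?F \<ge> 0" by (simp add: sum_nonneg)
  have "\<bar>f e\<bar> \<le> ?F * (L ^ i / L ^ w s)"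
  proof (cases "w s = i")
    case True
    have "\<bar>f (x s)\<bar> \<le> ?F" by (rule member_le_sum) (use light_snoc in auto)
    then show ?thesis using True L fe by simp
  next
    case False
    then have "x s \<in> lower_central G (Suc i)"
      using ws letter_in[OF \<open>s < M\<close>] lower_central_antimono[of "Suc i" "w s"] by auto
    then show ?thesis using f_0 fe F0 L by simp
  qed
  then have "\<bar>f (g \<otimes> e)\<bar> \<le> ?F * \<mu> * L ^ i + ?F * (L ^ i / L ^ w s)"
    using f_add[OF g e] light_snoc(6) by simp
  also have "\<dots> = ?F * (\<mu> + 1 / L ^ w s) * L ^ i" by (simp add: algebra_simps)
  also have "\<dots> \<le> ?F * \<nu> * L ^ i"
    using light_snoc(5) F0 L by (intro mult_right_mono mult_left_mono) auto
  finally show ?case .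
qed

end

locale word_group = group +
  fixes A :: "'a set"
  assumes finite_gens: "finite A" and gens_closed: "A \<subseteq> carrier G" and gens: "generate G A = carrier G"
begin

definition nrm :: "'a \<Rightarrow> real" where
  "nrm g = real (word_length G A g)"

lemma mspace_word [simp]: "mspace (word_metric G A) = carrier G"
  and mdist_word: "g \<in> carrier G \<Longrightarrow> h \<in> carrier G \<Longrightarrow> mdist (word_metric G A) g h = nrm (inv g \<otimes> h)"
  using Metric_space_word[OF gens_closed gens]
  by (simp_all add: word_metric_def nrm_def Metric_space.mspace_metric Metric_space.mdist_metric)

lemma nrm_nonneg [simp]: "0 \<le> nrm g"
  by (simp add: nrm_def)

lemma nrm_conv_mdist: "g \<in> carrier G \<Longrightarrow> nrm g = mdist (word_metric G A) \<one> g"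
  by (simp add: mdist_word)

lemma nrm_one [simp]: "nrm \<one> = 0"
  by (subst nrm_conv_mdist) simp_all

lemma nrm_mult:
  assumes "g \<in> carrier G" "h \<in> carrier G"
  shows "nrm (g \<otimes> h) \<le> nrm g + nrm h"
  using mdist_triangle[of \<one> "word_metric G A" g "g \<otimes> h"] assms by (simp add: mdist_word)

lemma nrm_inv [simp]: "g \<in> carrier G \<Longrightarrow> nrm (inv g) = nrm g"
  using mdist_commute[of "word_metric G A" g \<one>] by (simp add: mdist_word)

lemma nrm_pow: "g \<in> carrier G \<Longrightarrow> nrm (g [^] (n::nat)) \<le> real n * nrm g"
proof (induction n)
  case (Suc n)
  then show ?case using nrm_mult[of "g [^] n" g] by (simp add: algebra_simps)
qed simp

lemma nrm_word:
  assumes "g \<in> carrier G"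
  shows "\<exists>ws. nrm g = length ws \<and> set ws \<subseteq> A \<union> m_inv G ` A \<and> foldr (\<otimes>) ws \<one> = g"
proof -
  let ?P = "\<lambda>n. \<exists>ws. length ws = n \<and> set ws \<subseteq> A \<union> m_inv G ` A \<and> foldr (\<otimes>) ws \<one> = g"
  have "\<exists>n. ?P n" using word_exists[OF gens_closed] gens assms by blast
  then have "?P (Least ?P)" by (rule LeastI_ex[of ?P])
  then obtain ws where ws: "length ws = Least ?P" "set ws \<subseteq> A \<union> m_inv G ` A" "foldr (\<otimes>) ws \<one> = g"
    by blast
  then have "nrm g = length ws" by (simp only: nrm_def word_length_def)
  with ws(2,3) show ?thesis by blast
qed

lemma nrm_comm: "g \<in> carrier G \<Longrightarrow> h \<in> carrier G \<Longrightarrow> nrm (comm g h) \<le> 2 * nrm g + 2 * nrm h"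
  using nrm_mult[of g h] nrm_mult[of "g \<otimes> h" "inv g"] nrm_mult[of "g \<otimes> h \<otimes> inv g" "inv h"]
  by (simp add: comm_def)

end

locale weighted_word_group = weighted_letters G x w M c + word_group G A
  for G (structure) and x w M c A
begin

lemma light_of_word:
  "\<exists>C\<ge>0. \<forall>L\<ge>1. \<forall>g\<in>carrier G. light 0 L g (C * (nrm g / L))"
proof -
  have "\<exists>C\<ge>0. \<forall>a\<in>A. \<forall>L\<ge>1. light 0 L a (C / L)"
  proof (rule uniform_constant[OF finite_gens])
    show "\<exists>C\<ge>0. \<forall>L\<ge>1. light 0 L a (C / L)" if "a \<in> A" for a
      using light_lower_central[of a 1 0] that gens_closed by auto
    fix a and C D :: real assume C: "\<forall>L\<ge>1. light 0 L a (C / L)" "C \<le> D"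
    have "C / L \<le> D / L" if "L \<ge> 1" for L :: real
      using C(2) that by (intro divide_right_mono) auto
    with C(1) show "\<forall>L\<ge>1. light 0 L a (D / L)" by (meson light_mono)
  qed
  then obtain C where C0: "C \<ge> 0" and C: "\<And>a L. a \<in> A \<Longrightarrow> L \<ge> 1 \<Longrightarrow> light 0 L a (C / L)" by blast
  have letter: "light 0 L e (C / L)" if "e \<in> A \<union> m_inv G ` A" "L \<ge> 1" for e L
    using that C light_inv by auto
  have "light 0 L (foldr (\<otimes>) ws \<one>) (C * (length ws / L))" if "set ws \<subseteq> A \<union> m_inv G ` A" "L \<ge> 1" for ws L
    using that(1)
  proof (induction ws)
    case (Cons e ws)
    then have "light 0 L (e \<otimes> foldr (\<otimes>) ws \<one>) (C / L + C * (length ws / L))"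
      using letter[OF _ that(2)] by (intro light_mult) auto
    then show ?case by (simp add: algebra_simps add_divide_distrib)
  qed (simp add: light_one)
  then have "\<forall>L\<ge>1. \<forall>g\<in>carrier G. light 0 L g (C * (nrm g / L))"
    using nrm_word by metis
  then show ?thesis using C0 by blast
qed

text \<open>A letter \<open>[y, z]\<close> of weight \<open>v + 1\<close> is strongly distorted: its \<open>L\<^sup>v\<^sup>+\<^sup>1\<close>-th power is,
  modulo deeper terms, the commutator of \<open>z\<^sup>L\<close> with the power of \<open>y\<close> to the \<open>L\<^sup>v\<close>. By the
  hypothesis \<open>UB\<close>, the latter is congruent to an element of word length of order \<open>L\<close>.\<close>

lemma nrm_letter_pow:
  assumes t: "t < M" and K: "0 \<le> K"
    and UB: "\<exists>C\<ge>0. \<forall>L\<ge>1. \<forall>g. light 0 L g 1 \<longrightarrow>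
      (\<exists>u\<in>carrier G. nrm u \<le> C * L \<and> inv u \<otimes> g \<in> tail t)"
  shows "\<exists>C\<ge>0. \<forall>L\<ge>1. \<forall>p::int. real_of_int \<bar>p\<bar> / L ^ w t \<le> K \<longrightarrow>
      (\<exists>u\<in>carrier G. nrm u \<le> C * L \<and> inv u \<otimes> x t [^] p \<in> tail (Suc t))"
proof -
  have xt: "x t \<in> carrier G" using t by simp
  \<comment> \<open>It is enough to treat natural exponents, as the claim is stable under inversion.\<close>
  have wlog: ?thesis if nat: "\<exists>C\<ge>0. \<forall>L\<ge>1. \<forall>m::nat. real m / L ^ w t \<le> K \<longrightarrow>
      (\<exists>u\<in>carrier G. nrm u \<le> C * L \<and> cong_lc (Suc (w t)) u (x t [^] m))"
  proof -
    obtain C where C: "C \<ge> 0" "\<And>L m. L \<ge> 1 \<Longrightarrow> real m / L ^ w t \<le> K \<Longrightarrow>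
      \<exists>u\<in>carrier G. nrm u \<le> C * L \<and> cong_lc (Suc (w t)) u (x t [^] (m::nat))"
      using nat by blast
    have "\<exists>u\<in>carrier G. nrm u \<le> C * L \<and> inv u \<otimes> x t [^] p \<in> tail (Suc t)"
      if L: "L \<ge> 1" and p: "real_of_int \<bar>p\<bar> / L ^ w t \<le> K" for L and p :: int
    proof -
      obtain u where u: "u \<in> carrier G" "nrm u \<le> C * L" "cong_lc (Suc (w t)) u (x t [^] nat \<bar>p\<bar>)"
        using C(2)[OF L, of "nat \<bar>p\<bar>"] p by auto
      obtain v where v: "v \<in> carrier G" "nrm v \<le> C * L" "cong_lc (Suc (w t)) v (x t [^] p)"
      proof (cases "p < 0")
        case True
        have "x t [^] p = inv (x t [^] nat \<bar>p\<bar>)" using True unfolding int_pow_def2 by simp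
        then show ?thesis using that[of "inv u"] u cong_lc_inv[OF u(3)] by simp
      next
        case False
        have "x t [^] p = x t [^] nat \<bar>p\<bar>" using False unfolding int_pow_def2 by simp
        then show ?thesis using that[of u] u by simp
      qed
      then have "inv v \<otimes> x t [^] p \<in> tail (Suc t)"
        using lower_central_le_tail[OF t] by (auto simp: cong_lc_def)
      with v show ?thesis by blast
    qed
    then show ?thesis using C(1) by blast
  qed
  show ?thesis
  proof (cases "w t = 1")
    case True
    show ?thesis
    proof (rule wlog, rule exI[of _ "K * nrm (x t)"], intro conjI allI impI)
      fix L :: real and m :: nat assume L: "L \<ge> 1" "real m / L ^ w t \<le> K"
      have "nrm (x t [^] m) \<le> real m * nrm (x t)" by (rule nrm_pow[OF xt])
      also have "\<dots> \<le> K * L * nrm (x t)"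
        using L True by (intro mult_right_mono) (auto simp: divide_le_eq)
      finally show "\<exists>u\<in>carrier G. nrm u \<le> K * nrm (x t) * L \<and> cong_lc (Suc (w t)) u (x t [^] m)"
        using xt by (intro bexI[of _ "x t [^] m"]) (auto simp: algebra_simps intro: cong_lc_refl)
    qed (use K in simp)
  next
    case False
    then have "1 < w t" using w_pos[OF t] by simp
    then obtain s r where sr: "s < M" "r < M" "w s = w t - 1" "w r = 1" "x t = comm (x s) (x r)"
      using letter_comm[OF t] by blast
    define j where "j = w s"
    have j: "1 \<le> j" "w t = Suc j" using sr \<open>1 < w t\<close> by (auto simp: j_def)
    define y z where "y = x s" and "z = x r"
    have y: "y \<in> lower_central G j" using letter_in[OF sr(1)] by (simp add: y_def j_def)
    have yz: "y \<in> carrier G" "z \<in> carrier G" "x t = comm y z" using sr by (auto simp: y_def z_def)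
    obtain C where C: "C \<ge> 0" "\<And>L g. L \<ge> 1 \<Longrightarrow> light 0 L g 1 \<Longrightarrow>
      \<exists>u\<in>carrier G. nrm u \<le> C * L \<and> inv u \<otimes> g \<in> tail t" using UB by blast
    \<comment> \<open>At the scale \<open>\<kappa> L\<close>, the power \<open>y\<^sup>a\<close> used below has weighted length at most 1.\<close>
    define \<kappa> where "\<kappa> = max 1 K"
    show ?thesis
    proof (rule wlog, rule exI[of _ "2 * (C * \<kappa>) + 8 * nrm z + 2 * nrm y"], intro conjI allI impI)
      fix L :: real and m :: nat assume L: "L \<ge> 1" and m: "real m / L ^ w t \<le> K"
      define Q where "Q = nat \<lceil>L\<rceil>"
      have Q: "L \<le> real Q" "real Q \<le> 2 * L" "0 < Q" unfolding Q_def using L by linarith+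
      \<comment> \<open>The exponent \<open>m \<le> K L\<^sup>j\<^sup>+\<^sup>1\<close> is divided by \<open>Q \<approx> L\<close>, leaving a quotient of order \<open>L\<^sup>j\<close>.\<close>
      define a b where "a = m div Q" and "b = m mod Q"
      have ab: "m = a * Q + b" "b < Q" using Q by (auto simp: a_def b_def)
      have a_le: "real a \<le> K * L ^ j"
      proof -
        have "real a * L \<le> real a * real Q" using Q by (intro mult_left_mono) auto
        also have "\<dots> \<le> real m" using ab(1) by (simp flip: of_nat_mult)
        also have "\<dots> \<le> K * L ^ j * L" using m L j by (simp add: divide_le_eq mult_ac)
        finally show ?thesis using L by simp
      qed
      have "light 0 L (y [^] a) (real a * (1 / L ^ j))"
        unfolding y_def j_def by (intro light_pow light_letter) (use sr in auto)
      moreover have "real a * (1 / L ^ j) \<le> \<kappa>"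
      proof -
        have "real a / L ^ j \<le> K" using a_le L by (simp add: divide_le_eq)
        then show ?thesis by (simp add: \<kappa>_def)
      qed
      ultimately have "light 0 (\<kappa> * L) (y [^] a) 1"
        using light_mono L by (intro light_enlarge) (auto simp: \<kappa>_def)
      moreover have "1 * 1 \<le> \<kappa> * L" using L by (intro mult_mono) (auto simp: \<kappa>_def)
      ultimately obtain u where u: "u \<in> carrier G" "nrm u \<le> C * (\<kappa> * L)" "inv u \<otimes> y [^] a \<in> tail t"
        using C(2)[of "\<kappa> * L" "y [^] a"] by auto
      have "inv u \<otimes> y [^] a \<in> lower_central G (Suc j)"
        using u(3) tail_le_lower_central[OF t] j by auto
      from comm_pow_cong[OF j(1) y yz(2) u(1) this, of Q b]
      have "cong_lc (Suc (w t)) (comm u (z [^] Q) \<otimes> comm y (z [^] b)) (x t [^] m)"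
        using ab j yz by simp
      moreover have "nrm (comm u (z [^] Q) \<otimes> comm y (z [^] b)) \<le> (2 * (C * \<kappa>) + 8 * nrm z + 2 * nrm y) * L"
      proof -
        have zQ: "nrm (z [^] Q) \<le> 2 * L * nrm z"
          using order_trans[OF nrm_pow[OF yz(2)] mult_right_mono[OF Q(2) nrm_nonneg]] .
        have "real b \<le> 2 * L" using ab(2) Q(2) by simp
        then have zb: "nrm (z [^] b) \<le> 2 * L * nrm z"
          using order_trans[OF nrm_pow[OF yz(2)] mult_right_mono[OF _ nrm_nonneg]] by blast
        have "nrm y \<le> nrm y * L" using mult_left_mono[OF L nrm_nonneg[of y]] by simp
        then have "2 * nrm u + 2 * nrm (z [^] Q) + (2 * nrm y + 2 * nrm (z [^] b))
           \<le> (2 * (C * \<kappa>) + 8 * nrm z + 2 * nrm y) * L"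
          using zQ zb u(2) by (simp add: algebra_simps)
        then show ?thesis
          using nrm_mult[of "comm u (z [^] Q)" "comm y (z [^] b)"] nrm_comm[of u "z [^] Q"]
            nrm_comm[of y "z [^] b"] u(1) yz by simp
      qed
      ultimately show "\<exists>u\<in>carrier G. nrm u \<le> (2 * (C * \<kappa>) + 8 * nrm z + 2 * nrm y) * L \<and>
          cong_lc (Suc (w t)) u (x t [^] m)"
        using u(1) yz by (intro bexI[of _ "comm u (z [^] Q) \<otimes> comm y (z [^] b)"]) auto
    qed (use C in \<open>simp add: \<kappa>_def\<close>)
  qed
qed

text \<open>Approximation letter by letter: what remains after dividing by the short element \<open>u\<close> found so
  far still has bounded weighted length, its leading power of \<open>x\<^sub>t\<close> can be read off by
  collection, and that power is short modulo later letters.\<close>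

lemma nrm_modulo_tail:
  assumes "t \<le> M"
  shows "\<exists>C\<ge>0. \<forall>L\<ge>1. \<forall>g. light 0 L g 1 \<longrightarrow>
      (\<exists>u\<in>carrier G. nrm u \<le> C * L \<and> inv u \<otimes> g \<in> tail t)"
  using assms
proof (induction t)
  case 0
  show ?case
    by (intro exI[of _ 0]) (auto simp: tail_0 dest: light_carrier intro!: bexI[of _ \<one>])
next
  case (Suc t)
  then have t: "t < M" and IH: "\<exists>C\<ge>0. \<forall>L\<ge>1. \<forall>g. light 0 L g 1 \<longrightarrow>
      (\<exists>u\<in>carrier G. nrm u \<le> C * L \<and> inv u \<otimes> g \<in> tail t)" by auto
  obtain C where C: "C \<ge> 0" "\<And>L g. L \<ge> 1 \<Longrightarrow> light 0 L g 1 \<Longrightarrow>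
      \<exists>u\<in>carrier G. nrm u \<le> C * L \<and> inv u \<otimes> g \<in> tail t" using IH by blast
  obtain C1 where C1: "C1 \<ge> 0" "\<And>L g. L \<ge> 1 \<Longrightarrow> g \<in> carrier G \<Longrightarrow> light 0 L g (C1 * (nrm g / L))"
    using light_of_word by blast
  define K where "K = C1 * C + 1"
  have K: "0 \<le> K" using C(1) C1(1) by (simp add: K_def)
  obtain C2 where C2: "C2 \<ge> 0" "\<And>L g \<mu>. L \<ge> 1 \<Longrightarrow> light 0 L g \<mu> \<Longrightarrow> \<mu> \<le> K \<Longrightarrow> g \<in> tail t \<Longrightarrow> light t L g (C2 * \<mu>)"
    using light_tail[OF _ K, of t] t by auto
  obtain C3 where C3: "C3 \<ge> 0" "\<And>L g \<mu>. L \<ge> 1 \<Longrightarrow> light t L g \<mu> \<Longrightarrow>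
    (\<exists>p::int. \<exists>h. g = x t [^] p \<otimes> h \<and> real_of_int \<bar>p\<bar> / L ^ w t \<le> \<mu> \<and> light (Suc t) L h (exp (C3 * \<mu>) * \<mu>))"
    using light_collect[OF t] by blast
  obtain C4 where C4: "C4 \<ge> 0" "\<And>L p. L \<ge> 1 \<Longrightarrow> real_of_int \<bar>p\<bar> / L ^ w t \<le> C2 * K \<Longrightarrow>
      \<exists>u\<in>carrier G. nrm u \<le> C4 * L \<and> inv u \<otimes> x t [^] (p::int) \<in> tail (Suc t)"
    using nrm_letter_pow[OF t _ IH, of "C2 * K"] C2(1) K by auto
  have xt: "x t \<in> carrier G" using t by simp
  have "\<exists>u\<in>carrier G. nrm u \<le> (C + C4) * L \<and> inv u \<otimes> g \<in> tail (Suc t)"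
    if L: "L \<ge> 1" and g: "light 0 L g 1" for L g
  proof -
    have gc: "g \<in> carrier G" using g light_carrier by blast
    obtain u where u: "u \<in> carrier G" "nrm u \<le> C * L" "inv u \<otimes> g \<in> tail t"
      using C(2)[OF L g] by blast
    have "light 0 L (inv u \<otimes> g) (C1 * (nrm u / L) + 1)"
      by (intro light_mult light_inv C1 L u g)
    moreover have "C1 * (nrm u / L) + 1 \<le> K"
      unfolding K_def using u(2) L C1(1) by (simp add: mult_left_mono divide_le_eq del: times_divide_eq_right)
    ultimately have "light t L (inv u \<otimes> g) (C2 * K)"
      using C2(2)[OF L _ order_refl u(3)] light_mono by blast
    then obtain p :: int and h where ph: "inv u \<otimes> g = x t [^] p \<otimes> h" "real_of_int \<bar>p\<bar> / L ^ w t \<le> C2 * K"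
      "light (Suc t) L h (exp (C3 * (C2 * K)) * (C2 * K))" using C3(2)[OF L] by blast
    have h: "h \<in> tail (Suc t)" "h \<in> carrier G" using ph(3) light_in_tail light_carrier by auto
    obtain v where v: "v \<in> carrier G" "nrm v \<le> C4 * L" "inv v \<otimes> x t [^] p \<in> tail (Suc t)"
      using C4(2)[OF L ph(2)] by blast
    have "inv (u \<otimes> v) \<otimes> g = inv v \<otimes> (inv u \<otimes> g)" using u v gc by (simp add: group_word)
    also have "\<dots> = (inv v \<otimes> x t [^] p) \<otimes> h" using ph(1) v xt h by (simp add: m_assoc)
    also have "\<dots> \<in> tail (Suc t)" using v(3) h(1) subgroup.m_closed[OF tail_subgroup] by blast
    finally have "inv (u \<otimes> v) \<otimes> g \<in> tail (Suc t)" .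
    moreover have "nrm (u \<otimes> v) \<le> (C + C4) * L"
      using nrm_mult[OF u(1) v(1)] u(2) v(2) by (simp add: algebra_simps)
    ultimately show ?thesis using u(1) v(1) by blast
  qed
  then show ?case using C(1) C4(1) by (intro exI[of _ "C + C4"]) auto
qed

lemma nrm_le_of_light:
  "\<exists>C\<ge>0. \<forall>L\<ge>1. \<forall>g. light 0 L g 1 \<longrightarrow> nrm g \<le> C * L"
proof -
  obtain C where C: "C \<ge> 0" "\<And>L g. L \<ge> 1 \<Longrightarrow> light 0 L g 1 \<Longrightarrow>
      \<exists>u\<in>carrier G. nrm u \<le> C * L \<and> inv u \<otimes> g \<in> tail M" using nrm_modulo_tail[of M] by blast
  have "nrm g \<le> C * L" if L: "L \<ge> 1" and g: "light 0 L g 1" for L g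
  proof -
    obtain u where u: "u \<in> carrier G" "nrm u \<le> C * L" "inv u \<otimes> g \<in> tail M" using C(2)[OF L g] by blast
    then have "inv u \<otimes> g = \<one>" by (simp add: tail_M)
    then have "u \<otimes> (inv u \<otimes> g) = u" using u by simp
    then show ?thesis using u light_carrier[OF g] by simp
  qed
  then show ?thesis using C(1) by blast
qed

text \<open>A word of weighted length \<open>\<mu> \<le> 1\<close> at scale \<open>L\<close> has weighted length at most 1 at the
  smaller scale \<open>\<mu>\<^sup>1\<^sup>/\<^sup>c L\<close>. Below scale 1 only the empty word is that light.\<close>

lemma nrm_le_of_light_small:
  assumes c: "1 \<le> c"
  shows "\<exists>C\<ge>0. \<forall>L\<ge>1. \<forall>g \<mu>. light 0 L g \<mu> \<longrightarrow> 0 < \<mu> \<longrightarrow> \<mu> \<le> 1 \<longrightarrow> nrm g \<le> C * (\<mu> powr (1 / c) * L)"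
proof -
  obtain C where C: "C \<ge> 0" "\<And>L g. L \<ge> 1 \<Longrightarrow> light 0 L g 1 \<Longrightarrow> nrm g \<le> C * L"
    using nrm_le_of_light by blast
  have "nrm g \<le> C * (\<mu> powr (1 / c) * L)" if L: "L \<ge> 1" and g: "light 0 L g \<mu>" and \<mu>: "0 < \<mu>" "\<mu> \<le> 1" for L g \<mu>
  proof -
    define \<theta> where "\<theta> = \<mu> powr (1 / c)"
    have \<theta>: "0 < \<theta>" "\<theta> \<le> 1" "\<theta> ^ c = \<mu>"
      using \<mu> c by (auto simp: \<theta>_def powr_le1 powr_powr simp flip: powr_realpow)
    have key: "\<mu> * (1 / (\<theta> * L) ^ w s) \<le> 1 / L ^ w s" if "s < M" for s
    proof -
      have "\<mu> \<le> \<theta> ^ w s" using \<theta> w_le[OF that] power_decreasing[of "w s" c \<theta>] by simp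
      then have "\<mu> / (\<theta> ^ w s * L ^ w s) \<le> \<theta> ^ w s / (\<theta> ^ w s * L ^ w s)"
        using \<theta> L by (intro divide_right_mono) auto
      then show ?thesis using \<theta> by (simp add: power_mult_distrib)
    qed
    show ?thesis
    proof (cases "1 \<le> \<theta> * L")
      case True
      have "light 0 (\<theta> * L) g (1 / \<mu> * \<mu>)"
      proof (rule light_rescale[OF g])
        show "1 / (\<theta> * L) ^ w s \<le> 1 / \<mu> * (1 / L ^ w s)" if "s < M" for s
          using mult_left_mono[OF key[OF that], of "1 / \<mu>"] \<mu> by simp
      qed (use \<mu> in simp)
      then show ?thesis using C(2)[OF True] \<mu> by (simp add: \<theta>_def)
    next
      case False
      have "g = \<one>"
        using g
      proof cases
        case (light_snoc h \<nu> s e)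
        have "0 \<le> \<nu>" using light_nonneg[OF light_snoc(2)] L by simp
        then have "1 / L ^ w s \<le> \<mu>" using light_snoc by linarith
        then have "\<mu> * (1 / (\<theta> * L) ^ w s) \<le> \<mu>" using key[of s] light_snoc by linarith
        then have "1 / (\<theta> * L) ^ w s \<le> 1" using \<mu> mult_le_cancel_left_pos[of \<mu> "1 / (\<theta> * L) ^ w s" 1] by simp
        moreover have "(\<theta> * L) ^ w s < 1"
          using False \<theta> L w_pos[of s] light_snoc by (intro power_less_one_iff[THEN iffD2]) auto
        ultimately show ?thesis using \<theta> L by (auto simp: divide_le_eq)
      qed
      then show ?thesis using C(1) \<theta> L by (simp add: \<theta>_def)
    qed
  qed
  then show ?thesis using C(1) by blast
qed

text \<open>At the scale \<open>L = \<parallel>g\<parallel>\<close> a shortest word for \<open>g\<close> has bounded weighted length, and it can be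
  rewritten in the letters of weight at least \<open>i\<close>.\<close>

lemma nrm_ge_functional:
  assumes f_add: "\<And>g h. g \<in> lower_central G i \<Longrightarrow> h \<in> lower_central G i \<Longrightarrow> f (g \<otimes> h) = f g + (f h :: real)"
    and f_0: "\<And>g. g \<in> lower_central G (Suc i) \<Longrightarrow> f g = 0" and i: "i \<ge> 1"
  shows "\<exists>C\<ge>0. \<forall>g\<in>lower_central G i. \<bar>f g\<bar> \<le> C * nrm g ^ i"
proof -
  obtain C1 where C1: "C1 \<ge> 0" "\<And>L g. L \<ge> 1 \<Longrightarrow> g \<in> carrier G \<Longrightarrow> light 0 L g (C1 * (nrm g / L))"
    using light_of_word by blast
  obtain C2 where C2: "C2 \<ge> 0" "\<And>L g \<mu>. L \<ge> 1 \<Longrightarrow> light 0 L g \<mu> \<Longrightarrow> \<mu> \<le> C1 \<Longrightarrow> g \<in> tail (first i) \<Longrightarrow> light (first i) L g (C2 * \<mu>)"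
    using light_tail[OF first_le C1(1), of i] by blast
  let ?F = "\<Sum>s<M. \<bar>f (x s)\<bar>"
  have "\<bar>f g\<bar> \<le> (?F * (C2 * C1)) * nrm g ^ i" if g: "g \<in> lower_central G i" for g
  proof (cases "nrm g = 0")
    case True
    have "g = \<one>" using True g lower_central_carrier[OF g] mdist_zero[of \<one> "word_metric G A" g] 
      by (simp add: nrm_conv_mdist)
    then show ?thesis using f_0[OF lower_central_one] C1(1) C2(1) by (simp add: sum_nonneg)
  next
    case False
    then have L: "nrm g \<ge> 1" by (simp add: nrm_def)
    have "light 0 (nrm g) g C1" using C1(2)[OF L] lower_central_carrier[OF g] False by fastforce
    then have "light (first i) (nrm g) g (C2 * C1)"
      using C2(2)[OF L] g tail_first[OF i] by simp
    from light_functional_bound[OF f_add f_0 i L this] show ?thesis by simp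
  qed
  then show ?thesis using C1(1) C2(1) by (intro exI[of _ "?F * (C2 * C1)"]) (auto simp: sum_nonneg)
qed

end

section \<open>The torsion-free rank of a finitely generated commutative group\<close>

context comm_group
begin

text \<open>Integral linear combinations, written multiplicatively.\<close>

definition comb :: "('i \<Rightarrow> 'a) \<Rightarrow> 'i set \<Rightarrow> ('i \<Rightarrow> int) \<Rightarrow> 'a" where
  "comb f I e = finprod G (\<lambda>i. f i [^] e i) I"

definition zindep :: "'a set \<Rightarrow> bool" where
  "zindep B \<longleftrightarrow> finite B \<and> B \<subseteq> carrier G \<and> (\<forall>e. comb (\<lambda>b. b) B e = \<one> \<longrightarrow> (\<forall>b\<in>B. e b = 0))"

lemma torsion_free_rank_zindep: "torsion_free_rank G = Sup (card ` {B. zindep B})"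
  unfolding torsion_free_rank_def zindep_def comb_def by (rule arg_cong[where f = Sup]) auto

lemma comb_closed [simp]: "f \<in> I \<rightarrow> carrier G \<Longrightarrow> comb f I e \<in> carrier G"
  unfolding comb_def by (rule finprod_closed) auto

lemma comb_cong: "f \<in> I \<rightarrow> carrier G \<Longrightarrow> (\<And>i. i \<in> I \<Longrightarrow> e i = e' i) \<Longrightarrow> comb f I e = comb f I e'"
  unfolding comb_def by (rule finprod_cong') auto

lemma comb_add: "f \<in> I \<rightarrow> carrier G \<Longrightarrow> comb f I (\<lambda>i. d i + e i) = comb f I d \<otimes> comb f I e"
proof -
  assume f: "f \<in> I \<rightarrow> carrier G"
  have "comb f I (\<lambda>i. d i + e i) = finprod G (\<lambda>i. f i [^] d i \<otimes> f i [^] e i) I"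
    unfolding comb_def using f by (intro finprod_cong') (auto simp: int_pow_mult Pi_iff)
  also have "\<dots> = comb f I d \<otimes> comb f I e"
    unfolding comb_def using f by (intro finprod_multf) auto
  finally show ?thesis .
qed

lemma comb_zero [simp]: "comb f I (\<lambda>i. 0) = \<one>"
  unfolding comb_def by (simp add: finprod_one_eqI)

lemma comb_uminus: "f \<in> I \<rightarrow> carrier G \<Longrightarrow> comb f I (\<lambda>i. - e i) = inv (comb f I e)"
  using comb_add[of f I "\<lambda>i. - e i" e] by (intro inv_equality[symmetric]) auto

lemma comb_diff: "f \<in> I \<rightarrow> carrier G \<Longrightarrow> comb f I (\<lambda>i. d i - e i) = comb f I d \<otimes> inv (comb f I e)"
  using comb_add[of f I d "\<lambda>i. - e i"] by (simp add: comb_uminus)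

lemma comb_scale: "f \<in> I \<rightarrow> carrier G \<Longrightarrow> comb f I (\<lambda>i. int n * e i) = comb f I e [^] n"
proof (induction n)
  case (Suc n)
  have "(\<lambda>i. int (Suc n) * e i) = (\<lambda>i. int n * e i + e i)" by (simp add: algebra_simps fun_eq_iff)
  then show ?case using Suc comb_add[of f I "\<lambda>i. int n * e i" e] by simp
qed simp

lemma comb_int_scale: 
  assumes f: "f \<in> I \<rightarrow> carrier G"
  shows "comb f I (\<lambda>i. k * e i) = comb f I e [^] (k::int)"
proof (cases "k < 0")
  case True
  have "(\<lambda>i. k * e i) = (\<lambda>i. - (int (nat (- k)) * e i))" using True by (simp add: fun_eq_iff)
  then have "comb f I (\<lambda>i. k * e i) = inv (comb f I e [^] nat (- k))"
    by (simp only: comb_uminus[OF f] comb_scale[OF f])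
  then show ?thesis using True by (simp only: int_pow_def2 if_True)
next
  case False
  have "(\<lambda>i. k * e i) = (\<lambda>i. int (nat k) * e i)" using False by (simp add: fun_eq_iff)
  then have "comb f I (\<lambda>i. k * e i) = comb f I e [^] nat k"
    by (simp only: comb_scale[OF f])
  then show ?thesis using False by (simp only: int_pow_def2 if_False)
qed

lemma comb_delta:
  assumes "finite I" "j \<in> I" "f \<in> I \<rightarrow> carrier G"
  shows "comb f I (\<lambda>i. if i = j then k else 0) = f j [^] k"
proof -
  have "comb f I (\<lambda>i. if i = j then k else 0) = finprod G (\<lambda>i. if i = j then f i [^] k else \<one>) I"
    unfolding comb_def using assms by (intro finprod_cong') (auto simp: Pi_iff)
  also have "\<dots> = f j [^] k"
    using assms by (intro finprod_singleton_swap) (auto simp: Pi_iff)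
  finally show ?thesis .
qed

lemma comb_insert:
  assumes "finite I" "j \<notin> I" "f \<in> insert j I \<rightarrow> carrier G"
  shows "comb f (insert j I) e = f j [^] e j \<otimes> comb f I e"
  unfolding comb_def using assms by (intro finprod_insert) auto

lemma comb_of_comb:
  assumes "finite J" "f \<in> I \<rightarrow> carrier G"
  shows "comb (\<lambda>b. comb f I (P b)) J e = comb f I (\<lambda>i. \<Sum>b\<in>J. e b * P b i)"
  using assms(1)
proof (induction J)
  case empty
  have "comb (\<lambda>b. comb f I (P b)) {} e = \<one>" by (simp add: comb_def)
  then show ?case by simp
next
  case (insert b J)
  have "comb (\<lambda>b. comb f I (P b)) (insert b J) e = comb f I (P b) [^] e b \<otimes> comb (\<lambda>b. comb f I (P b)) J e"
    using insert assms(2) by (intro comb_insert) auto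
  also have "\<dots> = comb f I (\<lambda>i. e b * P b i) \<otimes> comb f I (\<lambda>i. \<Sum>b\<in>J. e b * P b i)"
    using insert by (simp add: comb_int_scale[OF assms(2)])
  also have "\<dots> = comb f I (\<lambda>i. \<Sum>b\<in>insert b J. e b * P b i)"
    using insert by (simp flip: comb_add[OF assms(2)])
  finally show ?case .
qed

lemma generate_comb:
  assumes "finite A" "A \<subseteq> carrier G" "g \<in> generate G A"
  shows "\<exists>p. g = comb (\<lambda>a. a) A p"
proof -
  have A: "(\<lambda>a. a) \<in> A \<rightarrow> carrier G" using assms(2) by auto
  show ?thesis
    using assms(3)
  proof induction
    case one
    show ?case by (rule exI[of _ "\<lambda>_. 0"]) simp
  next
    case (incl h)
    then have "h \<in> carrier G" using A by auto
    then show ?case using comb_delta[OF assms(1) incl A, of 1]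
      by (intro exI[of _ "\<lambda>i. if i = h then 1 else 0"]) simp
  next
    case (inv h)
    then have "h \<in> carrier G" using A by auto
    then show ?case using comb_delta[OF assms(1) inv A, of "-1"]
      by (intro exI[of _ "\<lambda>i. if i = h then -1 else 0"]) (auto simp: int_pow_neg)
  next
    case (eng g h)
    then obtain p q where "g = comb (\<lambda>a. a) A p" "h = comb (\<lambda>a. a) A q" by blast
    then show ?case using comb_add[OF A, of p q] by metis
  qed
qed

text \<open>Pigeonhole: the \<open>T\<^sup>k\<close> combinations of \<open>k\<close> independent elements with coefficients below
  \<open>T\<close> are distinct, but they are combinations of the \<open>n\<close> generators with coefficients
  \<open>O(T)\<close>, of which there are only \<open>O(T\<^sup>n)\<close>.\<close>

lemma card_zindep_le:
  assumes A: "finite A" "A \<subseteq> carrier G" "generate G A = carrier G" and B: "zindep B"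
  shows "card B \<le> card A"
proof (rule ccontr)
  assume "\<not> card B \<le> card A"
  then have BA: "Suc (card A) \<le> card B" by simp
  have fB: "finite B" and Bc: "B \<subseteq> carrier G" using B by (auto simp: zindep_def)
  have "\<forall>b\<in>B. \<exists>p. b = comb (\<lambda>a. a) A p" using generate_comb[OF A(1,2)] A(3) Bc by blast
  then obtain P where P: "\<And>b. b \<in> B \<Longrightarrow> b = comb (\<lambda>a. a) A (P b)" by metis
  have Ai: "(\<lambda>a. a) \<in> A \<rightarrow> carrier G" and Bi: "(\<lambda>b. b) \<in> B \<rightarrow> carrier G" using A(2) Bc by auto
  define K where "K = (\<Sum>b\<in>B. \<Sum>a\<in>A. nat \<bar>P b a\<bar>) + 1"
  define T where "T = (3 * K) ^ card A + 1"
  let ?X = "PiE B (\<lambda>_. {0..<int T})" and ?Y = "PiE A (\<lambda>_. {- int (T * K)..int (T * K)})"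
  define F where "F e = restrict (\<lambda>a. \<Sum>b\<in>B. e b * P b a) A" for e
  have eq: "comb (\<lambda>b. b) B e = comb (\<lambda>a. a) A (F e)" for e
  proof -
    have "comb (\<lambda>b. b) B e = comb (\<lambda>b. comb (\<lambda>a. a) A (P b)) B e"
      unfolding comb_def[of _ B] using P Bc A(2) by (intro finprod_cong') auto
    also have "\<dots> = comb (\<lambda>a. a) A (F e)"
      unfolding comb_of_comb[OF fB Ai] by (rule comb_cong[OF Ai]) (simp add: F_def)
    finally show ?thesis .
  qed
  have "inj_on F ?X"
  proof (rule inj_onI)
    fix d e assume de: "d \<in> ?X" "e \<in> ?X" "F d = F e"
    then have "comb (\<lambda>b. b) B (\<lambda>b. d b - e b) = \<one>"
      unfolding comb_diff[OF Bi] eq by (simp add: comb_closed[OF Ai])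
    then have "d b = e b" if "b \<in> B" for b
      using B that unfolding zindep_def by fastforce
    then show "d = e" using de by (intro PiE_ext) auto
  qed
  moreover have "F ` ?X \<subseteq> ?Y"
  proof (rule image_subsetI)
    fix e assume e: "e \<in> ?X"
    have "\<bar>\<Sum>b\<in>B. e b * P b a\<bar> \<le> int (T * K)" if a: "a \<in> A" for a
    proof -
      have "\<bar>\<Sum>b\<in>B. e b * P b a\<bar> \<le> (\<Sum>b\<in>B. \<bar>e b * P b a\<bar>)" by (rule sum_abs)
      also have "\<dots> \<le> (\<Sum>b\<in>B. int T * (\<Sum>a\<in>A. \<bar>P b a\<bar>))"
      proof (rule sum_mono)
        fix b assume b: "b \<in> B"
        then have "e b \<in> {0..<int T}" using e by (rule PiE_mem[rotated])
        then have "\<bar>e b\<bar> \<le> int T" by simp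
        moreover have "\<bar>P b a\<bar> \<le> (\<Sum>a\<in>A. \<bar>P b a\<bar>)" using a A(1) by (intro member_le_sum) auto
        ultimately show "\<bar>e b * P b a\<bar> \<le> int T * (\<Sum>a\<in>A. \<bar>P b a\<bar>)"
          unfolding abs_mult by (intro mult_mono) auto
      qed
      also have "\<dots> = int T * (int K - 1)"
        by (simp add: K_def sum_distrib_left)
      also have "\<dots> \<le> int T * int K" by (intro mult_left_mono) auto
      finally show ?thesis by simp
    qed
    then have "(\<Sum>b\<in>B. e b * P b a) \<in> {- int (T * K)..int (T * K)}" if "a \<in> A" for a
      using that by (auto simp: abs_le_iff minus_le_iff)
    then show "F e \<in> ?Y" unfolding F_def by (intro restrict_PiE_iff[THEN iffD2]) blast
  qed
  moreover have "finite ?Y" using A(1) by (intro finite_PiE) auto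
  ultimately have "card ?X \<le> card ?Y" by (rule card_inj_on_le)
  moreover have "card ?X = T ^ card B" using fB by (simp add: card_PiE)
  moreover have "card ?Y = (2 * (T * K) + 1) ^ card A" using A(1) by (simp add: card_PiE nat_add_distrib nat_mult_distrib mult.commute)
  ultimately have "T ^ card B \<le> (2 * (T * K) + 1) ^ card A" by simp
  also have "\<dots> \<le> (T * (3 * K)) ^ card A"
  proof (rule power_mono)
    have "1 \<le> T * K" by (simp add: T_def K_def)
    then show "2 * (T * K) + 1 \<le> T * (3 * K)" by simp
  qed simp
  also have "\<dots> = T ^ card A * (3 * K) ^ card A" by (simp add: power_mult_distrib)
  also have "\<dots> < T ^ card A * T" by (simp add: T_def)
  also have "\<dots> = T ^ Suc (card A)" by simp
  also have "\<dots> \<le> T ^ card B" using BA by (intro power_increasing) (auto simp: T_def)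
  finally show False by simp
qed

text \<open>An independent set of maximal size spans up to torsion: adjoining another element \<open>g\<close> creates
  a relation, and \<open>g\<close> must occur in it.\<close>

lemma rank_basis:
  assumes A: "finite A" "A \<subseteq> carrier G" "generate G A = carrier G"
  obtains e where "e \<in> {..<torsion_free_rank G} \<rightarrow> carrier G"
    "\<And>m s. comb e {..<torsion_free_rank G} m = \<one> \<Longrightarrow> s < torsion_free_rank G \<Longrightarrow> m s = 0"
    "\<And>g. g \<in> carrier G \<Longrightarrow> \<exists>p>0. \<exists>m. g [^] (p::nat) = comb e {..<torsion_free_rank G} m"
proof -
  let ?r = "torsion_free_rank G"
  let ?X = "card ` {B. zindep B}"
  have bdd: "finite ?X"
    by (rule finite_subset[of _ "{..card A}"]) (use card_zindep_le[OF A] in auto)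
  have "zindep {}" by (simp add: zindep_def)
  then have ne: "?X \<noteq> {}" by blast
  have r: "?r = Max ?X" unfolding torsion_free_rank_zindep using cSup_eq_Max[OF bdd ne] .
  then have "?r \<in> ?X" using Max_in[OF bdd ne] by simp
  then obtain B where B: "zindep B" "card B = ?r" by auto
  have fB: "finite B" and Bc: "B \<subseteq> carrier G" using B by (auto simp: zindep_def)
  have Bi: "(\<lambda>b. b) \<in> B \<rightarrow> carrier G" using Bc by auto
  obtain e where e: "bij_betw e {..<?r} B" using ex_bij_betw_nat_finite[OF fB] B(2) by (auto simp: atLeast0LessThan)
  have ei: "e \<in> {..<?r} \<rightarrow> carrier G" using e Bc bij_betwE by blast
  have reindex: "comb e {..<?r} (\<lambda>s. m (e s)) = comb (\<lambda>b. b) B m" for m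
    unfolding comb_def using e Bc by (subst finprod_reindex[of _ e "{..<?r}", unfolded bij_betw_imp_surj_on[OF e], symmetric])
      (auto simp: bij_betw_def)
  have inv_e: "inv_into {..<?r} e (e s) = s" if "s < ?r" for s
    using e that by (simp add: bij_betw_def)
  have reindex': "comb e {..<?r} m = comb (\<lambda>b. b) B (\<lambda>b. m (inv_into {..<?r} e b))" for m
    unfolding reindex[symmetric] using inv_e by (intro comb_cong[OF ei]) auto
  show ?thesis
  proof (rule that[OF ei])
    fix m s assume "comb e {..<?r} m = \<one>" "s < ?r"
    then have "m (inv_into {..<?r} e (e s)) = 0"
      using B(1) e unfolding reindex' zindep_def bij_betw_def by blast
    then show "m s = 0" using inv_e \<open>s < ?r\<close> by simp
  next
    fix g assume g: "g \<in> carrier G"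
    show "\<exists>p>0. \<exists>m. g [^] (p::nat) = comb e {..<?r} m"
    proof (cases "g \<in> B")
      case True
      then have "g = comb (\<lambda>b. b) B (\<lambda>i. if i = g then 1 else 0)" using comb_delta[OF fB True Bi, of 1] g by simp
      moreover have "g [^] (1::nat) = g" using g by simp
      ultimately have "g [^] (1::nat) = comb e {..<?r} (\<lambda>s. (\<lambda>i. if i = g then 1 else 0) (e s))"
        using reindex[of "\<lambda>i. if i = g then 1 else 0"] by simp
      then show ?thesis using zero_less_one by blast
    next
      case False
      have "\<not> zindep (insert g B)"
      proof
        assume "zindep (insert g B)"
        then have "card (insert g B) \<le> ?r" unfolding r using bdd by (intro Max_ge) auto
        then show False using False fB B(2) by simp
      qed
      moreover have "finite (insert g B)" "insert g B \<subseteq> carrier G" using fB Bc g by auto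
      ultimately have "\<not> (\<forall>d. comb (\<lambda>b. b) (insert g B) d = \<one> \<longrightarrow> (\<forall>b\<in>insert g B. d b = 0))"
        unfolding zindep_def by (simp only: simp_thms)
      then obtain d where d: "comb (\<lambda>b. b) (insert g B) d = \<one>" "\<exists>b\<in>insert g B. d b \<noteq> 0"
        by (simp only: not_all not_imp) (metis (no_types))
      have split: "g [^] d g \<otimes> comb (\<lambda>b. b) B d = \<one>"
        using d(1) comb_insert[OF fB False, of "\<lambda>b. b" d] Bi g by simp
      have "d g \<noteq> 0"
      proof
        assume "d g = 0"
        then have "comb (\<lambda>b. b) B d = \<one>" using split comb_closed[OF Bi, of d] by simp
        then show False using B(1) d(2) \<open>d g = 0\<close> unfolding zindep_def by blast
      qed
      have inv: "comb (\<lambda>b. b) B (\<lambda>b. - d b) = g [^] d g"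
        unfolding comb_uminus[OF Bi] by (rule inv_equality[OF split]) (use g Bi in auto)
      then have "comb (\<lambda>b. b) B d = inv (g [^] d g)"
        using comb_uminus[OF Bi, of d] comb_closed[OF Bi, of d] inv_inv by metis
      then have neg: "comb (\<lambda>b. b) B d = g [^] (- d g)" using g by (simp add: int_pow_neg)
      show ?thesis
      proof (cases "0 < d g")
        case True
        then have "g [^] nat (d g) = comb e {..<?r} (\<lambda>s. (\<lambda>b. - d b) (e s))"
          using inv reindex[of "\<lambda>b. - d b"] by simp
        then show ?thesis using True by (intro exI[of _ "nat (d g)"]) auto
      next
        case False
        then have "g [^] nat (- d g) = comb e {..<?r} (\<lambda>s. d (e s))"
          using neg reindex[of d] by simp
        then show ?thesis using False \<open>d g \<noteq> 0\<close> by (intro exI[of _ "nat (- d g)"]) auto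
      qed
    qed
  qed
qed

text \<open>Rational coordinates with respect to such a basis: if \<open>g\<^sup>p\<close> is the combination with
  coefficients \<open>m\<close>, then \<open>g\<close> has coordinates \<open>m / p\<close>, and independence makes this well-defined.\<close>

lemma rank_coordinates:
  assumes A: "finite A" "A \<subseteq> carrier G" "generate G A = carrier G"
  obtains e and lam :: "'a \<Rightarrow> nat \<Rightarrow> real" where "e \<in> {..<torsion_free_rank G} \<rightarrow> carrier G"
    "\<And>g h s. g \<in> carrier G \<Longrightarrow> h \<in> carrier G \<Longrightarrow> lam (g \<otimes> h) s = lam g s + lam h s"
    "\<And>g s. s \<ge> torsion_free_rank G \<Longrightarrow> lam g s = 0"
    "\<And>s t. s < torsion_free_rank G \<Longrightarrow> t < torsion_free_rank G \<Longrightarrow> lam (e s) t = (if s = t then 1 else 0)"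
    "\<And>g. g \<in> carrier G \<Longrightarrow> \<exists>p>0. \<exists>m. g [^] (p::nat) = comb e {..<torsion_free_rank G} m
       \<and> (\<forall>s<torsion_free_rank G. real_of_int (m s) = real p * lam g s)"
proof -
  let ?r = "torsion_free_rank G"
  obtain e where e: "e \<in> {..<?r} \<rightarrow> carrier G"
    "\<And>m s. comb e {..<?r} m = \<one> \<Longrightarrow> s < ?r \<Longrightarrow> m s = 0"
    "\<And>g. g \<in> carrier G \<Longrightarrow> \<exists>p>0. \<exists>m. g [^] (p::nat) = comb e {..<?r} m"
    using rank_basis[OF A] by blast
  define rel where "rel g p m \<longleftrightarrow> 0 < p \<and> g [^] (p::nat) = comb e {..<?r} m" for g p m
  have "\<exists>pm. rel g (fst pm) (snd pm)" if "g \<in> carrier G" for g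
    using e(3)[OF that] by (auto simp: rel_def)
  then obtain pm where pm: "\<And>g. g \<in> carrier G \<Longrightarrow> rel g (fst (pm g)) (snd (pm g))" by metis
  define lam where "lam g s = (if s < ?r then real_of_int (snd (pm g) s) / real (fst (pm g)) else 0)" for g s
  have uniq: "real_of_int (m s) = real p * lam g s" if g: "g \<in> carrier G" and rel: "rel g p m" and s: "s < ?r" for g p m s
  proof -
    define q k where "q = fst (pm g)" and "k = snd (pm g)"
    have q: "0 < q" "g [^] q = comb e {..<?r} k" using pm[OF g] by (auto simp: rel_def q_def k_def)
    have p: "0 < p" "g [^] p = comb e {..<?r} m" using rel by (auto simp: rel_def)
    have "comb e {..<?r} (\<lambda>i. int q * m i) = g [^] (p * q)"
      unfolding comb_scale[OF e(1)] p(2)[symmetric] using g by (simp add: nat_pow_pow)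
    moreover have "comb e {..<?r} (\<lambda>i. int p * k i) = g [^] (q * p)"
      unfolding comb_scale[OF e(1)] q(2)[symmetric] using g by (simp add: nat_pow_pow)
    ultimately have "comb e {..<?r} (\<lambda>i. int q * m i - int p * k i) = \<one>"
      using g comb_diff[OF e(1)] by (simp add: mult.commute)
    then have "int q * m s = int p * k s" using e(2)[OF _ s] by force
    then have "real q * real_of_int (m s) = real p * real_of_int (k s)"
      by (metis of_int_mult of_int_of_nat_eq)
    then show ?thesis using q s by (simp add: lam_def q_def k_def field_simps)
  qed
  show ?thesis
  proof (rule that[OF e(1)])
    show "lam g s = 0" if "s \<ge> ?r" for g s using that by (simp add: lam_def)
    show "\<exists>p>0. \<exists>m. g [^] (p::nat) = comb e {..<?r} m \<and> (\<forall>s<?r. real_of_int (m s) = real p * lam g s)"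
      if "g \<in> carrier G" for g
      using pm[OF that] uniq[OF that pm[OF that]] unfolding rel_def by blast
    show "lam (e s) t = (if s = t then 1 else 0)" if "s < ?r" "t < ?r" for s t
    proof -
      have es: "e s \<in> carrier G" using e(1) that by auto
      have "rel (e s) 1 (\<lambda>i. if i = s then 1 else 0)"
        unfolding rel_def using comb_delta[of "{..<?r}" s e 1] e(1) that es by simp
      from uniq[OF es this that(2)] show ?thesis by auto
    qed
    fix g h s assume gh: "g \<in> carrier G" "h \<in> carrier G"
    show "lam (g \<otimes> h) s = lam g s + lam h s"
    proof (cases "s < ?r")
      case True
      define p m q k where "p = fst (pm g)" and "m = snd (pm g)" and "q = fst (pm h)" and "k = snd (pm h)"
      have p: "0 < p" "g [^] p = comb e {..<?r} m" and q: "0 < q" "h [^] q = comb e {..<?r} k"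
        using pm gh by (auto simp: rel_def p_def m_def q_def k_def)
      have "(g \<otimes> h) [^] (p * q) = (g [^] p) [^] q \<otimes> (h [^] q) [^] p"
        using gh by (simp add: nat_pow_distrib nat_pow_pow mult.commute)
      also have "\<dots> = comb e {..<?r} (\<lambda>i. int q * m i + int p * k i)"
        unfolding comb_add[OF e(1)] comb_scale[OF e(1)] p q ..
      finally have "rel (g \<otimes> h) (p * q) (\<lambda>i. int q * m i + int p * k i)"
        using p q by (simp add: rel_def)
      from uniq[OF _ this True] have "real q * m s + real p * k s = real (p * q) * lam (g \<otimes> h) s"
        using gh by simp
      moreover have "real_of_int (m s) = real p * lam g s" "real_of_int (k s) = real q * lam h s"
        using uniq[OF _ _ True] pm gh by (auto simp: p_def m_def q_def k_def)
      ultimately have "real p * real q * (lam g s + lam h s) = real p * real q * lam (g \<otimes> h) s"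
        by (simp add: algebra_simps)
      then show ?thesis using p q by simp
    qed (simp add: lam_def)
  qed
qed

end

context group
begin

text \<open>The factors commute only modulo a deeper subgroup, whence a product in a fixed order.\<close>

fun oprod :: "(nat \<Rightarrow> 'a) \<Rightarrow> (nat \<Rightarrow> int) \<Rightarrow> nat \<Rightarrow> 'a" where
  "oprod e m 0 = \<one>"
| "oprod e m (Suc r) = oprod e m r \<otimes> e r [^] m r"

lemma oprod_lower_central:
  "(\<And>s. s < r \<Longrightarrow> e s \<in> lower_central G i) \<Longrightarrow> oprod e m r \<in> lower_central G i"
  by (induction r) (auto simp: lower_central_one intro!: lower_central_mult lower_central_int_pow)

end

context weighted_letters
begin

text \<open>Coordinates on \<open>\<gamma>\<^sub>i\<close> that identify \<open>\<gamma>\<^sub>i/\<gamma>\<^sub>i\<^sub>+\<^sub>1\<close> modulo torsion with a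
  lattice between \<open>\<int>\<^sup>r\<close> and \<open>\<rat>\<^sup>r\<close>.\<close>

lemma lower_central_coordinates:
  assumes i: "1 \<le> i"
  obtains e and lam :: "'a \<Rightarrow> nat \<Rightarrow> real" where
    "\<And>s. s < lower_central_rank G i \<Longrightarrow> e s \<in> lower_central G i"
    "\<And>g h s. g \<in> lower_central G i \<Longrightarrow> h \<in> lower_central G i \<Longrightarrow> lam (g \<otimes> h) s = lam g s + lam h s"
    "\<And>g s. s \<ge> lower_central_rank G i \<Longrightarrow> lam g s = 0"
    "\<And>g s. g \<in> lower_central G (Suc i) \<Longrightarrow> lam g s = 0"
    "\<And>s t. s < lower_central_rank G i \<Longrightarrow> t < lower_central_rank G i \<Longrightarrow> lam (e s) t = (if s = t then 1 else 0)"
    "\<And>g. g \<in> lower_central G i \<Longrightarrow> \<exists>p>0. \<exists>m.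
       cong_lc (Suc i) (g [^] (p::nat)) (oprod e m (lower_central_rank G i))
       \<and> (\<forall>s<lower_central_rank G i. real_of_int (m s) = real p * lam g s)"
proof -
  let ?S = "lower_central G i" and ?K = "lower_central G (Suc i)"
  define Q where "Q = G\<lparr>carrier := ?S\<rparr> Mod ?K"
  define \<pi> where "\<pi> g = ?K #>\<^bsub>G\<lparr>carrier := ?S\<rparr>\<^esub> g" for g
  have KS: "?K \<subseteq> ?S" using lower_central_antimono by simp
  interpret n: normal ?K "G\<lparr>carrier := ?S\<rparr>"
    by (rule normal_restrict_supergroup[OF lower_central_subgroup lower_central_normal KS])
  have gQ: "group Q" unfolding Q_def by (rule n.factorgroup_is_group)
  then interpret Q: group Q .
  have carQ: "carrier Q = \<pi> ` ?S" by (auto simp: Q_def \<pi>_def carrier_FactGroup)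
  have \<pi>_car: "\<pi> a \<in> carrier Q" if "a \<in> ?S" for a using that carQ by auto
  have \<pi>_mult: "\<pi> (a \<otimes> b) = \<pi> a \<otimes>\<^bsub>Q\<^esub> \<pi> b" if "a \<in> ?S" "b \<in> ?S" for a b
    using hom_mult[OF n.r_coset_hom_Mod, of a b] that by (simp add: Q_def \<pi>_def)
  have \<pi>_ker: "\<pi> a = \<one>\<^bsub>Q\<^esub> \<longleftrightarrow> a \<in> ?K" if "a \<in> ?S" for a
  proof
    assume "\<pi> a = \<one>\<^bsub>Q\<^esub>"
    then have "?K #>\<^bsub>G\<lparr>carrier := ?S\<rparr>\<^esub> a = ?K" by (simp add: Q_def \<pi>_def)
    then show "a \<in> ?K" using n.coset_join1[of ?K a] that n.subgroup_axioms by simp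
  next
    assume "a \<in> ?K"
    then show "\<pi> a = \<one>\<^bsub>Q\<^esub>" using n.rcos_const by (simp add: Q_def \<pi>_def)
  qed
  have \<pi>_one: "\<pi> \<one> = \<one>\<^bsub>Q\<^esub>" using \<pi>_ker[OF lower_central_one] lower_central_one by simp
  have \<pi>_inv: "\<pi> (inv a) = inv\<^bsub>Q\<^esub> (\<pi> a)" if "a \<in> ?S" for a
  proof (rule Q.inv_equality[symmetric])
    have "\<pi> (inv a) \<otimes>\<^bsub>Q\<^esub> \<pi> a = \<pi> (inv a \<otimes> a)" using that lower_central_inv \<pi>_mult by simp
    then show "\<pi> (inv a) \<otimes>\<^bsub>Q\<^esub> \<pi> a = \<one>\<^bsub>Q\<^esub>" using that lower_central_carrier \<pi>_one by simp
  qed (use that lower_central_inv \<pi>_car in auto)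
  have \<pi>_eq: "cong_lc (Suc i) a b" if "a \<in> ?S" "b \<in> ?S" "\<pi> a = \<pi> b" for a b
  proof -
    have "\<pi> (inv a \<otimes> b) = inv\<^bsub>Q\<^esub> (\<pi> a) \<otimes>\<^bsub>Q\<^esub> \<pi> b" using that \<pi>_mult \<pi>_inv lower_central_inv by simp
    then have "\<pi> (inv a \<otimes> b) = \<one>\<^bsub>Q\<^esub>" using that \<pi>_car by simp
    then have "inv a \<otimes> b \<in> ?K" using \<pi>_ker[of "inv a \<otimes> b"] that lower_central_mult lower_central_inv by blast
    then show ?thesis using that lower_central_carrier by (auto simp: cong_lc_def)
  qed
  have \<pi>_cong: "\<pi> a = \<pi> b" if "a \<in> ?S" "b \<in> ?S" "cong_lc (Suc i) a b" for a b
  proof -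
    have "a \<in> carrier G" "b \<in> carrier G" using that lower_central_carrier by auto
    then have "b = a \<otimes> (inv a \<otimes> b)" by simp
    moreover have ab: "inv a \<otimes> b \<in> ?K" using that by (simp add: cong_lc_def)
    ultimately have "\<pi> b = \<pi> a \<otimes>\<^bsub>Q\<^esub> \<pi> (inv a \<otimes> b)" using that \<pi>_mult KS by (metis subsetD)
    then show ?thesis using \<pi>_ker[of "inv a \<otimes> b"] ab KS \<pi>_car that by auto
  qed
  have \<pi>_pow: "\<pi> (a [^] (k::nat)) = \<pi> a [^]\<^bsub>Q\<^esub> k" if "a \<in> ?S" for a k
    by (induction k) (simp_all add: \<pi>_one \<pi>_mult lower_central_pow that)
  have \<pi>_int_pow: "\<pi> (a [^] (k::int)) = \<pi> a [^]\<^bsub>Q\<^esub> k" if "a \<in> ?S" for a k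
  proof (cases "k < 0")
    case True
    show ?thesis unfolding int_pow_def2 if_P[OF True] by (simp add: \<pi>_inv \<pi>_pow lower_central_pow that)
  next
    case False
    show ?thesis unfolding int_pow_def2 if_not_P[OF False] by (rule \<pi>_pow[OF that])
  qed
  have "comm_group Q"
  proof (rule Q.group_comm_groupI)
    fix X Y assume "X \<in> carrier Q" "Y \<in> carrier Q"
    then obtain a b where ab: "a \<in> ?S" "b \<in> ?S" "X = \<pi> a" "Y = \<pi> b" using carQ by auto
    have "cong_lc (Suc i) (a \<otimes> b) (b \<otimes> a)"
      using ab i lower_central_carrier by (intro cong_lc_swap) auto
    then have "\<pi> (a \<otimes> b) = \<pi> (b \<otimes> a)" using ab lower_central_mult by (intro \<pi>_cong) auto
    then show "X \<otimes>\<^bsub>Q\<^esub> Y = Y \<otimes>\<^bsub>Q\<^esub> X" using ab \<pi>_mult by simp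
  qed
  then interpret C: comm_group Q .
  define D where "D = x ` {t. t < M \<and> i \<le> w t}"
  have D: "D \<subseteq> ?S" using letter_in lower_central_antimono unfolding D_def by blast
  have Dfin: "finite (\<pi> ` D)" by (simp add: D_def)
  have DQ: "\<pi> ` D \<subseteq> carrier Q" using D carQ by auto
  have "\<pi> g \<in> generate Q (\<pi> ` D)" if "g \<in> generate G D" for g
    using that
  proof induction
    case one
    then show ?case by (simp add: \<pi>_one generate.one)
  next
    case (incl h)
    then show ?case by (intro generate.incl) simp
  next
    case (inv h)
    then have "\<pi> (inv h) = inv\<^bsub>Q\<^esub> (\<pi> h)" using D by (intro \<pi>_inv) auto
    then show ?case using inv by (simp add: generate.inv)
  next
    case (eng g h)
    have "generate G D \<subseteq> ?S" by (rule generate_subgroup_incl[OF D lower_central_subgroup])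
    then have "\<pi> (g \<otimes> h) = \<pi> g \<otimes>\<^bsub>Q\<^esub> \<pi> h" using eng by (intro \<pi>_mult) auto
    then show ?case using eng by (simp add: generate.eng)
  qed
  moreover have "?S = generate G D" unfolding D_def by (rule lower_central_letters[OF i])
  ultimately have "carrier Q \<subseteq> generate Q (\<pi> ` D)" using carQ by auto
  then have Dgen: "generate Q (\<pi> ` D) = carrier Q" using Q.generate_incl[OF DQ] by blast
  have r: "torsion_free_rank Q = lower_central_rank G i"
    by (simp add: lower_central_rank_def Q_def)
  let ?r = "lower_central_rank G i"
  obtain E and l :: "'a set \<Rightarrow> nat \<Rightarrow> real" where E: "E \<in> {..<?r} \<rightarrow> carrier Q"
    and l: "\<And>g h s. g \<in> carrier Q \<Longrightarrow> h \<in> carrier Q \<Longrightarrow> l (g \<otimes>\<^bsub>Q\<^esub> h) s = l g s + l h s"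
    "\<And>g s. s \<ge> ?r \<Longrightarrow> l g s = 0"
    "\<And>s t. s < ?r \<Longrightarrow> t < ?r \<Longrightarrow> l (E s) t = (if s = t then 1 else 0)"
    "\<And>g. g \<in> carrier Q \<Longrightarrow> \<exists>p>0. \<exists>m. g [^]\<^bsub>Q\<^esub> (p::nat) = C.comb E {..<?r} m
       \<and> (\<forall>s<?r. real_of_int (m s) = real p * l g s)"
    apply (rule C.rank_coordinates[OF Dfin DQ Dgen, unfolded r])
    subgoal premises prems for e lam by (rule prems(1)[OF prems(2-)])
    done
  have "\<exists>a\<in>?S. E s = \<pi> a" if "s < ?r" for s
  proof -
    have "E s \<in> \<pi> ` ?S" using funcset_mem[OF E, of s] that by (simp only: carQ lessThan_iff)
    then show ?thesis by blast
  qed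
  then obtain e where e: "\<And>s. s < ?r \<Longrightarrow> e s \<in> ?S" "\<And>s. s < ?r \<Longrightarrow> E s = \<pi> (e s)" by metis
  have comb: "C.comb E {..<k} m = \<pi> (oprod e m k)" if "k \<le> ?r" for k m
    using that
  proof (induction k)
    case 0
    then show ?case by (simp add: C.comb_def \<pi>_one)
  next
    case (Suc k)
    have "C.comb E {..<Suc k} m = E k [^]\<^bsub>Q\<^esub> m k \<otimes>\<^bsub>Q\<^esub> C.comb E {..<k} m"
      unfolding lessThan_Suc using E Suc by (intro C.comb_insert) auto
    also have "\<dots> = C.comb E {..<k} m \<otimes>\<^bsub>Q\<^esub> E k [^]\<^bsub>Q\<^esub> m k"
      using E Suc by (intro C.m_comm C.comb_closed Q.int_pow_closed) auto
    also have "\<dots> = \<pi> (oprod e m k) \<otimes>\<^bsub>Q\<^esub> \<pi> (e k [^] m k)"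
      using Suc e \<pi>_int_pow by simp
    also have "\<dots> = \<pi> (oprod e m (Suc k))"
      using Suc e oprod_lower_central[of k e i m] lower_central_int_pow by (simp add: \<pi>_mult)
    finally show ?case .
  qed
  define lam where "lam g = l (\<pi> g)" for g
  show ?thesis
  proof (rule that[of e lam])
    show "e s \<in> ?S" if "s < ?r" for s using e that by blast
    show "lam (g \<otimes> h) s = lam g s + lam h s" if "g \<in> ?S" "h \<in> ?S" for g h s
      using that \<pi>_mult \<pi>_car l(1) by (simp add: lam_def)
    show "lam g s = 0" if "s \<ge> ?r" for g s using that l(2) by (simp add: lam_def)
    show "lam g s = 0" if "g \<in> ?K" for g s
    proof -
      have "\<pi> g = \<one>\<^bsub>Q\<^esub>" using \<pi>_ker[OF subsetD[OF KS that]] that by blast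
      then have "lam g s = l \<one>\<^bsub>Q\<^esub> s" by (simp only: lam_def)
      then show ?thesis using l(1)[of "\<one>\<^bsub>Q\<^esub>" "\<one>\<^bsub>Q\<^esub>" s] by simp
    qed
    show "lam (e s) t = (if s = t then 1 else 0)" if "s < ?r" "t < ?r" for s t
      using l(3)[OF that] e(2)[OF that(1)] by (simp add: lam_def)
    fix g assume g: "g \<in> ?S"
    obtain p :: nat and m where pm: "0 < p" "\<pi> g [^]\<^bsub>Q\<^esub> p = C.comb E {..<?r} m"
      "\<forall>s<?r. real_of_int (m s) = real p * l (\<pi> g) s"
      using l(4)[OF \<pi>_car[OF g]] by blast
    have "\<pi> (g [^] p) = \<pi> (oprod e m ?r)" using pm(2) comb[of ?r m] g by (simp add: \<pi>_pow)
    then have "cong_lc (Suc i) (g [^] p) (oprod e m ?r)"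
      using g e(1) by (intro \<pi>_eq lower_central_pow oprod_lower_central) auto
    then show "\<exists>p>0. \<exists>m. cong_lc (Suc i) (g [^] (p::nat)) (oprod e m ?r)
       \<and> (\<forall>s<?r. real_of_int (m s) = real p * lam g s)"
      using pm by (auto simp: lam_def)
  qed
qed

end

section \<open>Powers in one stratum\<close>

lemma powr_root_of_power: "0 \<le> y \<Longrightarrow> 1 \<le> n \<Longrightarrow> (y ^ n) powr (1 / real n) = y"
proof -
  assume y: "0 \<le> y" and n: "1 \<le> n"
  show ?thesis
  proof (cases "y = 0")
    case True
    then show ?thesis using n by simp
  next
    case False
    then have "y ^ n = y powr real n" using y by (simp add: powr_realpow)
    then show ?thesis using n y by (simp add: powr_powr)
  qed
qed

lemma power_of_powr_root: "0 \<le> y \<Longrightarrow> 1 \<le> n \<Longrightarrow> (y powr (1 / real n)) ^ n = y"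
proof -
  assume y: "0 \<le> y" and n: "1 \<le> n"
  show ?thesis
  proof (cases "y = 0")
    case True
    then show ?thesis using n by simp
  next
    case False
    then have "(y powr (1 / real n)) ^ n = (y powr (1 / real n)) powr real n" using y by (simp add: powr_realpow)
    then show ?thesis using n y by (simp add: powr_powr)
  qed
qed

text \<open>A fixed stratum \<open>i\<close>, with coordinates \<open>lam\<close> on \<open>\<gamma>\<^sub>i\<close> whose kernel is the torsion modulo
  \<open>\<gamma>\<^sub>i\<^sub>+\<^sub>1\<close>, and elements \<open>e s\<close> with the unit vectors as coordinates.\<close>

locale graded_coordinates = weighted_word_group +
  fixes i r :: nat and e :: "nat \<Rightarrow> 'a" and lam :: "'a \<Rightarrow> nat \<Rightarrow> real"
  assumes i_pos: "1 \<le> i" and c_pos: "1 \<le> c"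
    and e_in: "s < r \<Longrightarrow> e s \<in> lower_central G i"
    and lam_mult: "g \<in> lower_central G i \<Longrightarrow> h \<in> lower_central G i \<Longrightarrow> lam (g \<otimes> h) s = lam g s + lam h s"
    and lam_beyond: "r \<le> s \<Longrightarrow> lam g s = 0"
    and lam_deep: "g \<in> lower_central G (Suc i) \<Longrightarrow> lam g s = 0"
    and lam_e: "s < r \<Longrightarrow> t < r \<Longrightarrow> lam (e s) t = (if s = t then 1 else 0)"
    and lam_pow_ex: "g \<in> lower_central G i \<Longrightarrow>
      \<exists>p>0. \<exists>m. cong_lc (Suc i) (g [^] (p::nat)) (oprod e m r) \<and> (\<forall>s<r. real_of_int (m s) = real p * lam g s)"
begin

abbreviation "\<Gamma> \<equiv> lower_central G i"

definition vnorm :: "(nat \<Rightarrow> real) \<Rightarrow> real" where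
  "vnorm a = L2_set a {..<r}"

lemma vnorm_nonneg [simp]: "0 \<le> vnorm a"
  by (simp add: vnorm_def)

lemma vnorm_triangle: "vnorm (\<lambda>s. a s + b s) \<le> vnorm a + vnorm b"
  unfolding vnorm_def by (rule L2_set_triangle_ineq)

lemma vnorm_scale: "vnorm (\<lambda>s. t * a s) = \<bar>t\<bar> * vnorm a"
  by (simp add: vnorm_def L2_set_def power_mult_distrib real_sqrt_mult flip: sum_distrib_left)

lemma vnorm_uminus: "vnorm (\<lambda>s. - a s) = vnorm a"
  by (simp add: vnorm_def L2_set_def)

lemma abs_le_vnorm: "s < r \<Longrightarrow> \<bar>a s\<bar> \<le> vnorm a"
  using member_le_L2_set[of "{..<r}" s "\<lambda>s. \<bar>a s\<bar>"] by (simp add: vnorm_def L2_set_def)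

lemma lam_one [simp]: "lam \<one> s = 0"
  using lam_deep[OF lower_central_one] .

lemma lam_inv: "g \<in> \<Gamma> \<Longrightarrow> lam (inv g) s = - lam g s"
  using lam_mult[of g "inv g" s] lower_central_inv lower_central_carrier by simp

lemma lam_pow: "g \<in> \<Gamma> \<Longrightarrow> lam (g [^] (n::nat)) s = real n * lam g s"
  by (induction n) (simp_all add: lam_mult lower_central_pow algebra_simps)

lemma lam_int_pow: "g \<in> \<Gamma> \<Longrightarrow> lam (g [^] (n::int)) s = real_of_int n * lam g s"
proof (cases "n < 0")
  case True
  assume "g \<in> \<Gamma>"
  then have "lam (inv (g [^] nat (- n))) s = - (real (nat (- n)) * lam g s)"
    by (simp only: lam_inv lam_pow lower_central_pow)
  then show ?thesis unfolding int_pow_def2 if_P[OF True] using True by simp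
next
  case False
  assume "g \<in> \<Gamma>"
  then have "lam (g [^] nat n) s = real (nat n) * lam g s" by (simp only: lam_pow)
  then show ?thesis unfolding int_pow_def2 if_not_P[OF False] using False by simp
qed

lemma nrm_ge_lam: "\<exists>\<kappa>>0. \<forall>g\<in>\<Gamma>. \<kappa> * vnorm (lam g) powr (1 / i) \<le> nrm g"
proof -
  have "\<exists>C\<ge>0. \<forall>g\<in>\<Gamma>. \<bar>lam g s\<bar> \<le> C * nrm g ^ i" for s
    by (rule nrm_ge_functional[OF lam_mult lam_deep i_pos])
  then obtain F where F: "\<And>s. F s \<ge> 0" "\<And>s g. g \<in> \<Gamma> \<Longrightarrow> \<bar>lam g s\<bar> \<le> F s * nrm g ^ i"
    by metis
  define C where "C = (\<Sum>s<r. F s) + 1"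
  have C: "C > 0" using F(1) by (simp add: C_def sum_nonneg add_nonneg_pos)
  have "(1 / C powr (1 / i)) * vnorm (lam g) powr (1 / i) \<le> nrm g" if g: "g \<in> \<Gamma>" for g
  proof -
    have "vnorm (lam g) \<le> (\<Sum>s<r. \<bar>lam g s\<bar>)" unfolding vnorm_def by (rule L2_set_le_sum_abs)
    also have "\<dots> \<le> (\<Sum>s<r. F s * nrm g ^ i)" by (intro sum_mono F g)
    also have "\<dots> \<le> C * nrm g ^ i" by (simp add: C_def sum_distrib_right algebra_simps)
    finally have "vnorm (lam g) powr (1 / i) \<le> (C * nrm g ^ i) powr (1 / i)"
      by (intro powr_mono2) auto
    also have "\<dots> = C powr (1 / i) * nrm g"
    proof -
      have "(nrm g ^ i) powr (1 / i) = nrm g"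
        using i_pos by (intro powr_root_of_power) auto
      then show ?thesis using C by (simp add: powr_mult)
    qed
    finally show ?thesis using C by (simp add: divide_le_eq mult.commute)
  qed
  then show ?thesis using C by (intro exI[of _ "1 / C powr (1 / i)"]) auto
qed

subsection \<open>Elements with integral coordinates\<close>

text \<open>Good elements are combinations of the \<open>e s\<close> modulo \<open>\<gamma>\<^sub>i\<^sub>+\<^sub>1\<close>; neither denominators nor torsion
  hide their size. Every element of \<open>\<gamma>\<^sub>i\<close> has a good power.\<close>

definition good :: "'a \<Rightarrow> bool" where
  "good g \<longleftrightarrow> (\<exists>m. cong_lc (Suc i) g (oprod e m r))"

lemma cong_swap: "a \<in> \<Gamma> \<Longrightarrow> b \<in> \<Gamma> \<Longrightarrow> cong_lc (Suc i) (a \<otimes> b) (b \<otimes> a)"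
  using cong_lc_swap i_pos lower_central_carrier by blast

lemma oprod_in: "k \<le> r \<Longrightarrow> oprod e m k \<in> \<Gamma>"
  by (rule oprod_lower_central) (use e_in in auto)

lemma oprod_add_cong:
  "k \<le> r \<Longrightarrow> cong_lc (Suc i) (oprod e m k \<otimes> oprod e m' k) (oprod e (\<lambda>s. m s + m' s) k)"
proof (induction k)
  case 0
  then show ?case by (simp add: cong_lc_refl)
next
  case (Suc k)
  define p q a b where "p = oprod e m k" and "q = oprod e m' k" and "a = e k [^] m k" and "b = e k [^] m' k"
  have in_\<Gamma>: "p \<in> \<Gamma>" "q \<in> \<Gamma>" "a \<in> \<Gamma>" "b \<in> \<Gamma>"
    using Suc.prems e_in by (auto simp: p_def q_def a_def b_def intro: oprod_in lower_central_int_pow)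
  note car = in_\<Gamma>[THEN lower_central_carrier]
  have ek: "e k \<in> carrier G" using Suc.prems e_in[of k] lower_central_carrier by auto
  have "cong_lc (Suc i) (p \<otimes> (a \<otimes> q) \<otimes> b) (p \<otimes> (q \<otimes> a) \<otimes> b)"
    using car in_\<Gamma> by (intro cong_lc_mult cong_lc_refl cong_swap) auto
  also have "p \<otimes> (q \<otimes> a) \<otimes> b = (p \<otimes> q) \<otimes> (a \<otimes> b)" using car by (simp add: m_assoc)
  also have "cong_lc (Suc i) ((p \<otimes> q) \<otimes> (a \<otimes> b)) (oprod e (\<lambda>s. m s + m' s) k \<otimes> (a \<otimes> b))"
    using Suc car unfolding p_def q_def by (intro cong_lc_mult cong_lc_refl) auto
  also have "oprod e (\<lambda>s. m s + m' s) k \<otimes> (a \<otimes> b) = oprod e (\<lambda>s. m s + m' s) (Suc k)"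
    using ek by (simp add: a_def b_def int_pow_mult)
  finally show ?case using car by (simp add: p_def q_def a_def b_def m_assoc)
qed

lemma oprod_zero: "k \<le> r \<Longrightarrow> oprod e (\<lambda>s. 0) k = \<one>"
  by (induction k) auto

lemma good_in: "good g \<Longrightarrow> g \<in> \<Gamma>"
proof -
  assume "good g"
  then obtain m where m: "cong_lc (Suc i) (oprod e m r) g" using cong_lc_sym by (auto simp: good_def)
  then have "inv (oprod e m r) \<otimes> g \<in> \<Gamma>" using lower_central_antimono[of i "Suc i"] by (auto simp: cong_lc_def)
  then have "oprod e m r \<otimes> (inv (oprod e m r) \<otimes> g) \<in> \<Gamma>" using oprod_in lower_central_mult by blast
  then show ?thesis using m by (simp add: cong_lc_def)
qed

lemma good_mult: "good g \<Longrightarrow> good h \<Longrightarrow> good (g \<otimes> h)"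
  unfolding good_def by (meson cong_lc_mult cong_lc_trans oprod_add_cong order_refl)

lemma good_one: "good \<one>"
  unfolding good_def using oprod_zero[of r] by (intro exI[of _ "\<lambda>_. 0"]) (simp add: cong_lc_refl)

lemma good_inv: "good g \<Longrightarrow> good (inv g)"
proof -
  assume "good g"
  then obtain m where m: "cong_lc (Suc i) g (oprod e m r)" by (auto simp: good_def)
  have car: "oprod e m' r \<in> carrier G" for m' using oprod_in lower_central_carrier by blast
  have "cong_lc (Suc i) (oprod e m r \<otimes> oprod e (\<lambda>s. - m s) r) \<one>"
    using oprod_add_cong[of r m "\<lambda>s. - m s"] oprod_zero[of r] by simp
  then have "cong_lc (Suc i) (inv (oprod e m r) \<otimes> (oprod e m r \<otimes> oprod e (\<lambda>s. - m s) r)) (inv (oprod e m r) \<otimes> \<one>)"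
    using car by (intro cong_lc_mult cong_lc_refl) auto
  then have "cong_lc (Suc i) (inv (oprod e m r)) (oprod e (\<lambda>s. - m s) r)"
    using car cong_lc_sym by simp
  from cong_lc_trans[OF cong_lc_inv[OF m] this] show ?thesis unfolding good_def by (intro exI[of _ "\<lambda>s. - m s"])
qed

lemma good_pow: "good g \<Longrightarrow> good (g [^] (n::nat))"
  by (induction n) (auto intro: good_one good_mult)

lemma ex_good_pow: "g \<in> \<Gamma> \<Longrightarrow> \<exists>p>0. good (g [^] (p::nat))"
  using lam_pow_ex[of g] unfolding good_def by blast

lemma lam_oprod: "k \<le> r \<Longrightarrow> lam (oprod e m k) s = (if s < k then real_of_int (m s) else 0)"
proof (induction k)
  case (Suc k)
  then have ek: "e k \<in> \<Gamma>" using e_in by simp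
  have "lam (oprod e m (Suc k)) s = (if s < k then real_of_int (m s) else 0) + real_of_int (m k) * lam (e k) s"
    using Suc ek by (simp add: lam_mult lam_int_pow oprod_in lower_central_int_pow)
  then show ?case using Suc lam_e[of k s] lam_beyond[of s "e k"] by (cases "s < r"; cases "s = k") auto
qed simp

text \<open>To leading order in \<open>1 / L\<close>, the weighted length is controlled by the coordinates, with a
  constant common to all good elements; only the lower order term depends on \<open>g\<close> otherwise.\<close>

lemma good_light:
  "\<exists>C\<ge>0. \<forall>g. good g \<longrightarrow> (\<exists>K\<ge>0. \<forall>L\<ge>1. light 0 L g (C * vnorm (lam g) / L ^ i + K / L ^ Suc i))"
proof -
  have "\<forall>s. \<exists>C. s < r \<longrightarrow> C \<ge> 0 \<and> (\<forall>L\<ge>1. light 0 L (e s) (C / L ^ i))"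
    using light_lower_central[OF e_in i_pos] by (metis le0)
  then obtain F where F: "\<And>s. s < r \<Longrightarrow> F s \<ge> 0 \<and> (\<forall>L\<ge>1. light 0 L (e s) (F s / L ^ i))" by metis
  have oprod: "light 0 L (oprod e m k) (\<Sum>s<k. real_of_int \<bar>m s\<bar> * (F s / L ^ i))" if "k \<le> r" "L \<ge> 1" for k m L
    using that(1)
  proof (induction k)
    case (Suc k)
    have "light 0 L (e k [^] m k) (real_of_int \<bar>m k\<bar> * (F k / L ^ i))"
      using F[of k] Suc that(2) by (intro light_int_pow) auto
    then show ?case using Suc by (auto intro: light_mult)
  qed (simp add: light_one)
  define C where "C = (\<Sum>s<r. F s)"
  have "\<exists>K\<ge>0. \<forall>L\<ge>1. light 0 L g (C * vnorm (lam g) / L ^ i + K / L ^ Suc i)" if "good g" for g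
  proof -
    obtain m where m: "cong_lc (Suc i) (oprod e m r) g"
      using \<open>good g\<close> cong_lc_sym by (auto simp: good_def)
    define z where "z = inv (oprod e m r) \<otimes> g"
    have z: "z \<in> lower_central G (Suc i)" using m by (simp add: z_def cong_lc_def)
    have g: "g = oprod e m r \<otimes> z" using m by (simp add: z_def cong_lc_def)
    obtain K where K: "K \<ge> 0" "\<And>L. L \<ge> 1 \<Longrightarrow> light 0 L z (K / L ^ Suc i)"
      using light_lower_central[OF z, of 0] by auto
    have m_lam: "real_of_int (m s) = lam g s" if "s < r" for s
      using that lam_mult[OF oprod_in[of r m], of z s] lam_deep[OF z] z lower_central_antimono[of i "Suc i"] lam_oprod[of r m s]
      unfolding g by auto
    have "light 0 L g (C * vnorm (lam g) / L ^ i + K / L ^ Suc i)" if L: "L \<ge> 1" for L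
    proof -
      have "(\<Sum>s<r. real_of_int \<bar>m s\<bar> * (F s / L ^ i)) \<le> (\<Sum>s<r. vnorm (lam g) * (F s / L ^ i))"
      proof (intro sum_mono mult_right_mono)
        fix s assume "s \<in> {..<r}"
        then show "real_of_int \<bar>m s\<bar> \<le> vnorm (lam g)" "0 \<le> F s / L ^ i"
          using m_lam[of s] abs_le_vnorm[of s "lam g"] F L by auto
      qed
      also have "\<dots> = C * vnorm (lam g) / L ^ i"
        by (simp add: C_def sum_distrib_left sum_distrib_right sum_divide_distrib mult.commute)
      finally have "light 0 L (oprod e m r) (C * vnorm (lam g) / L ^ i)"
        using oprod[of r L m] L light_mono by blast
      then show ?thesis unfolding g[symmetric] using light_mult[OF _ K(2)[OF L]] g by metis
    qed
    then show ?thesis using K(1) by blast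
  qed
  moreover have "C \<ge> 0" unfolding C_def using F by (intro sum_nonneg) auto
  ultimately show ?thesis by blast
qed

lemma eventually_large: "a > 0 \<Longrightarrow> \<exists>n0::nat. \<forall>n\<ge>n0. B \<le> (real n * a) powr (1 / i)"
proof -
  assume a: "a > 0"
  obtain n0 :: nat where n0: "(max B 0) ^ i / a \<le> real n0" using real_arch_simple by blast
  have "B \<le> (real n * a) powr (1 / i)" if "n \<ge> n0" for n
  proof -
    have "max B 0 ^ i / a \<le> real n" using that n0 by linarith
    then have "max B 0 ^ i \<le> real n * a" using a by (simp add: divide_le_eq)
    then have "(max B 0 ^ i) powr (1 / i) \<le> (real n * a) powr (1 / i)" by (intro powr_mono2) auto
    moreover have "(max B 0 ^ i) powr (1 / i) = max B 0"
      using i_pos by (intro powr_root_of_power) auto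
    ultimately show ?thesis by linarith
  qed
  then show ?thesis by blast
qed

text \<open>At the scale \<open>L = (n |\<lambda>|)\<^sup>1\<^sup>/\<^sup>i\<close> the first \<open>n\<close> powers are uniformly light.\<close>

lemma good_pow_light:
  "\<exists>C\<ge>1. \<forall>g. good g \<longrightarrow> vnorm (lam g) > 0 \<longrightarrow>
     (\<exists>n0. \<forall>n\<ge>n0. \<forall>j\<le>n. light 0 ((real n * vnorm (lam g)) powr (1 / i)) (g [^] (j::nat)) C)"
proof -
  obtain C where C: "C \<ge> 0" "\<And>g. good g \<Longrightarrow> \<exists>K\<ge>0. \<forall>L\<ge>1. light 0 L g (C * vnorm (lam g) / L ^ i + K / L ^ Suc i)"
    using good_light by blast
  have "\<exists>n0. \<forall>n\<ge>n0. \<forall>j\<le>n. light 0 ((real n * vnorm (lam g)) powr (1 / i)) (g [^] (j::nat)) (C + 1)"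
    if g: "good g" "vnorm (lam g) > 0" for g
  proof -
    define a where "a = vnorm (lam g)"
    obtain K where K: "K \<ge> 0" "\<And>L. L \<ge> 1 \<Longrightarrow> light 0 L g (C * a / L ^ i + K / L ^ Suc i)"
      using C(2)[OF g(1)] unfolding a_def by blast
    obtain n0 where n0: "\<And>n. n \<ge> n0 \<Longrightarrow> max 1 (K / a) \<le> (real n * a) powr (1 / i)"
      using eventually_large[of a] g(2) unfolding a_def by blast
    have "light 0 ((real n * a) powr (1 / i)) (g [^] j) (C + 1)" if "n \<ge> max n0 1" "j \<le> n" for n j
    proof -
      define L where "L = (real n * a) powr (1 / i)"
      have L: "1 \<le> L" "K / a \<le> L" using n0[of n] that by (auto simp: L_def)
      have n: "real n > 0" using that by simp
      have a: "a > 0" using g(2) by (simp add: a_def)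
      have Li: "L ^ i = real n * a" unfolding L_def by (rule power_of_powr_root) (use a i_pos in simp_all)
      have "real j * (C * a / L ^ i + K / L ^ Suc i) \<le> real n * (C * a / L ^ i + K / L ^ Suc i)"
        using that C(1) K(1) a L by (intro mult_right_mono add_nonneg_nonneg divide_nonneg_nonneg) auto
      also have "\<dots> = C + (K / a) / L"
        unfolding power_Suc Li using n a L by (simp add: field_simps)
      also have "(K / a) / L \<le> 1" using L by (subst divide_le_eq_1_pos) auto
      finally have "real j * (C * a / L ^ i + K / L ^ Suc i) \<le> C + 1" by simp
      from light_mono[OF light_pow[OF K(2)[OF L(1)]] this] show ?thesis unfolding L_def .
    qed
    then show ?thesis unfolding a_def by blast
  qed
  then show ?thesis using C(1) by (intro exI[of _ "C + 1"]) auto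
qed

lemma good_pow_nrm:
  "\<exists>C>0. \<forall>g. good g \<longrightarrow> vnorm (lam g) > 0 \<longrightarrow>
     (\<exists>n0. \<forall>n\<ge>n0. nrm (g [^] (n::nat)) \<le> C * (real n * vnorm (lam g)) powr (1 / i))"
proof -
  obtain C where C: "C \<ge> 1" "\<And>g. good g \<Longrightarrow> vnorm (lam g) > 0 \<Longrightarrow>
     \<exists>n0. \<forall>n\<ge>n0. \<forall>j\<le>n. light 0 ((real n * vnorm (lam g)) powr (1 / i)) (g [^] (j::nat)) C"
    using good_pow_light by blast
  obtain D where D: "D \<ge> 0" "\<And>L g. L \<ge> 1 \<Longrightarrow> light 0 L g 1 \<Longrightarrow> nrm g \<le> D * L"
    using nrm_le_of_light by blast
  have "\<exists>n0. \<forall>n\<ge>n0. nrm (g [^] n) \<le> (D * C + 1) * (real n * vnorm (lam g)) powr (1 / i)"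
    if g: "good g" "vnorm (lam g) > 0" for g
  proof -
    obtain n0 where n0: "\<And>n. n \<ge> n0 \<Longrightarrow> light 0 ((real n * vnorm (lam g)) powr (1 / i)) (g [^] n) C"
      using C(2)[OF g] by blast
    obtain n1 where n1: "\<And>n. n \<ge> n1 \<Longrightarrow> 1 \<le> (real n * vnorm (lam g)) powr (1 / i)"
      using eventually_large[OF g(2)] by blast
    have "nrm (g [^] n) \<le> (D * C + 1) * (real n * vnorm (lam g)) powr (1 / i)" if "n \<ge> max n0 n1" for n
    proof -
      define L where "L = (real n * vnorm (lam g)) powr (1 / i)"
      have L: "1 \<le> L" "light 0 L (g [^] n) C" using n0[of n] n1[of n] that by (auto simp: L_def)
      have "1 * 1 \<le> C * L" using L C(1) by (intro mult_mono) auto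
      then have "nrm (g [^] n) \<le> D * (C * L)" using light_enlarge[OF L(2) C(1) L(1)] D(2) by simp
      then show ?thesis unfolding L_def[symmetric] using L by (simp add: algebra_simps)
    qed
    then show ?thesis by blast
  qed
  moreover have "D * C + 1 > 0" using C(1) D(1) by (simp add: add_nonneg_pos)
  ultimately show ?thesis by blast
qed

text \<open>The quotient \<open>g\<^sup>-\<^sup>n h\<^sup>n\<close> is the product of the conjugates of \<open>g\<^sup>-\<^sup>1 h\<close> by
  \<open>g\<^sup>n\<^sup>-\<^sup>1, \<dots>, g, 1\<close>. These conjugating elements are uniformly light, so the weighted length
  grows like \<open>n\<close> times that of \<open>g\<^sup>-\<^sup>1 h\<close>, which is a small proportion of that of \<open>g\<^sup>n\<close>.\<close>

lemma good_quotient_nrm: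
  assumes \<epsilon>: "\<epsilon> > 0"
  shows "\<exists>\<delta>>0. \<forall>g h. good g \<longrightarrow> good h \<longrightarrow> vnorm (lam g) > 0 \<longrightarrow>
    vnorm (\<lambda>s. lam h s - lam g s) \<le> \<delta> * vnorm (lam g) \<longrightarrow>
     (\<exists>n0. \<forall>n\<ge>n0. nrm (inv (g [^] n) \<otimes> h [^] (n::nat)) \<le> \<epsilon> * (real n * vnorm (lam g)) powr (1 / i))"
proof -
  obtain C where C: "C \<ge> 1" "\<And>g. good g \<Longrightarrow> vnorm (lam g) > 0 \<Longrightarrow>
     \<exists>n0. \<forall>n\<ge>n0. \<forall>j\<le>n. light 0 ((real n * vnorm (lam g)) powr (1 / i)) (g [^] (j::nat)) C"
    using good_pow_light by blast
  obtain B where B: "B \<ge> 0" "\<And>g. good g \<Longrightarrow> \<exists>K\<ge>0. \<forall>L\<ge>1. light 0 L g (B * vnorm (lam g) / L ^ i + K / L ^ Suc i)"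
    using good_light by blast
  obtain E where E: "E \<ge> 0" "\<And>L g \<mu> h \<nu>. L \<ge> 1 \<Longrightarrow> light 0 L h \<nu> \<Longrightarrow> light 0 L g \<mu> \<Longrightarrow>
     light 0 L (inv h \<otimes> g \<otimes> h) (exp (E * \<nu>) * \<mu>)" using light_conj by blast
  obtain D where D: "D \<ge> 0" "\<And>L g \<mu>. L \<ge> 1 \<Longrightarrow> light 0 L g \<mu> \<Longrightarrow> 0 < \<mu> \<Longrightarrow> \<mu> \<le> 1 \<Longrightarrow> nrm g \<le> D * (\<mu> powr (1 / c) * L)"
    using nrm_le_of_light_small[OF c_pos] by blast
  define F where "F = exp (E * C) * (B + 1)"
  have F: "F > 0" using B(1) by (simp add: F_def add_nonneg_pos)
  \<comment> \<open>the weighted length that guarantees word length at most \<open>\<epsilon> L\<close>\<close>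
  define \<theta> where "\<theta> = min 1 ((\<epsilon> / (D + 1)) ^ c)"
  have \<theta>: "0 < \<theta>" "\<theta> \<le> 1" using \<epsilon> D(1) by (auto simp: \<theta>_def add_nonneg_pos)
  have \<theta>_le: "D * \<theta> powr (1 / c) \<le> \<epsilon>"
  proof -
    have "\<theta> powr (1 / c) \<le> ((\<epsilon> / (D + 1)) ^ c) powr (1 / c)"
      using \<theta> by (intro powr_mono2) (auto simp: \<theta>_def)
    also have "\<dots> = \<epsilon> / (D + 1)"
      using \<epsilon> D(1) c_pos by (intro powr_root_of_power) auto
    finally have "D * \<theta> powr (1 / c) \<le> D * (\<epsilon> / (D + 1))" using D(1) by (rule mult_left_mono)
    also have "\<dots> \<le> \<epsilon>" using D(1) \<epsilon> by (simp add: divide_le_eq algebra_simps)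
    finally show ?thesis .
  qed
  define \<delta> where "\<delta> = \<theta> / F"
  have \<delta>: "\<delta> > 0" using \<theta> F by (simp add: \<delta>_def)
  have "\<exists>n0. \<forall>n\<ge>n0. nrm (inv (g [^] n) \<otimes> h [^] n) \<le> \<epsilon> * (real n * vnorm (lam g)) powr (1 / i)"
    if gh: "good g" "good h" "vnorm (lam g) > 0" "vnorm (\<lambda>s. lam h s - lam g s) \<le> \<delta> * vnorm (lam g)" for g h
  proof -
    define a where "a = vnorm (lam g)"
    have a: "a > 0" using gh by (simp add: a_def)
    define k where "k = inv g \<otimes> h"
    have gc: "g \<in> carrier G" "h \<in> carrier G" "k \<in> carrier G"
      unfolding k_def using gh(1,2)[THEN good_in, THEN lower_central_carrier] by simp_all
    have k: "good k" unfolding k_def using gh good_inv good_mult by blast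
    have lam_k: "lam k = (\<lambda>s. lam h s - lam g s)"
      using gh good_in lower_central_inv by (auto simp: k_def lam_mult lam_inv fun_eq_iff)
    then have k_le: "vnorm (lam k) \<le> \<delta> * a" using gh(4) by (simp add: a_def)
    obtain K where K: "K \<ge> 0" "\<And>L. L \<ge> 1 \<Longrightarrow> light 0 L k (B * vnorm (lam k) / L ^ i + K / L ^ Suc i)"
      using B(2)[OF k] by blast
    obtain n0 where n0: "\<And>n j. n \<ge> n0 \<Longrightarrow> j \<le> n \<Longrightarrow> light 0 ((real n * a) powr (1 / i)) (g [^] j) C"
      using C(2)[OF gh(1,3)] unfolding a_def by blast
    obtain n1 where n1: "\<And>n. n \<ge> n1 \<Longrightarrow> max 1 (K / (a * \<delta>)) \<le> (real n * a) powr (1 / i)"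
      using eventually_large[OF a] by blast
    have "nrm (inv (g [^] n) \<otimes> h [^] n) \<le> \<epsilon> * (real n * a) powr (1 / i)" if n: "n \<ge> max (max n0 n1) 1" for n
    proof -
      define L where "L = (real n * a) powr (1 / i)"
      have L: "1 \<le> L" "K / (a * \<delta>) \<le> L" using n1[of n] n by (auto simp: L_def)
      have n_pos: "real n > 0" using n by simp
      have Li: "L ^ i = real n * a" unfolding L_def by (rule power_of_powr_root) (use a i_pos in simp_all)
      define \<mu> where "\<mu> = B * vnorm (lam k) / L ^ i + K / L ^ Suc i"
      have \<mu>: "light 0 L k \<mu>" using K(2)[OF L(1)] by (simp add: \<mu>_def)
      have D_light: "light 0 L (inv (g [^] j) \<otimes> h [^] j) (real j * (exp (E * C) * \<mu>))" if "j \<le> n" for j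
        using that
      proof (induction j)
        case (Suc j)
        have "light 0 L (inv (g [^] j) \<otimes> k \<otimes> g [^] j) (exp (E * C) * \<mu>)"
          using n0[of n j] n Suc by (intro E(2) L \<mu>) (auto simp: L_def)
        then have "light 0 L ((inv (g [^] j) \<otimes> k \<otimes> g [^] j) \<otimes> (inv (g [^] j) \<otimes> h [^] j))
            (exp (E * C) * \<mu> + real j * (exp (E * C) * \<mu>))"
          using Suc by (intro light_mult) auto
        moreover have "(inv (g [^] j) \<otimes> k \<otimes> g [^] j) \<otimes> (inv (g [^] j) \<otimes> h [^] j) = inv (g [^] Suc j) \<otimes> h [^] Suc j"
        proof -
          have "g [^] Suc j = g \<otimes> g [^] j" "h [^] Suc j = h \<otimes> h [^] j" using gc nat_pow_Suc2 by auto
          then show ?thesis using gc by (simp add: k_def group_word)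
        qed
        ultimately show ?case by (simp add: algebra_simps)
      qed (simp add: light_one)
      have "real n * \<mu> \<le> (B + 1) * \<delta>"
      proof -
        have "real n * \<mu> = B * (vnorm (lam k) / a) + (K / a) / L"
          unfolding \<mu>_def power_Suc Li using n_pos a L by (simp add: field_simps)
        also have "\<dots> \<le> B * \<delta> + \<delta>"
        proof (rule add_mono)
          show "B * (vnorm (lam k) / a) \<le> B * \<delta>"
            using k_le a B(1) by (intro mult_left_mono) (auto simp: divide_le_eq)
          show "(K / a) / L \<le> \<delta>" using L a \<delta> by (simp add: field_simps)
        qed
        finally show ?thesis by (simp add: algebra_simps)
      qed
      then have "exp (E * C) * (real n * \<mu>) \<le> exp (E * C) * ((B + 1) * \<delta>)" by (intro mult_left_mono) auto
      also have "\<dots> = F * \<delta>" by (simp add: F_def)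
      also have "\<dots> = \<theta>" using F by (simp add: \<delta>_def)
      finally have "light 0 L (inv (g [^] n) \<otimes> h [^] n) \<theta>"
        using D_light[of n] by (auto intro: light_mono simp: mult_ac)
      then have "nrm (inv (g [^] n) \<otimes> h [^] n) \<le> (D * \<theta> powr (1 / c)) * L"
        using D(2)[OF L(1) _ \<theta>] by (simp add: mult.assoc)
      also have "\<dots> \<le> \<epsilon> * L" using \<theta>_le L by (intro mult_right_mono) auto
      finally show ?thesis by (simp add: L_def)
    qed
    then show ?thesis unfolding a_def by blast
  qed
  then show ?thesis using \<delta> by blast
qed

end

context graded_coordinates
begin

definition dir :: "'a \<Rightarrow> nat \<Rightarrow> real" where
  "dir g s = lam g s / vnorm (lam g)"

lemma vnorm_dir: "vnorm (lam g) > 0 \<Longrightarrow> vnorm (dir g) = 1"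
  using vnorm_scale[of "1 / vnorm (lam g)" "lam g"] by (simp add: dir_def[abs_def])

lemma lam_dir: "vnorm (lam g) > 0 \<Longrightarrow> lam g s = vnorm (lam g) * dir g s"
  by (simp add: dir_def)

lemma vnorm_lam_pow: "g \<in> \<Gamma> \<Longrightarrow> vnorm (lam (g [^] (n::nat))) = real n * vnorm (lam g)"
proof -
  assume "g \<in> \<Gamma>"
  then have "lam (g [^] n) = (\<lambda>s. real n * lam g s)" by (simp add: lam_pow fun_eq_iff)
  then show ?thesis using vnorm_scale[of "real n" "lam g"] by simp
qed

text \<open>If two elements have nearby directions, powers of one follow those of the other up to
  an error that is small compared with the distance from the identity. To compare
  \<open>g\<close> and \<open>h\<close>, pass to powers whose coordinates are integral and almost equally long.\<close>

lemma shadow_powers: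
  assumes \<epsilon>: "\<epsilon> > 0"
  shows "\<exists>\<delta>>0. \<forall>g\<in>\<Gamma>. \<forall>h\<in>\<Gamma>. vnorm (lam g) > 0 \<longrightarrow> vnorm (lam h) > 0 \<longrightarrow>
     vnorm (\<lambda>s. dir h s - dir g s) < \<delta> \<longrightarrow>
     (\<exists>K\<ge>0. \<forall>m::nat. \<exists>n::nat. nrm (inv (g [^] n) \<otimes> h [^] m) \<le> \<epsilon> * nrm (g [^] n) + K)"
proof -
  obtain \<kappa> where \<kappa>: "\<kappa> > 0" "\<And>g. g \<in> \<Gamma> \<Longrightarrow> \<kappa> * vnorm (lam g) powr (1 / i) \<le> nrm g"
    using nrm_ge_lam by blast
  have "\<epsilon> * \<kappa> > 0" using \<epsilon> \<kappa> by simp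
  from good_quotient_nrm[OF this] obtain \<delta> where \<delta>: "\<delta> > 0"
    "\<And>g h. good g \<Longrightarrow> good h \<Longrightarrow> vnorm (lam g) > 0 \<Longrightarrow> vnorm (\<lambda>s. lam h s - lam g s) \<le> \<delta> * vnorm (lam g) \<Longrightarrow>
     \<exists>n0. \<forall>n\<ge>n0. nrm (inv (g [^] n) \<otimes> h [^] (n::nat)) \<le> \<epsilon> * \<kappa> * (real n * vnorm (lam g)) powr (1 / i)"
    by blast
  have "\<exists>K\<ge>0. \<forall>m::nat. \<exists>n::nat. nrm (inv (g [^] n) \<otimes> h [^] m) \<le> \<epsilon> * nrm (g [^] n) + K"
    if gh: "g \<in> \<Gamma>" "h \<in> \<Gamma>" "vnorm (lam g) > 0" "vnorm (lam h) > 0" "vnorm (\<lambda>s. dir h s - dir g s) < \<delta> / 2" for g h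
  proof -
    have car: "g \<in> carrier G" "h \<in> carrier G" using gh lower_central_carrier by auto
    obtain p0 where p0: "0 < p0" "good (g [^] (p0::nat))" using ex_good_pow[OF gh(1)] by blast
    obtain q0 where q0: "0 < q0" "good (h [^] (q0::nat))" using ex_good_pow[OF gh(2)] by blast
    define a b where "a = real p0 * vnorm (lam g)" and "b = real q0 * vnorm (lam h)"
    have ab: "a > 0" "b > 0" using p0 q0 gh by (auto simp: a_def b_def)
    \<comment> \<open>Multiples \<open>j a \<approx> l b\<close> of the two lengths, with relative error at most \<open>\<delta> / 2\<close>.\<close>
    obtain j :: nat where j: "2 * b / (\<delta> * a) + 1 \<le> real j" using real_arch_simple by blast
    have "0 \<le> 2 * b / (\<delta> * a)" using ab \<delta>(1) by simp
    then have j1: "1 \<le> real j" "2 * b / (\<delta> * a) \<le> real j" using j by linarith+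
    define l where "l = nat \<lceil>real j * a / b\<rceil>"
    have ja: "0 < real j * a / b" using j1 ab by simp
    then have l: "real j * a / b \<le> real l" "real l \<le> real j * a / b + 1" "0 < l"
      unfolding l_def by linarith+
    have b_le: "b \<le> \<delta> / 2 * (real j * a)"
      using j1(2) ab \<delta>(1) by (simp add: divide_le_eq algebra_simps)
    have lj: "\<bar>real l * b - real j * a\<bar> \<le> \<delta> / 2 * (real j * a)"
    proof -
      have "real j * a \<le> real l * b" using l(1) ab by (simp add: divide_le_eq)
      moreover have "real l * b \<le> (real j * a / b + 1) * b" using l(2) ab by (intro mult_right_mono) auto
      moreover have "(real j * a / b + 1) * b = real j * a + b" using ab by (simp add: field_simps)
      ultimately show ?thesis using b_le by linarith
    qed
    define P Q where "P = p0 * j" and "Q = q0 * l"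
    have Q: "0 < Q" using q0 l by (simp add: Q_def)
    have goodP: "good (g [^] P)" "good (h [^] Q)"
      using good_pow[OF p0(2), of j] good_pow[OF q0(2), of l] car by (simp_all add: P_def Q_def nat_pow_pow)
    have vP: "vnorm (lam (g [^] P)) = real j * a" "vnorm (lam (h [^] Q)) = real l * b"
      using gh by (simp_all add: vnorm_lam_pow P_def Q_def a_def b_def)
    have lamP: "lam (g [^] P) s = real j * a * dir g s" "lam (h [^] Q) s = real l * b * dir h s" for s
      using gh by (simp_all add: lam_pow P_def Q_def a_def b_def dir_def)
    have "vnorm (\<lambda>s. lam (h [^] Q) s - lam (g [^] P) s)
       = vnorm (\<lambda>s. (real l * b - real j * a) * dir h s + real j * a * (dir h s - dir g s))"
      by (simp add: lamP algebra_simps)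
    also have "\<dots> \<le> vnorm (\<lambda>s. (real l * b - real j * a) * dir h s) + vnorm (\<lambda>s. real j * a * (dir h s - dir g s))"
      by (rule vnorm_triangle)
    also have "\<dots> = \<bar>real l * b - real j * a\<bar> + real j * a * vnorm (\<lambda>s. dir h s - dir g s)"
      unfolding vnorm_scale using vnorm_dir[OF gh(4)] ab by simp
    also have "\<dots> \<le> \<delta> / 2 * (real j * a) + real j * a * (\<delta> / 2)"
      using lj gh(5) ab by (intro add_mono mult_left_mono) auto
    also have "\<dots> = \<delta> * vnorm (lam (g [^] P))" by (simp add: vP)
    finally obtain n0 where n0: "\<And>n. n \<ge> n0 \<Longrightarrow> nrm (inv ((g [^] P) [^] n) \<otimes> (h [^] Q) [^] n)
        \<le> \<epsilon> * \<kappa> * (real n * vnorm (lam (g [^] P))) powr (1 / i)"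
      using \<delta>(2)[OF goodP] vP ab j1 by auto
    define K where "K = (\<Sum>n<n0. nrm (inv ((g [^] P) [^] n) \<otimes> (h [^] Q) [^] n)) + (\<Sum>t<Q. nrm (h [^] t))"
    have K: "K \<ge> 0" by (simp add: K_def sum_nonneg)
    have "\<exists>n::nat. nrm (inv (g [^] n) \<otimes> h [^] m) \<le> \<epsilon> * nrm (g [^] n) + K" for m :: nat
    proof -
      \<comment> \<open>\<open>h\<^sup>m\<close> is within bounded distance of the \<open>n\<close>-th power of \<open>h\<^sup>Q\<close>, which \<open>(g\<^sup>P)\<^sup>n\<close> shadows.\<close>
      define n t where "n = m div Q" and "t = m mod Q"
      have t: "t < Q" "m = Q * n + t" using Q by (auto simp: n_def t_def)
      define v where "v = inv ((g [^] P) [^] n) \<otimes> (h [^] Q) [^] n"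
      have v: "v \<in> carrier G" using car by (simp add: v_def)
      have hm: "h [^] m = (h [^] Q) [^] n \<otimes> h [^] t"
        unfolding t(2) using car by (simp add: nat_pow_mult nat_pow_pow)
      then have "inv ((g [^] P) [^] n) \<otimes> h [^] m = v \<otimes> h [^] t"
        using car by (simp add: v_def m_assoc)
      then have 1: "nrm (inv ((g [^] P) [^] n) \<otimes> h [^] m) \<le> nrm v + nrm (h [^] t)"
        using nrm_mult[OF v, of "h [^] t"] car by simp
      have 2: "nrm (h [^] t) \<le> (\<Sum>t<Q. nrm (h [^] t))" using t by (intro member_le_sum) auto
      have 3: "nrm v \<le> \<epsilon> * nrm ((g [^] P) [^] n) + (\<Sum>n<n0. nrm (inv ((g [^] P) [^] n) \<otimes> (h [^] Q) [^] n))"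
      proof (cases "n < n0")
        case True
        then have "nrm v \<le> (\<Sum>n<n0. nrm (inv ((g [^] P) [^] n) \<otimes> (h [^] Q) [^] n))"
          unfolding v_def by (intro member_le_sum) auto
        then show ?thesis using \<epsilon> nrm_nonneg[of "(g [^] P) [^] n"] by (simp add: add_increasing)
      next
        case False
        have gP: "g [^] P \<in> \<Gamma>" using gh(1) lower_central_pow by blast
        have "\<kappa> * (real n * vnorm (lam (g [^] P))) powr (1 / i) \<le> nrm ((g [^] P) [^] n)"
          using \<kappa>(2)[of "(g [^] P) [^] n"] gP lower_central_pow vnorm_lam_pow[OF gP, of n] by simp
        then have "\<epsilon> * (\<kappa> * (real n * vnorm (lam (g [^] P))) powr (1 / i)) \<le> \<epsilon> * nrm ((g [^] P) [^] n)"
          using \<epsilon> by (intro mult_left_mono) auto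
        then have "nrm v \<le> \<epsilon> * nrm ((g [^] P) [^] n)" using n0[of n] False by (simp add: v_def mult.assoc)
        moreover have "0 \<le> (\<Sum>n<n0. nrm (inv ((g [^] P) [^] n) \<otimes> (h [^] Q) [^] n))" by (simp add: sum_nonneg)
        ultimately show ?thesis by linarith
      qed
      have "nrm (inv ((g [^] P) [^] n) \<otimes> h [^] m) \<le> \<epsilon> * nrm ((g [^] P) [^] n) + K"
        using 1 2 3 by (simp add: K_def)
      then show ?thesis using car by (intro exI[of _ "P * n"]) (simp add: nat_pow_pow)
    qed
    then show ?thesis using K by blast
  qed
  then show ?thesis using \<delta>(1) by (intro exI[of _ "\<delta> / 2"]) auto
qed

lemma nrm_pow_unbounded:
  assumes "g \<in> \<Gamma>" "vnorm (lam g) > 0"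
  shows "\<exists>n::nat. B < nrm (g [^] n)"
proof -
  obtain \<kappa> where \<kappa>: "\<kappa> > 0" "\<And>g. g \<in> \<Gamma> \<Longrightarrow> \<kappa> * vnorm (lam g) powr (1 / i) \<le> nrm g"
    using nrm_ge_lam by blast
  obtain n where n: "(B + 1) / \<kappa> \<le> (real n * vnorm (lam g)) powr (1 / i)"
    using eventually_large[OF assms(2)] by blast
  have "B + 1 \<le> \<kappa> * (real n * vnorm (lam g)) powr (1 / i)"
    using n \<kappa>(1) by (simp add: divide_le_eq mult.commute)
  also have "\<dots> \<le> nrm (g [^] n)"
    using \<kappa>(2)[of "g [^] n"] assms vnorm_lam_pow lower_central_pow by simp
  finally show ?thesis by (intro exI[of _ n]) simp
qed

text \<open>If the direction of \<open>g\<close> keeps distance \<open>\<rho>\<close> from all multiples of the coordinates of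
  \<open>h\<close>, then \<open>h\<^sup>-\<^sup>m g\<^sup>n\<close> has coordinates of length at least \<open>n |\<lambda> g| \<rho>\<close>, so its word
  length is at least proportional to that of \<open>g\<^sup>n\<close>.\<close>

lemma separated_powers:
  assumes \<rho>: "\<rho> > 0"
  shows "\<exists>\<kappa>>0. \<forall>g\<in>\<Gamma>. \<forall>h\<in>\<Gamma>. \<forall>Z \<alpha> K. vnorm (lam g) > 0 \<longrightarrow>
     (\<forall>m\<in>Z. \<forall>\<tau>\<ge>0. \<rho> \<le> vnorm (\<lambda>s. dir g s - \<tau> * real_of_int m * lam h s)) \<longrightarrow> 0 \<le> \<alpha> \<longrightarrow>
     (\<forall>n::nat. \<exists>m\<in>Z. nrm (inv (h [^] (m::int)) \<otimes> g [^] n) \<le> \<alpha> * nrm (h [^] m) + K) \<longrightarrow> \<kappa> \<le> \<alpha>"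
proof -
  obtain \<kappa> where \<kappa>: "\<kappa> > 0" "\<And>g. g \<in> \<Gamma> \<Longrightarrow> \<kappa> * vnorm (lam g) powr (1 / i) \<le> nrm g"
    using nrm_ge_lam by blast
  obtain C where C: "C > 0" "\<And>g. good g \<Longrightarrow> vnorm (lam g) > 0 \<Longrightarrow>
     \<exists>n0. \<forall>n\<ge>n0. nrm (g [^] (n::nat)) \<le> C * (real n * vnorm (lam g)) powr (1 / i)"
    using good_pow_nrm by blast
  define \<beta> where "\<beta> = \<kappa> * \<rho> powr (1 / i)"
  have \<beta>: "\<beta> > 0" using \<kappa>(1) \<rho> by (simp add: \<beta>_def)
  \<comment> \<open>Below \<open>1 / 2\<close>, being near \<open>g\<^sup>n\<close> bounds \<open>\<parallel>h\<^sup>m\<parallel>\<close> by \<open>2 \<parallel>g\<^sup>n\<parallel>\<close> up to a constant. Below \<open>\<beta> / (2 C)\<close>, this contradicts the growth of \<open>\<parallel>h\<^sup>-\<^sup>m g\<^sup>n\<parallel>\<close>.\<close>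
  define \<eta> where "\<eta> = min (1 / 2) (\<beta> / (2 * C))"
  have \<eta>: "\<eta> > 0" using \<beta> C(1) by (simp add: \<eta>_def)
  have "\<eta> \<le> \<alpha>" if g: "g \<in> \<Gamma>" and h: "h \<in> \<Gamma>" and g0: "vnorm (lam g) > 0"
    and sep: "\<And>m \<tau>. m \<in> Z \<Longrightarrow> 0 \<le> \<tau> \<Longrightarrow> \<rho> \<le> vnorm (\<lambda>s. dir g s - \<tau> * real_of_int m * lam h s)"
    and \<alpha>: "0 \<le> \<alpha>"
    and near: "\<And>n. \<exists>m\<in>Z. nrm (inv (h [^] (m::int)) \<otimes> g [^] (n::nat)) \<le> \<alpha> * nrm (h [^] m) + K'"
    for g h Z \<alpha> K'
  proof (rule ccontr)
    assume "\<not> \<eta> \<le> \<alpha>"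
    then have "\<alpha> < 1 / 2" "\<alpha> < \<beta> / (2 * C)" by (auto simp: \<eta>_def)
    then have small: "\<alpha> < 1 / 2" "2 * C * \<alpha> < \<beta>" using C(1) by (simp_all add: less_divide_eq mult.commute)
    define K where "K = max K' 0"
    have K: "0 \<le> K" by (simp add: K_def)
    have car: "g \<in> carrier G" "h \<in> carrier G" using g h lower_central_carrier by auto
    obtain p where p: "0 < p" "good (g [^] (p::nat))" using ex_good_pow[OF g] by blast
    define a where "a = vnorm (lam (g [^] p))"
    have a_eq: "a = real p * vnorm (lam g)" using vnorm_lam_pow[OF g] by (simp add: a_def)
    have a: "a > 0" using p g0 by (simp add: a_eq)
    obtain n0 where n0: "\<And>n. n \<ge> n0 \<Longrightarrow> nrm ((g [^] p) [^] n) \<le> C * (real n * a) powr (1 / i)"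
      using C(2)[OF p(2)] a unfolding a_def by blast
    obtain n1 where n1: "\<And>n. n \<ge> n1 \<Longrightarrow> (2 * K + 1) / (\<beta> - 2 * C * \<alpha>) \<le> (real n * a) powr (1 / i)"
      using eventually_large[OF a] by blast
    define n where "n = max (max n0 n1) 1"
    define X where "X = (real n * a) powr (1 / i)"
    have n: "n \<ge> n0" "n \<ge> n1" "real n \<ge> 1" by (auto simp: n_def)
    define v where "v = g [^] (p * n)"
    have v: "v \<in> \<Gamma>" "v \<in> carrier G" using g lower_central_pow car by (auto simp: v_def)
    have v_le: "nrm v \<le> C * X" using n0[OF n(1)] car by (simp add: v_def X_def nat_pow_pow)
    obtain m where m: "m \<in> Z" "nrm (inv (h [^] m) \<otimes> v) \<le> \<alpha> * nrm (h [^] m) + K'"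
      using near[of "p * n"] unfolding v_def by blast
    have "K' \<le> K" by (simp add: K_def)
    with m have m: "m \<in> Z" "nrm (inv (h [^] m) \<otimes> v) \<le> \<alpha> * nrm (h [^] m) + K" by linarith+
    have hm: "h [^] m \<in> \<Gamma>" "h [^] m \<in> carrier G" using h lower_central_int_pow car by auto
    have "h [^] m = v \<otimes> inv (inv (h [^] m) \<otimes> v)" using v hm by (simp add: inv_mult_group)
    then have "nrm (h [^] m) \<le> nrm v + nrm (inv (h [^] m) \<otimes> v)"
      using nrm_mult[of v "inv (inv (h [^] m) \<otimes> v)"] v hm by simp
    also have "\<dots> \<le> nrm v + (1 / 2 * nrm (h [^] m) + K)"
      using m(2) small(1) mult_right_mono[of \<alpha> "1 / 2" "nrm (h [^] m)"] by simp
    finally have "nrm (h [^] m) \<le> 2 * (nrm v + K)" by simp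
    then have "\<alpha> * nrm (h [^] m) \<le> \<alpha> * (2 * (nrm v + K))" using \<alpha> by (intro mult_left_mono)
    also have "\<dots> \<le> \<alpha> * (2 * (C * X + K))" using v_le \<alpha> by (intro mult_left_mono) auto
    also have "\<dots> = 2 * C * \<alpha> * X + 2 * \<alpha> * K" by (simp add: algebra_simps)
    also have "2 * \<alpha> * K \<le> K" using mult_right_mono[of "2 * \<alpha>" 1 K] small(1) K by simp
    finally have upper: "nrm (inv (h [^] m) \<otimes> v) \<le> 2 * C * \<alpha> * X + 2 * K" using m(2) by simp
    have lam_v: "lam v s = real n * a * dir g s" for s
      using g g0 by (simp add: v_def lam_pow a_eq dir_def)
    have "lam (inv (h [^] m) \<otimes> v) s = real n * a * (dir g s - (1 / (real n * a)) * real_of_int m * lam h s)" for s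
    proof -
      have "lam (inv (h [^] m) \<otimes> v) s = real n * a * dir g s - real_of_int m * lam h s"
        using v hm h by (simp add: lam_mult lam_inv lower_central_inv lam_int_pow lam_v)
      then show ?thesis using n a by (simp add: right_diff_distrib)
    qed
    then have "vnorm (lam (inv (h [^] m) \<otimes> v))
        = vnorm (\<lambda>s. real n * a * (dir g s - (1 / (real n * a)) * real_of_int m * lam h s))"
      by presburger
    also have "\<dots> = real n * a * vnorm (\<lambda>s. dir g s - (1 / (real n * a)) * real_of_int m * lam h s)"
      unfolding vnorm_scale using n a by simp
    finally have "real n * a * \<rho> \<le> vnorm (lam (inv (h [^] m) \<otimes> v))"
      using sep[OF m(1), of "1 / (real n * a)"] n a by (simp add: mult_left_mono)
    then have "(real n * a * \<rho>) powr (1 / i) \<le> vnorm (lam (inv (h [^] m) \<otimes> v)) powr (1 / i)"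
      using n a \<rho> by (intro powr_mono2) auto
    moreover have "(real n * a * \<rho>) powr (1 / i) = X * \<rho> powr (1 / i)"
      using n a \<rho> by (simp add: X_def powr_mult)
    ultimately have "\<kappa> * (X * \<rho> powr (1 / i)) \<le> \<kappa> * vnorm (lam (inv (h [^] m) \<otimes> v)) powr (1 / i)"
      using \<kappa>(1) by simp
    also have "\<dots> \<le> nrm (inv (h [^] m) \<otimes> v)"
      using v hm by (intro \<kappa>(2) lower_central_mult lower_central_inv) auto
    finally have "\<beta> * X \<le> 2 * C * \<alpha> * X + 2 * K" using upper by (simp add: \<beta>_def mult_ac)
    then have "(\<beta> - 2 * C * \<alpha>) * X \<le> 2 * K" by (simp add: algebra_simps)
    moreover have "2 * K + 1 \<le> (\<beta> - 2 * C * \<alpha>) * X"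
      using n1[OF n(2)] small(2) by (simp add: X_def divide_le_eq mult.commute)
    ultimately show False by simp
  qed
  then show ?thesis using \<eta> by (intro exI[of _ \<eta>]) blast
qed

end

section \<open>Classes of unbounded sets\<close>

lemma thicken_basepoint:
  assumes "p \<in> mspace m" "p' \<in> mspace m" "0 \<le> \<alpha>"
  shows "thicken m p \<alpha> R a \<subseteq> thicken m p' \<alpha> R (a + \<alpha> * mdist m p p')"
proof
  fix y assume "y \<in> thicken m p \<alpha> R a"
  then obtain x where x: "x \<in> R" "y \<in> mcball_of m x (\<alpha> * mdist m p x + a)"
    by (auto simp: thicken_def)
  then have "x \<in> mspace m" by simp
  then have "mdist m p x \<le> mdist m p p' + mdist m p' x"
    using assms by (intro mdist_triangle)
  then have "\<alpha> * mdist m p x \<le> \<alpha> * (mdist m p p' + mdist m p' x)"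
    using assms(3) by (rule mult_left_mono)
  then have "y \<in> mcball_of m x (\<alpha> * mdist m p' x + (a + \<alpha> * mdist m p p'))"
    using x by (simp add: algebra_simps)
  with x(1) show "y \<in> thicken m p' \<alpha> R (a + \<alpha> * mdist m p p')"
    unfolding thicken_def by blast
qed

lemma s_plus_basepoint:
  assumes "p \<in> mspace m" "p' \<in> mspace m"
  shows "s_plus m p R S = s_plus m p' R S"
proof -
  have "{\<alpha>. 0 \<le> \<alpha> \<and> (\<exists>a\<ge>0. S \<subseteq> thicken m p \<alpha> R a)} \<subseteq> {\<alpha>. 0 \<le> \<alpha> \<and> (\<exists>a\<ge>0. S \<subseteq> thicken m p' \<alpha> R a)}"
    if "p \<in> mspace m" "p' \<in> mspace m" for p p'
  proof clarify
    fix \<alpha> a :: real assume *: "0 \<le> \<alpha>" "0 \<le> a" "S \<subseteq> thicken m p \<alpha> R a"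
    then have "S \<subseteq> thicken m p' \<alpha> R (a + \<alpha> * mdist m p p')"
      using thicken_basepoint[OF that, of \<alpha> R a] by blast
    with * show "\<exists>a\<ge>0. S \<subseteq> thicken m p' \<alpha> R a"
      by (intro exI[of _ "a + \<alpha> * mdist m p p'"]) simp
  qed
  from subset_antisym[OF this[OF assms] this[OF assms(2,1)]] show ?thesis
    by (simp only: s_plus_def)
qed

lemma boundary_basepoint:
  assumes "p \<in> mspace m" "p' \<in> mspace m"
  shows "boundary m p \<E> = boundary m p' \<E>"
proof -
  have s: "s_dist m p R S = s_dist m p' R S" for R S
    by (simp add: s_dist_def s_plus_basepoint[OF assms])
  have e: "s_equiv m p = s_equiv m p'" by (simp add: s_equiv_def s)
  have "t_dist m p = t_dist m p'" by (intro ext) (simp add: t_dist_def s)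
  then have "t_class m p = t_class m p'"
    by (simp add: t_class_def[abs_def] e cong: if_cong)
  then have "class_metric m p = class_metric m p'" by (simp add: class_metric_def e)
  then show ?thesis by (simp add: boundary_def e)
qed

text \<open>The limit of a Cauchy sequence of sets is pieced together from annuli: far out, take
  a late member of the sequence. The radii grow so fast that the additive constants
  relating the first \<open>l\<close> sets are negligible beyond the \<open>l\<close>-th radius.\<close>

lemma limit_of_sets:
  fixes S :: "nat \<Rightarrow> 'a set" and \<epsilon> :: "nat \<Rightarrow> real"
  assumes p: "p \<in> mspace m" and S: "\<And>k. S k \<in> unbounded_sets m"
    and \<epsilon>: "\<And>k. 0 < \<epsilon> k" "\<And>k. \<epsilon> k \<le> 1 / 2" "\<And>k l. k \<le> l \<Longrightarrow> \<epsilon> l \<le> \<epsilon> k"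
    and close: "\<And>k l. k \<le> l \<Longrightarrow> \<exists>a\<ge>0. S l \<subseteq> thicken m p (\<epsilon> k) (S k) a \<and> S k \<subseteq> thicken m p (\<epsilon> k) (S l) a"
  shows "\<exists>T\<in>unbounded_sets m. \<forall>k. s_dist m p (S k) T \<le> 4 * \<epsilon> k"
proof -
  define n where "n = mdist m p"
  have SM: "S k \<subseteq> mspace m" for k using S by (simp add: unbounded_sets_def)
  have tri: "n y \<le> n x + mdist m x y" "n x \<le> n y + mdist m x y" "mdist m x y \<le> n x + n y"
    if "x \<in> mspace m" "y \<in> mspace m" for x y
    using mdist_triangle[of p m x y] mdist_triangle[of p m y x] mdist_triangle[of x m p y] p that
    by (simp_all add: n_def mdist_commute)
  obtain a where a: "\<And>k l. k \<le> l \<Longrightarrow> 0 \<le> a k l \<and> S l \<subseteq> thicken m p (\<epsilon> k) (S k) (a k l) \<and> S k \<subseteq> thicken m p (\<epsilon> k) (S l) (a k l)"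
    using close by metis
  define A where "A l = (\<Sum>k\<le>l. a k l)" for l
  have A: "a k l \<le> A l" if "k \<le> l" for k l
    unfolding A_def by (rule member_le_sum) (use a that in auto)
  have A0: "0 \<le> A l" for l unfolding A_def by (rule sum_nonneg) (use a in auto)
  \<comment> \<open>the summand 1 makes the radii tend to infinity\<close>
  define rad where "rad l = (\<Sum>j\<le>l. A j / \<epsilon> j + 1)" for l
  have rad_Suc: "rad (Suc l) = rad l + (A (Suc l) / \<epsilon> (Suc l) + 1)" for l by (simp add: rad_def)
  have rad_mono: "rad k \<le> rad l" if "k \<le> l" for k l
    unfolding rad_def by (rule sum_mono2) (use that A0 \<epsilon>(1) less_imp_le in \<open>auto intro!: add_nonneg_nonneg divide_nonneg_nonneg\<close>)
  have rad_large: "real l \<le> rad l" for l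
  proof (induction l)
    case 0
    then show ?case using A0[of 0] \<epsilon>(1)[of 0] by (simp add: rad_def)
  next
    case (Suc l)
    have "0 \<le> A (Suc l) / \<epsilon> (Suc l)" using A0[of "Suc l"] \<epsilon>(1)[of "Suc l"] by simp
    with Suc show ?case by (simp add: rad_Suc)
  qed
  have A_rad: "A l \<le> \<epsilon> k * rad l" if "k \<le> l" for k l
  proof -
    have "A l / \<epsilon> l + 1 \<le> rad l" unfolding rad_def
      by (rule member_le_sum) (use A0 \<epsilon>(1) less_imp_le in \<open>auto intro!: add_nonneg_nonneg divide_nonneg_nonneg\<close>)
    then have "A l / \<epsilon> l \<le> rad l" by simp
    then have "A l \<le> \<epsilon> l * rad l" using \<epsilon>(1)[of l] by (simp add: divide_le_eq mult.commute)
    also have "\<dots> \<le> \<epsilon> k * rad l" using \<epsilon>(3)[OF that] rad_large[of l] by (intro mult_right_mono) auto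
    finally show ?thesis .
  qed
  have near: "\<exists>x\<in>R. x \<in> mspace m \<and> mdist m x y \<le> \<epsilon> k * n x + \<epsilon> k * rad l"
    if y: "y \<in> R'" "R' \<subseteq> thicken m p (\<epsilon> k) R (a k l)" and kl: "k \<le> l" for y R R' k l
  proof -
    obtain x where "x \<in> R" "y \<in> mcball_of m x (\<epsilon> k * mdist m p x + a k l)"
      using y by (auto simp: thicken_def)
    then show ?thesis using A[OF kl] A_rad[OF kl] by (intro bexI[of _ x]) (auto simp: n_def)
  qed
  \<comment> \<open>The pieces are wide enough to contain all approximations to points with \<open>2 rad l \<le> n y \<le> 2 rad (l + 1)\<close>.\<close>
  define T where "T = (\<Union>l. {y \<in> S l. rad l \<le> n y \<and> n y \<le> 5 * rad (Suc l)})"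
  have TM: "T \<subseteq> mspace m" using SM by (auto simp: T_def)
  have in_T: "\<exists>x\<in>T. mdist m x y \<le> 2 * \<epsilon> k * n x" if y: "y \<in> S k" "2 * rad k < n y" for y k
  proof -
    define l' where "l' = (LEAST l. n y < 2 * rad l)"
    obtain j where "n y < real j" using reals_Archimedean2 by blast
    then have "n y < 2 * rad j" using rad_large[of j] by linarith
    then have l'1: "n y < 2 * rad l'" unfolding l'_def by (rule LeastI)
    have "k < l'"
    proof (rule ccontr)
      assume "\<not> k < l'"
      then have "rad l' \<le> rad k" by (intro rad_mono) simp
      with l'1 y(2) show False by simp
    qed
    then obtain l where l: "l' = Suc l" "k \<le> l" by (cases l') auto
    have "\<not> n y < 2 * rad l" using not_less_Least[of l "\<lambda>l. n y < 2 * rad l"] l by (simp add: l'_def)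
    then have y_range: "2 * rad l \<le> n y" "n y < 2 * rad (Suc l)" using l'1 l by auto
    obtain x where x: "x \<in> S l" "x \<in> mspace m" "mdist m x y \<le> \<epsilon> k * n x + \<epsilon> k * rad l"
      using near[OF y(1) _ l(2)] a[OF l(2)] by blast
    have yM: "y \<in> mspace m" using y SM by blast
    have nx: "0 \<le> n x" by (simp add: n_def)
    have r0: "0 \<le> rad l" using rad_large[of l] by simp
    have e: "\<epsilon> k * n x \<le> 1 / 2 * n x" "\<epsilon> k * rad l \<le> 1 / 2 * rad l"
      using \<epsilon>(2)[of k] nx r0 by (intro mult_right_mono; simp)+
    have "rad l \<le> n x" using tri(1)[OF x(2) yM] x(3) y_range(1) e by linarith
    moreover have "n x \<le> 5 * rad (Suc l)"
      using tri(2)[OF x(2) yM] x(3) y_range(2) e rad_mono[of l "Suc l"] by linarith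
    ultimately have "x \<in> T" using x(1) unfolding T_def by blast
    moreover have "\<epsilon> k * rad l \<le> \<epsilon> k * n x" using \<open>rad l \<le> n x\<close> \<epsilon>(1)[of k] by simp
    ultimately show ?thesis using x(3) by (intro bexI[of _ x]) auto
  qed
  have T: "T \<in> unbounded_sets m"
  proof -
    interpret Metric_space "mspace m" "mdist m" by simp
    have "\<not> mbounded T"
    proof
      assume "mbounded T"
      then obtain x0 B0 where B0: "T \<subseteq> mcball x0 B0" by (auto simp: mbounded_def)
      define B where "B = n x0 + B0"
      have B: "n x \<le> B" if "x \<in> T" for x
      proof -
        have "x0 \<in> mspace m" "x \<in> mspace m" "mdist m x0 x \<le> B0" using B0 that by auto
        then show ?thesis using tri(1)[of x0 x] by (simp add: B_def)
      qed
      obtain y where y: "y \<in> S 0" "y \<in> mspace m" "mdist m p y > max (2 * rad 0) (2 * B)"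
        using unbounded_sets_far[OF S p] by blast
      then obtain x where x: "x \<in> T" "mdist m x y \<le> 2 * \<epsilon> 0 * n x"
        using in_T[of y 0] by (auto simp: n_def)
      have "2 * \<epsilon> 0 * n x \<le> 1 * n x" using \<epsilon>(2)[of 0] by (intro mult_right_mono) (auto simp: n_def)
      then have "n y \<le> 2 * n x" using tri(1)[of x y] x TM y(2) by auto
      then show False using B[OF x(1)] y(3) by (simp add: n_def)
    qed
    then show ?thesis using TM by (simp add: unbounded_sets_def)
  qed
  have "s_dist m p (S k) T \<le> 4 * \<epsilon> k" for k
  proof -
    obtain x0 where x0: "x0 \<in> S k" "x0 \<in> mspace m" using unbounded_sets_far[OF S p] by blast
    obtain x1 where x1: "x1 \<in> T" "x1 \<in> mspace m" using unbounded_sets_far[OF T p] by blast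
    have rk: "0 \<le> rad k" using rad_large[of k] by simp
    have far: "y \<in> thicken m p (4 * \<epsilon> k) R (n x + B)" if "x \<in> R" "x \<in> mspace m" "y \<in> mspace m" "n y \<le> B" for x y R B
    proof -
      have "mdist m x y \<le> 4 * \<epsilon> k * mdist m p x + (n x + B)"
        using tri(3)[OF that(2,3)] that(4) \<epsilon>(1)[of k] by (simp add: add_increasing)
      then show ?thesis using that by (auto simp: thicken_def)
    qed
    have close: "y \<in> thicken m p (4 * \<epsilon> k) R B" if "x \<in> R" "x \<in> mspace m" "y \<in> mspace m" "mdist m x y \<le> 4 * \<epsilon> k * n x" "0 \<le> B" for x y R B
      using that by (auto simp: thicken_def n_def intro!: bexI[of _ x])
    have "T \<subseteq> thicken m p (4 * \<epsilon> k) (S k) (n x0 + 5 * rad k)"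
    proof
      fix y assume "y \<in> T"
      then obtain l where l: "y \<in> S l" "rad l \<le> n y" "n y \<le> 5 * rad (Suc l)" by (auto simp: T_def)
      have yM: "y \<in> mspace m" using l SM by blast
      show "y \<in> thicken m p (4 * \<epsilon> k) (S k) (n x0 + 5 * rad k)"
      proof (cases "k \<le> l")
        case True
        obtain x where x: "x \<in> S k" "x \<in> mspace m" "mdist m x y \<le> \<epsilon> k * n x + \<epsilon> k * rad l"
          using near[OF l(1) _ True] a[OF True] by blast
        have "\<epsilon> k * rad l \<le> \<epsilon> k * n y" using l(2) \<epsilon>(1)[of k] by simp
        also have "\<dots> \<le> \<epsilon> k * (n x + mdist m x y)" using tri(1)[OF x(2) yM] \<epsilon>(1)[of k] by simp
        also have "\<dots> \<le> \<epsilon> k * n x + 1 / 2 * mdist m x y"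
          using mult_right_mono[OF \<epsilon>(2)[of k], of "mdist m x y"] by (simp add: algebra_simps)
        finally have "mdist m x y \<le> 4 * \<epsilon> k * n x" using x(3) by simp
        then show ?thesis using x yM rk by (intro close) (auto simp: n_def)
      next
        case False
        then have "rad (Suc l) \<le> rad k" by (intro rad_mono) simp
        then show ?thesis using x0 yM l(3) by (intro far) auto
      qed
    qed
    then have "s_plus m p (S k) T \<le> 4 * \<epsilon> k"
      using \<epsilon>(1)[of k] rk by (intro s_plus_le) (auto simp: n_def)
    moreover have "S k \<subseteq> thicken m p (4 * \<epsilon> k) T (n x1 + 2 * rad k)"
    proof
      fix y assume y: "y \<in> S k"
      then have yM: "y \<in> mspace m" using SM by blast
      show "y \<in> thicken m p (4 * \<epsilon> k) T (n x1 + 2 * rad k)"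
      proof (cases "n y \<le> 2 * rad k")
        case True
        then show ?thesis using x1 yM by (intro far)
      next
        case False
        then obtain x where x: "x \<in> T" "mdist m x y \<le> 2 * \<epsilon> k * n x" using in_T[OF y] by auto
        have "2 * \<epsilon> k * n x \<le> 4 * \<epsilon> k * n x" using \<epsilon>(1)[of k] by (simp add: n_def mult_right_mono)
        then show ?thesis using x yM TM rk by (intro close[of x]) (auto simp: n_def)
      qed
    qed
    then have "s_plus m p T (S k) \<le> 4 * \<epsilon> k"
      using \<epsilon>(1)[of k] rk by (intro s_plus_le) (auto simp: n_def)
    ultimately show ?thesis by (simp add: s_dist_def)
  qed
  then show ?thesis using T by blast
qed

lemma mcomplete_class_metric:
  assumes p: "p \<in> mspace m"
  shows "mcomplete_of (class_metric m p)"
proof -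
  let ?U = "unbounded_sets m" and ?q = "\<lambda>R. s_equiv m p `` {R}"
  interpret Metric_space "?U // s_equiv m p" "t_class m p" by (rule Metric_space_class[OF p])
  have "\<exists>x. limitin mtopology \<sigma> x sequentially" if \<sigma>: "MCauchy \<sigma>" for \<sigma>
  proof -
    have "\<exists>R\<in>?U. \<sigma> k = ?q R" for k
    proof -
      have "\<sigma> k \<in> ?U // s_equiv m p" using \<sigma> by (auto simp: MCauchy_def)
      then show ?thesis by (meson quotientE)
    qed
    then obtain R where R: "\<And>k. R k \<in> ?U" "\<And>k. \<sigma> k = ?q (R k)" by metis
    have d: "t_class m p (\<sigma> k) (\<sigma> l) = sqrt (s_dist m p (R k) (R l))" for k l
      unfolding R(2) t_class[OF p R(1) R(1)] by (simp add: t_dist_def)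
    define \<epsilon> where "\<epsilon> k = (1 / 2 :: real) ^ Suc k" for k
    have \<epsilon>: "0 < \<epsilon> k" "\<epsilon> k \<le> 1 / 2" "k \<le> l \<Longrightarrow> \<epsilon> l \<le> \<epsilon> k" for k l
      using power_decreasing[of 1 "Suc k" "1 / 2 :: real"] power_decreasing[of "Suc k" "Suc l" "1 / 2 :: real"]
      by (auto simp: \<epsilon>_def)
    have "\<exists>N. \<forall>n n'. N \<le> n \<longrightarrow> N \<le> n' \<longrightarrow> s_dist m p (R n) (R n') < \<epsilon> k" for k
    proof -
      have "\<exists>N. \<forall>n n'. N \<le> n \<longrightarrow> N \<le> n' \<longrightarrow> t_class m p (\<sigma> n) (\<sigma> n') < sqrt (\<epsilon> k)"
        using \<sigma> \<epsilon>(1)[of k] unfolding MCauchy_def by simp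
      then show ?thesis unfolding d real_sqrt_less_iff .
    qed
    then obtain N where N: "\<And>k n n'. N k \<le> n \<Longrightarrow> N k \<le> n' \<Longrightarrow> s_dist m p (R n) (R n') < \<epsilon> k" by metis
    define \<rho> where "\<rho> k = (\<Sum>j\<le>k. Suc (N j))" for k
    have \<rho>: "strict_mono \<rho>" by (rule strict_mono_Suc_iff[THEN iffD2]) (simp add: \<rho>_def)
    have N_le: "N k \<le> \<rho> l" if "k \<le> l" for k l
    proof -
      have "Suc (N k) \<le> \<rho> l" unfolding \<rho>_def by (rule member_le_sum) (use that in auto)
      then show ?thesis by simp
    qed
    have "\<exists>T\<in>?U. \<forall>k. s_dist m p (R (\<rho> k)) T \<le> 4 * \<epsilon> k"
    proof (rule limit_of_sets[OF p R(1) \<epsilon>])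
      fix k l :: nat assume kl: "k \<le> l"
      have s: "s_dist m p (R (\<rho> k)) (R (\<rho> l)) < \<epsilon> k" using N N_le kl by blast
      obtain a where a: "0 \<le> a" "R (\<rho> l) \<subseteq> thicken m p (\<epsilon> k) (R (\<rho> k)) a"
        using s_plus_less[OF p R(1) R(1)] s unfolding s_dist_def by (metis max_less_iff_conj)
      obtain b where b: "0 \<le> b" "R (\<rho> k) \<subseteq> thicken m p (\<epsilon> k) (R (\<rho> l)) b"
        using s_plus_less[OF p R(1) R(1)] s unfolding s_dist_def by (metis max_less_iff_conj)
      show "\<exists>a\<ge>0. R (\<rho> l) \<subseteq> thicken m p (\<epsilon> k) (R (\<rho> k)) a \<and> R (\<rho> k) \<subseteq> thicken m p (\<epsilon> k) (R (\<rho> l)) a"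
        using a b thicken_mono[of "\<epsilon> k" "\<epsilon> k" a "max a b" m p "R (\<rho> k)"]
          thicken_mono[of "\<epsilon> k" "\<epsilon> k" b "max a b" m p "R (\<rho> l)"]
        by (intro exI[of _ "max a b"]) auto
    qed
    then obtain T where T: "T \<in> ?U" "\<And>k. s_dist m p (R (\<rho> k)) T \<le> 4 * \<epsilon> k" by blast
    have "limitin mtopology (\<sigma> \<circ> \<rho>) (?q T) sequentially"
      unfolding limitin_metric
    proof (intro conjI allI impI)
      show "?q T \<in> ?U // s_equiv m p" using T by (simp add: quotientI)
      fix e :: real assume "0 < e"
      have "(\<lambda>k. 4 * \<epsilon> k) \<longlonglongrightarrow> 4 * 0"
        unfolding \<epsilon>_def by (intro tendsto_mult tendsto_const LIMSEQ_Suc LIMSEQ_power_zero) simp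
      then have "\<forall>\<^sub>F k in sequentially. 4 * \<epsilon> k < e\<^sup>2"
        using order_tendstoD(2)[of "\<lambda>k. 4 * \<epsilon> k" 0 sequentially "e\<^sup>2"] \<open>0 < e\<close> by simp
      then show "\<forall>\<^sub>F k in sequentially. (\<sigma> \<circ> \<rho>) k \<in> ?U // s_equiv m p \<and> t_class m p ((\<sigma> \<circ> \<rho>) k) (?q T) < e"
      proof eventually_elim
        case (elim k)
        have "t_class m p (\<sigma> (\<rho> k)) (?q T) = sqrt (s_dist m p (R (\<rho> k)) T)"
          unfolding R(2) t_class[OF p R(1) T(1)] by (simp add: t_dist_def)
        also have "\<dots> < sqrt (e\<^sup>2)" using T(2)[of k] elim by (intro real_sqrt_less_mono) simp
        finally show ?case using \<open>0 < e\<close> \<sigma> by (auto simp: MCauchy_def)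
      qed
    qed
    then show ?thesis using MCauchy_convergent_subsequence[OF \<sigma> \<rho>] by blast
  qed
  then show ?thesis
    unfolding mcomplete_of_def class_metric_simps[OF p] mcomplete_def by blast
qed

lemma bilipschitz_homeomorphic:
  assumes "bilipschitz_equivalent m1 m2"
  shows "mtopology_of m1 homeomorphic_space mtopology_of m2"
proof -
  obtain f C where f: "bij_betw f (mspace m1) (mspace m2)" and C: "C \<ge> 1"
    and fC: "\<And>x y. x \<in> mspace m1 \<Longrightarrow> y \<in> mspace m1 \<Longrightarrow>
      mdist m1 x y / C \<le> mdist m2 (f x) (f y) \<and> mdist m2 (f x) (f y) \<le> C * mdist m1 x y"
    using assms unfolding bilipschitz_equivalent_def by blast
  define g where "g = inv_into (mspace m1) f"
  have g: "g y \<in> mspace m1" "f (g y) = y" if "y \<in> mspace m2" for y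
    using that f by (auto simp: g_def bij_betw_def inv_into_into f_inv_into_f)
  have gf: "g (f x) = x" if "x \<in> mspace m1" for x
    using that f by (simp add: g_def bij_betw_def)
  have "Lipschitz_continuous_map m1 m2 f"
    unfolding Lipschitz_continuous_map_def using f fC by (auto simp: bij_betw_def)
  moreover have "Lipschitz_continuous_map m2 m1 g"
    unfolding Lipschitz_continuous_map_def
  proof (intro conjI exI ballI)
    fix x y assume xy: "x \<in> mspace m2" "y \<in> mspace m2"
    have "mdist m1 (g x) (g y) / C \<le> mdist m2 x y" using fC[of "g x" "g y"] g xy by simp
    then show "mdist m1 (g x) (g y) \<le> C * mdist m2 x y" using C by (simp add: divide_le_eq mult.commute)
  qed (use g in auto)
  ultimately have "continuous_map (mtopology_of m1) (mtopology_of m2) f" "continuous_map (mtopology_of m2) (mtopology_of m1) g"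
    by (blast dest: Lipschitz_continuous_imp_continuous_map)+
  then have "homeomorphic_maps (mtopology_of m1) (mtopology_of m2) f g"
    unfolding homeomorphic_maps_def using g gf by simp
  then show ?thesis unfolding homeomorphic_space_def by blast
qed

section \<open>Extending a map from a dense set to a quotient map\<close>

lemma quotient_maps_homeomorphic:
  assumes f: "quotient_map X Y f" and g: "quotient_map X Z g"
    and fibres: "\<And>x y. x \<in> topspace X \<Longrightarrow> y \<in> topspace X \<Longrightarrow> f x = f y \<longleftrightarrow> g x = g y"
  shows "Y homeomorphic_space Z"
proof -
  obtain h where h: "continuous_map Y Z h" "\<And>x. x \<in> topspace X \<Longrightarrow> h (f x) = g x"
    using quotient_map_lift_exists[OF f quotient_imp_continuous_map[OF g]] fibres by metis
  obtain k where k: "continuous_map Z Y k" "\<And>x. x \<in> topspace X \<Longrightarrow> k (g x) = f x"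
    using quotient_map_lift_exists[OF g quotient_imp_continuous_map[OF f]] fibres by metis
  have "f ` topspace X = topspace Y" "g ` topspace X = topspace Z"
    by (rule quotient_imp_surjective_map[OF f], rule quotient_imp_surjective_map[OF g])
  then have "\<forall>y\<in>topspace Y. k (h y) = y" "\<forall>z\<in>topspace Z. h (k z) = z"
    using h(2) k(2) by (metis imageE)+
  then have "homeomorphic_maps Y Z h k" using h(1) k(1) by (simp add: homeomorphic_maps_def)
  then show ?thesis unfolding homeomorphic_space_def by blast
qed

text \<open>The elements of \<open>\<G>\<close> have positions in the compact space \<open>X\<close>, which are dense, and images
  \<open>\<phi>\<close> in a complete metric space. If elements at nearby positions have nearby images, then
  \<open>\<phi>\<close> extends to \<open>X\<close>, and the closure of its image is the quotient of \<open>X\<close> by the relation of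
  having the same limit.\<close>

lemma dense_map_closure_homeomorphic:
  fixes X :: "'x topology" and m :: "'b metric" and nb :: "'x \<Rightarrow> real \<Rightarrow> 'x set"
    and pos :: "'g \<Rightarrow> 'x" and \<phi> :: "'g \<Rightarrow> 'b"
  assumes compact: "compact_space X" and complete: "mcomplete_of m"
    and nb_open: "\<And>x \<delta>. x \<in> topspace X \<Longrightarrow> 0 < \<delta> \<Longrightarrow> openin X (nb x \<delta>) \<and> x \<in> nb x \<delta>"
    and nb_mono: "\<And>x \<delta> \<delta>'. \<delta> \<le> \<delta>' \<Longrightarrow> nb x \<delta> \<subseteq> nb x \<delta>'"
    and nb_basis: "\<And>x y \<delta>. x \<in> topspace X \<Longrightarrow> 0 < \<delta> \<Longrightarrow> y \<in> nb x \<delta> \<Longrightarrow> \<exists>\<delta>'>0. nb y \<delta>' \<subseteq> nb x \<delta>"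
    and pos: "\<And>a. a \<in> \<G> \<Longrightarrow> pos a \<in> topspace X" and \<phi>: "\<And>a. a \<in> \<G> \<Longrightarrow> \<phi> a \<in> mspace m"
    and dense: "\<And>x \<delta>. x \<in> topspace X \<Longrightarrow> 0 < \<delta> \<Longrightarrow> \<exists>a\<in>\<G>. pos a \<in> nb x \<delta>"
    and near: "\<And>x \<epsilon>. x \<in> topspace X \<Longrightarrow> 0 < \<epsilon> \<Longrightarrow>
      \<exists>\<delta>>0. \<forall>a\<in>\<G>. \<forall>b\<in>\<G>. pos a \<in> nb x \<delta> \<longrightarrow> pos b \<in> nb x \<delta> \<longrightarrow> mdist m (\<phi> a) (\<phi> b) \<le> \<epsilon>"
    and q: "quotient_map X Z q"
    and same: "\<And>x y \<delta>. x \<in> topspace X \<Longrightarrow> y \<in> topspace X \<Longrightarrow> q x = q y \<Longrightarrow> 0 < \<delta> \<Longrightarrow>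
      \<exists>a\<in>\<G>. \<exists>b\<in>\<G>. pos a \<in> nb x \<delta> \<and> pos b \<in> nb y \<delta> \<and> \<phi> a = \<phi> b"
    and apart: "\<And>x y. x \<in> topspace X \<Longrightarrow> y \<in> topspace X \<Longrightarrow> q x \<noteq> q y \<Longrightarrow>
      \<exists>\<delta>>0. \<exists>\<kappa>>0. \<forall>a\<in>\<G>. \<forall>b\<in>\<G>. pos a \<in> nb x \<delta> \<longrightarrow> pos b \<in> nb y \<delta> \<longrightarrow> \<kappa> \<le> mdist m (\<phi> a) (\<phi> b)"
  shows "subtopology (mtopology_of m) (mtopology_of m closure_of (\<phi> ` \<G>)) homeomorphic_space Z"
proof -
  interpret Metric_space "mspace m" "mdist m" by simp
  have top: "mtopology_of m = mtopology" by (simp add: mtopology_of_def)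
  \<comment> \<open>Each point of \<open>X\<close> has a limit value.\<close>
  have "\<exists>l. l \<in> mspace m \<and> (\<forall>\<epsilon>>0. \<exists>\<delta>>0. \<forall>a\<in>\<G>. pos a \<in> nb x \<delta> \<longrightarrow> mdist m (\<phi> a) l \<le> \<epsilon>)"
    if x: "x \<in> topspace X" for x
  proof -
    define \<eta> where "\<eta> n = 1 / real (Suc n)" for n
    have \<eta>: "0 < \<eta> n" for n by (simp add: \<eta>_def)
    have \<eta>_small: "\<exists>N. \<forall>n\<ge>N. \<eta> n \<le> \<delta>" if "0 < \<delta>" for \<delta>
    proof -
      obtain N where N: "1 / \<delta> < real N" using reals_Archimedean2 by blast
      have "\<eta> n \<le> \<delta>" if "n \<ge> N" for n
      proof -
        have "1 / \<delta> \<le> real (Suc n)" using N that by simp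
        then show ?thesis using \<open>0 < \<delta>\<close> by (simp add: \<eta>_def divide_le_eq mult.commute)
      qed
      then show ?thesis by blast
    qed
    obtain \<alpha> where \<alpha>: "\<And>n. \<alpha> n \<in> \<G>" "\<And>n. pos (\<alpha> n) \<in> nb x (\<eta> n)"
      using dense[OF x \<eta>] by metis
    have tail: "\<exists>N. \<forall>n\<ge>N. pos (\<alpha> n) \<in> nb x \<delta>" if "0 < \<delta>" for \<delta>
      using \<eta>_small[OF that] \<alpha>(2) nb_mono by (meson subsetD)
    have "MCauchy (\<phi> \<circ> \<alpha>)"
      unfolding MCauchy_def
    proof (intro conjI allI impI)
      show "range (\<phi> \<circ> \<alpha>) \<subseteq> mspace m" using \<phi> \<alpha>(1) by auto
      fix \<epsilon> :: real assume "0 < \<epsilon>"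
      then obtain \<delta> where \<delta>: "\<delta> > 0" "\<And>a b. a \<in> \<G> \<Longrightarrow> b \<in> \<G> \<Longrightarrow> pos a \<in> nb x \<delta> \<Longrightarrow> pos b \<in> nb x \<delta> \<Longrightarrow> mdist m (\<phi> a) (\<phi> b) \<le> \<epsilon> / 2"
        using near[OF x, of "\<epsilon> / 2"] by auto
      obtain N where "\<And>n. n \<ge> N \<Longrightarrow> pos (\<alpha> n) \<in> nb x \<delta>" using tail[OF \<delta>(1)] by blast
      then have "mdist m ((\<phi> \<circ> \<alpha>) n) ((\<phi> \<circ> \<alpha>) n') < \<epsilon>" if "N \<le> n" "N \<le> n'" for n n'
        using \<delta>(2)[OF \<alpha>(1) \<alpha>(1), of n n'] that \<open>0 < \<epsilon>\<close> by fastforce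
      then show "\<exists>N. \<forall>n n'. N \<le> n \<longrightarrow> N \<le> n' \<longrightarrow> mdist m ((\<phi> \<circ> \<alpha>) n) ((\<phi> \<circ> \<alpha>) n') < \<epsilon>" by blast
    qed
    then obtain l where l: "limitin mtopology (\<phi> \<circ> \<alpha>) l sequentially"
      using complete unfolding mcomplete_of_def mcomplete_def by blast
    then have lM: "l \<in> mspace m" by (simp add: limitin_metric)
    have "\<exists>\<delta>>0. \<forall>a\<in>\<G>. pos a \<in> nb x \<delta> \<longrightarrow> mdist m (\<phi> a) l \<le> \<epsilon>" if "0 < \<epsilon>" for \<epsilon>
    proof -
      obtain \<delta> where \<delta>: "\<delta> > 0" "\<And>a b. a \<in> \<G> \<Longrightarrow> b \<in> \<G> \<Longrightarrow> pos a \<in> nb x \<delta> \<Longrightarrow> pos b \<in> nb x \<delta> \<Longrightarrow> mdist m (\<phi> a) (\<phi> b) \<le> \<epsilon> / 2"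
        using near[OF x, of "\<epsilon> / 2"] \<open>0 < \<epsilon>\<close> by auto
      obtain N where N: "\<And>n. n \<ge> N \<Longrightarrow> pos (\<alpha> n) \<in> nb x \<delta>" using tail[OF \<delta>(1)] by blast
      have "\<forall>\<^sub>F n in sequentially. mdist m ((\<phi> \<circ> \<alpha>) n) l < \<epsilon> / 2"
      proof -
        have "\<forall>\<^sub>F n in sequentially. (\<phi> \<circ> \<alpha>) n \<in> mspace m \<and> mdist m ((\<phi> \<circ> \<alpha>) n) l < \<epsilon> / 2"
          using l \<open>0 < \<epsilon>\<close> unfolding limitin_metric by (meson half_gt_zero)
        then show ?thesis by (rule eventually_mono) blast
      qed
      then obtain N' where N': "\<And>n. n \<ge> N' \<Longrightarrow> mdist m (\<phi> (\<alpha> n)) l < \<epsilon> / 2"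
        by (auto simp: eventually_sequentially)
      have "mdist m (\<phi> a) l \<le> \<epsilon>" if a: "a \<in> \<G>" "pos a \<in> nb x \<delta>" for a
      proof -
        define n where "n = max N N'"
        have "mdist m (\<phi> a) l \<le> mdist m (\<phi> a) (\<phi> (\<alpha> n)) + mdist m (\<phi> (\<alpha> n)) l"
          using \<phi> \<alpha>(1) a lM by (intro mdist_triangle) auto
        then show ?thesis using \<delta>(2)[OF a(1) \<alpha>(1) a(2) N, of n] N'[of n] by (simp add: n_def)
      qed
      then show ?thesis using \<delta>(1) by blast
    qed
    then show ?thesis using lM by blast
  qed
  then obtain \<Psi> where \<Psi>M: "\<And>x. x \<in> topspace X \<Longrightarrow> \<Psi> x \<in> mspace m"
    and \<Psi>: "\<And>x \<epsilon>. x \<in> topspace X \<Longrightarrow> 0 < \<epsilon> \<Longrightarrow> \<exists>\<delta>>0. \<forall>a\<in>\<G>. pos a \<in> nb x \<delta> \<longrightarrow> mdist m (\<phi> a) (\<Psi> x) \<le> \<epsilon>"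
    by metis
  have eqI: "l = l'" if "l \<in> mspace m" "l' \<in> mspace m" "\<And>\<epsilon>. 0 < \<epsilon> \<Longrightarrow> mdist m l l' \<le> \<epsilon>" for l l'
  proof -
    have "mdist m l l' \<le> 0" by (rule field_le_epsilon) (use that(3) in simp)
    then have "mdist m l l' = 0" using mdist_nonneg[of m l l'] by linarith
    then show ?thesis using zero[OF that(1,2)] by blast
  qed
  have \<Psi>_pos: "\<Psi> (pos a) = \<phi> a" if a: "a \<in> \<G>" for a
  proof (rule eqI[symmetric])
    fix \<epsilon> :: real assume "0 < \<epsilon>"
    then obtain \<delta> where "\<delta> > 0" "\<forall>b\<in>\<G>. pos b \<in> nb (pos a) \<delta> \<longrightarrow> mdist m (\<phi> b) (\<Psi> (pos a)) \<le> \<epsilon>"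
      using \<Psi>[OF pos[OF a]] by blast
    then show "mdist m (\<phi> a) (\<Psi> (pos a)) \<le> \<epsilon>" using a nb_open[OF pos[OF a]] by blast
  qed (use a \<phi> \<Psi>M pos in auto)
  have "continuous_map X mtopology \<Psi>"
    unfolding continuous_map_to_metric
  proof (intro ballI allI impI)
    fix x and \<epsilon> :: real assume x: "x \<in> topspace X" and "0 < \<epsilon>"
    obtain \<delta> where \<delta>: "\<delta> > 0" "\<And>a. a \<in> \<G> \<Longrightarrow> pos a \<in> nb x \<delta> \<Longrightarrow> mdist m (\<phi> a) (\<Psi> x) \<le> \<epsilon> / 3"
      using \<Psi>[OF x, of "\<epsilon> / 3"] \<open>0 < \<epsilon>\<close> by auto
    have "\<Psi> y \<in> mball (\<Psi> x) \<epsilon>" if y: "y \<in> nb x \<delta>" for y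
    proof -
      have yX: "y \<in> topspace X" using y nb_open[OF x \<delta>(1)] openin_subset by blast
      obtain \<delta>' where \<delta>': "\<delta>' > 0" "\<And>a. a \<in> \<G> \<Longrightarrow> pos a \<in> nb y \<delta>' \<Longrightarrow> mdist m (\<phi> a) (\<Psi> y) \<le> \<epsilon> / 3"
        using \<Psi>[OF yX, of "\<epsilon> / 3"] \<open>0 < \<epsilon>\<close> by auto
      obtain \<delta>'' where \<delta>'': "\<delta>'' > 0" "nb y \<delta>'' \<subseteq> nb x \<delta>" using nb_basis[OF x \<delta>(1) y] by blast
      obtain a where a: "a \<in> \<G>" "pos a \<in> nb y (min \<delta>' \<delta>'')"
        using dense[OF yX, of "min \<delta>' \<delta>''"] \<delta>' \<delta>'' by auto
      have "pos a \<in> nb y \<delta>'" "pos a \<in> nb x \<delta>"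
        using a(2) nb_mono[of "min \<delta>' \<delta>''" \<delta>' y] nb_mono[of "min \<delta>' \<delta>''" \<delta>'' y] \<delta>''(2) by auto
      then have "mdist m (\<phi> a) (\<Psi> y) \<le> \<epsilon> / 3" "mdist m (\<phi> a) (\<Psi> x) \<le> \<epsilon> / 3"
        using \<delta>(2) \<delta>'(2) a(1) by auto
      moreover have "mdist m (\<Psi> x) (\<Psi> y) \<le> mdist m (\<Psi> x) (\<phi> a) + mdist m (\<phi> a) (\<Psi> y)"
        using \<Psi>M x yX \<phi> a by (intro mdist_triangle) auto
      ultimately show ?thesis using \<Psi>M x yX \<open>0 < \<epsilon>\<close> by (simp add: mdist_commute)
    qed
    then show "\<exists>U. openin X U \<and> x \<in> U \<and> (\<forall>y\<in>U. \<Psi> y \<in> mball (\<Psi> x) \<epsilon>)"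
      using nb_open[OF x \<delta>(1)] by blast
  qed
  moreover have img: "\<Psi> ` topspace X = mtopology closure_of (\<phi> ` \<G>)"
  proof
    show "\<Psi> ` topspace X \<subseteq> mtopology closure_of (\<phi> ` \<G>)"
      unfolding metric_closure_of_alt
    proof clarify
      fix x assume x: "x \<in> topspace X"
      have "\<exists>y\<in>\<phi> ` \<G>. y \<in> mcball (\<Psi> x) \<epsilon>" if "0 < \<epsilon>" for \<epsilon>
      proof -
        obtain \<delta> where \<delta>: "\<delta> > 0" "\<And>a. a \<in> \<G> \<Longrightarrow> pos a \<in> nb x \<delta> \<Longrightarrow> mdist m (\<phi> a) (\<Psi> x) \<le> \<epsilon>"
          using \<Psi>[OF x \<open>0 < \<epsilon>\<close>] by blast
        obtain a where "a \<in> \<G>" "pos a \<in> nb x \<delta>" using dense[OF x \<delta>(1)] by blast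
        then show ?thesis using \<delta>(2) \<phi> \<Psi>M x by (auto simp: mdist_commute)
      qed
      then show "\<Psi> x \<in> mspace m \<and> (\<forall>r>0. \<exists>y\<in>\<phi> ` \<G>. y \<in> mcball (\<Psi> x) r)" using \<Psi>M x by blast
    qed
    have "compactin mtopology (\<Psi> ` topspace X)"
      using image_compactin[OF compact[unfolded compact_space_def] \<open>continuous_map X mtopology \<Psi>\<close>] .
    then have "closedin mtopology (\<Psi> ` topspace X)"
      by (rule compactin_imp_closedin[OF Hausdorff_space_mtopology])
    moreover have "\<phi> ` \<G> \<subseteq> \<Psi> ` topspace X" using \<Psi>_pos pos by (metis image_eqI image_subsetI)
    ultimately show "mtopology closure_of (\<phi> ` \<G>) \<subseteq> \<Psi> ` topspace X" by (intro closure_of_minimal)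
  qed
  ultimately have cont: "continuous_map X (subtopology mtopology (mtopology closure_of (\<phi> ` \<G>))) \<Psi>"
    by (auto simp: continuous_map_in_subtopology)
  have "quotient_map X (subtopology mtopology (mtopology closure_of (\<phi> ` \<G>))) \<Psi>"
  proof (rule continuous_closed_imp_quotient_map[OF cont])
    show "closed_map X (subtopology mtopology (mtopology closure_of (\<phi> ` \<G>))) \<Psi>"
      by (rule continuous_imp_closed_map_gen[OF compact _ cont])
        (intro Hausdorff_imp_kc_space Hausdorff_space_subtopology Hausdorff_space_mtopology)
    show "\<Psi> ` topspace X = topspace (subtopology mtopology (mtopology closure_of (\<phi> ` \<G>)))"
      unfolding img using closure_of_subset_topspace[of mtopology] by (auto simp: Int_absorb1)
  qed
  moreover have "\<Psi> x = \<Psi> y \<longleftrightarrow> q x = q y" if xy: "x \<in> topspace X" "y \<in> topspace X" for x y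
  proof
    assume eq: "q x = q y"
    show "\<Psi> x = \<Psi> y"
    proof (rule eqI[OF \<Psi>M[OF xy(1)] \<Psi>M[OF xy(2)]])
      fix \<epsilon> :: real assume "0 < \<epsilon>"
      obtain \<delta> where \<delta>: "\<delta> > 0" "\<And>a. a \<in> \<G> \<Longrightarrow> pos a \<in> nb x \<delta> \<Longrightarrow> mdist m (\<phi> a) (\<Psi> x) \<le> \<epsilon> / 2"
        using \<Psi>[OF xy(1), of "\<epsilon> / 2"] \<open>0 < \<epsilon>\<close> by auto
      obtain \<delta>' where \<delta>': "\<delta>' > 0" "\<And>a. a \<in> \<G> \<Longrightarrow> pos a \<in> nb y \<delta>' \<Longrightarrow> mdist m (\<phi> a) (\<Psi> y) \<le> \<epsilon> / 2"
        using \<Psi>[OF xy(2), of "\<epsilon> / 2"] \<open>0 < \<epsilon>\<close> by auto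
      obtain a b where ab: "a \<in> \<G>" "b \<in> \<G>" "pos a \<in> nb x (min \<delta> \<delta>')" "pos b \<in> nb y (min \<delta> \<delta>')" "\<phi> a = \<phi> b"
        using same[OF xy eq, of "min \<delta> \<delta>'"] \<delta>(1) \<delta>'(1) by auto
      have "pos a \<in> nb x \<delta>" "pos b \<in> nb y \<delta>'"
        using ab nb_mono[of "min \<delta> \<delta>'" \<delta> x] nb_mono[of "min \<delta> \<delta>'" \<delta>' y] by auto
      then have "mdist m (\<phi> a) (\<Psi> x) \<le> \<epsilon> / 2" "mdist m (\<phi> a) (\<Psi> y) \<le> \<epsilon> / 2"
        using \<delta>(2)[OF ab(1)] \<delta>'(2)[OF ab(2)] ab(5) by simp_all
      moreover have "mdist m (\<Psi> x) (\<Psi> y) \<le> mdist m (\<Psi> x) (\<phi> a) + mdist m (\<phi> a) (\<Psi> y)"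
        using \<Psi>M xy \<phi> ab by (intro mdist_triangle) auto
      ultimately show "mdist m (\<Psi> x) (\<Psi> y) \<le> \<epsilon>" by (simp add: mdist_commute)
    qed
  next
    assume eq: "\<Psi> x = \<Psi> y"
    show "q x = q y"
    proof (rule ccontr)
      assume "q x \<noteq> q y"
      then obtain \<delta>0 \<kappa> where \<delta>0: "\<delta>0 > 0" "\<kappa> > 0" "\<And>a b. a \<in> \<G> \<Longrightarrow> b \<in> \<G> \<Longrightarrow> pos a \<in> nb x \<delta>0 \<Longrightarrow> pos b \<in> nb y \<delta>0 \<Longrightarrow> \<kappa> \<le> mdist m (\<phi> a) (\<phi> b)"
        using apart[OF xy] by blast
      obtain \<delta> where \<delta>: "\<delta> > 0" "\<And>a. a \<in> \<G> \<Longrightarrow> pos a \<in> nb x \<delta> \<Longrightarrow> mdist m (\<phi> a) (\<Psi> x) \<le> \<kappa> / 3"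
        using \<Psi>[OF xy(1), of "\<kappa> / 3"] \<delta>0(2) by auto
      obtain \<delta>' where \<delta>': "\<delta>' > 0" "\<And>a. a \<in> \<G> \<Longrightarrow> pos a \<in> nb y \<delta>' \<Longrightarrow> mdist m (\<phi> a) (\<Psi> y) \<le> \<kappa> / 3"
        using \<Psi>[OF xy(2), of "\<kappa> / 3"] \<delta>0(2) by auto
      obtain a where a: "a \<in> \<G>" "pos a \<in> nb x (min \<delta>0 \<delta>)" using dense[OF xy(1), of "min \<delta>0 \<delta>"] \<delta> \<delta>0 by auto
      obtain b where b: "b \<in> \<G>" "pos b \<in> nb y (min \<delta>0 \<delta>')" using dense[OF xy(2), of "min \<delta>0 \<delta>'"] \<delta>' \<delta>0 by auto
      have "pos a \<in> nb x \<delta>0" "pos a \<in> nb x \<delta>" "pos b \<in> nb y \<delta>0" "pos b \<in> nb y \<delta>'"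
        using a b nb_mono[of "min \<delta>0 \<delta>" \<delta>0 x] nb_mono[of "min \<delta>0 \<delta>" \<delta> x]
          nb_mono[of "min \<delta>0 \<delta>'" \<delta>0 y] nb_mono[of "min \<delta>0 \<delta>'" \<delta>' y] by auto
      then have "\<kappa> \<le> mdist m (\<phi> a) (\<phi> b)" "mdist m (\<phi> a) (\<Psi> x) \<le> \<kappa> / 3" "mdist m (\<phi> b) (\<Psi> x) \<le> \<kappa> / 3"
        using \<delta>0(3) \<delta>(2) \<delta>'(2) a b eq by auto
      moreover have "mdist m (\<phi> a) (\<phi> b) \<le> mdist m (\<phi> a) (\<Psi> x) + mdist m (\<Psi> x) (\<phi> b)"
        using \<Psi>M xy \<phi> a b by (intro mdist_triangle) auto
      ultimately show False using \<delta>0(2) by (simp add: mdist_commute)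
    qed
  qed
  ultimately show ?thesis unfolding top by (rule quotient_maps_homeomorphic[OF _ q])
qed

section \<open>Directions of orbits and their distances\<close>

context graded_coordinates
begin

text \<open>Round a large multiple \<open>N v\<close> to a vector with integral coordinates.\<close>

lemma dense_dir:
  assumes v: "vnorm v = 1" and \<delta>: "\<delta> > 0"
  shows "\<exists>g\<in>\<Gamma>. vnorm (lam g) > 0 \<and> vnorm (\<lambda>s. dir g s - v s) < \<delta>"
proof -
  obtain N :: nat where N: "max (2 * real r / \<delta>) (real r) < real N" using reals_Archimedean2 by blast
  have N0: "0 < real N" using N by simp
  define m where "m s = \<lfloor>real N * v s\<rfloor>" for s
  define g where "g = oprod e m r"
  have g: "g \<in> \<Gamma>" unfolding g_def by (rule oprod_in) simp
  have lam_g: "lam g s = real_of_int (m s)" if "s < r" for s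
    using that lam_oprod[of r m s] by (simp add: g_def)
  define \<eta> where "\<eta> = real r / real N"
  have \<eta>: "\<eta> < 1" "2 * \<eta> < \<delta>" using N N0 \<delta> by (simp_all add: \<eta>_def divide_less_eq mult.commute)
  have d1: "vnorm (\<lambda>s. 1 / real N * lam g s - v s) \<le> \<eta>"
  proof -
    have "vnorm (\<lambda>s. 1 / real N * lam g s - v s) \<le> (\<Sum>s<r. \<bar>1 / real N * lam g s - v s\<bar>)"
      unfolding vnorm_def by (rule L2_set_le_sum_abs)
    also have "\<dots> \<le> (\<Sum>s<r. 1 / real N)"
    proof (rule sum_mono)
      fix s assume "s \<in> {..<r}"
      then have "1 / real N * lam g s - v s = (real_of_int (m s) - real N * v s) / real N"
        using N0 by (simp add: lam_g field_simps)
      moreover have "\<bar>real_of_int (m s) - real N * v s\<bar> \<le> 1" unfolding m_def by linarith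
      ultimately show "\<bar>1 / real N * lam g s - v s\<bar> \<le> 1 / real N"
        using N0 by (simp add: abs_divide divide_right_mono)
    qed
    finally show ?thesis by (simp add: \<eta>_def)
  qed
  define a where "a = vnorm (lam g) / real N"
  have a_eq: "vnorm (\<lambda>s. 1 / real N * lam g s) = a" using vnorm_scale[of "1 / real N" "lam g"] N0 by (simp add: a_def)
  have "a \<le> vnorm v + vnorm (\<lambda>s. 1 / real N * lam g s - v s)"
    using vnorm_triangle[of v "\<lambda>s. 1 / real N * lam g s - v s"] by (simp add: a_eq[symmetric])
  moreover have "vnorm v \<le> a + vnorm (\<lambda>s. 1 / real N * lam g s - v s)"
    using vnorm_triangle[of "\<lambda>s. 1 / real N * lam g s" "\<lambda>s. - (1 / real N * lam g s - v s)"]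
    unfolding a_eq vnorm_uminus by simp
  ultimately have a: "\<bar>1 - a\<bar> \<le> \<eta>" using d1 v by linarith
  then have a0: "0 < a" using \<eta> by linarith
  then have pos: "vnorm (lam g) > 0" using N0 by (simp add: a_def zero_less_divide_iff)
  have "vnorm (\<lambda>s. dir g s - v s) = vnorm (\<lambda>s. (1 - a) * dir g s + (1 / real N * lam g s - v s))"
    using N0 by (simp add: lam_dir[OF pos] a_def algebra_simps)
  also have "\<dots> \<le> vnorm (\<lambda>s. (1 - a) * dir g s) + vnorm (\<lambda>s. 1 / real N * lam g s - v s)"
    by (rule vnorm_triangle)
  also have "\<dots> \<le> \<eta> + \<eta>" unfolding vnorm_scale using a d1 vnorm_dir[OF pos] by (intro add_mono) auto
  finally show ?thesis using g pos \<eta>(2) by (intro bexI[of _ g]) auto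
qed

lemma dir_inv: "g \<in> \<Gamma> \<Longrightarrow> dir (inv g) s = - dir g s"
  and vnorm_lam_inv: "g \<in> \<Gamma> \<Longrightarrow> vnorm (lam (inv g)) = vnorm (lam g)"
proof -
  assume "g \<in> \<Gamma>"
  then have "lam (inv g) = (\<lambda>s. - lam g s)" by (simp add: lam_inv fun_eq_iff)
  then show "vnorm (lam (inv g)) = vnorm (lam g)" "dir (inv g) s = - dir g s"
    using vnorm_uminus[of "lam g"] by (simp_all add: dir_def)
qed

text \<open>The point \<open>\<sigma> v\<close> of the ray is \<open>|\<sigma> - 1|\<close> away from \<open>v\<close>, which is the difference of
  the lengths of \<open>\<sigma> v\<close> and \<open>u\<close> and thus no more than their distance.\<close>

lemma ray_distance:
  assumes u: "vnorm u = 1" and v: "vnorm v = 1" and \<sigma>: "0 \<le> \<sigma>"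
  shows "vnorm (\<lambda>s. u s - v s) \<le> 2 * vnorm (\<lambda>s. u s - \<sigma> * v s)"
proof -
  have 1: "vnorm (\<lambda>s. \<sigma> * v s) = \<sigma>" using v \<sigma> by (simp add: vnorm_scale)
  have "\<sigma> \<le> vnorm u + vnorm (\<lambda>s. u s - \<sigma> * v s)"
    using vnorm_triangle[of u "\<lambda>s. - (u s - \<sigma> * v s)"] unfolding vnorm_uminus by (simp add: 1)
  moreover have "vnorm u \<le> \<sigma> + vnorm (\<lambda>s. u s - \<sigma> * v s)"
    using vnorm_triangle[of "\<lambda>s. \<sigma> * v s" "\<lambda>s. u s - \<sigma> * v s"] by (simp add: 1)
  ultimately have "\<bar>\<sigma> - 1\<bar> \<le> vnorm (\<lambda>s. u s - \<sigma> * v s)" using u by linarith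
  moreover have "vnorm (\<lambda>s. u s - v s) \<le> vnorm (\<lambda>s. u s - \<sigma> * v s) + vnorm (\<lambda>s. (\<sigma> - 1) * v s)"
    using vnorm_triangle[of "\<lambda>s. u s - \<sigma> * v s" "\<lambda>s. (\<sigma> - 1) * v s"] by (simp add: algebra_simps)
  ultimately show ?thesis using v by (simp add: vnorm_scale)
qed

end

text \<open>Linear boundaries are made of forward orbits, projective ones of two-sided orbits; the flag
  allows a common treatment.\<close>

definition exponents :: "bool \<Rightarrow> int set" where
  "exponents two_sided = (if two_sided then UNIV else {0..})"

context word_group
begin

definition orb :: "bool \<Rightarrow> 'a \<Rightarrow> 'a set" where
  "orb b g = (\<lambda>n. g [^] n) ` exponents b"

lemma orb_False: "orb False g = range (\<lambda>n::nat. g [^] n)"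
proof -
  have "{0..} = range int" by (auto simp: image_iff intro: nonneg_int_cases)
  then show ?thesis by (simp add: orb_def exponents_def image_image int_pow_int)
qed

lemma orb_True: "orb True g = range (\<lambda>n::int. g [^] n)"
  by (simp add: orb_def exponents_def)

lemma orb_inv: "g \<in> carrier G \<Longrightarrow> orb True (inv g) = orb True g"
proof -
  assume g: "g \<in> carrier G"
  have "inv g [^] n = g [^] (- n)" for n :: int
    using g by (metis int_pow_inv int_pow_neg)
  then have "orb True (inv g) = (\<lambda>n. g [^] n) ` (range uminus :: int set)"
    by (simp only: orb_True image_image)
  also have "range uminus = (UNIV :: int set)" by (metis minus_minus surjI)
  finally show ?thesis by (simp add: orb_True)
qed

lemma orb_carrier: "g \<in> carrier G \<Longrightarrow> orb b g \<subseteq> carrier G"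
  by (auto simp: orb_def)

lemma nat_pow_in_orb: "g [^] (n::nat) \<in> orb b g"
proof -
  have "g [^] n = g [^] int n" by (simp add: int_pow_int)
  then show ?thesis unfolding orb_def exponents_def by (auto simp del: int_pow_int)
qed

lemma unbounded_word:
  assumes "R \<subseteq> carrier G" "\<And>B. \<exists>y\<in>R. B < nrm y"
  shows "R \<in> unbounded_sets (word_metric G A)"
proof -
  interpret Metric_space "carrier G" "mdist (word_metric G A)"
    using Metric_space_mspace_mdist[of "word_metric G A"] by simp
  have "\<not> mbounded R"
  proof
    assume "mbounded R"
    then obtain x B where B: "R \<subseteq> mcball x B" by (auto simp: mbounded_def)
    obtain y where y: "y \<in> R" "nrm x + B < nrm y" using assms(2) by blast
    have xy: "x \<in> carrier G" "y \<in> carrier G" "mdist (word_metric G A) x y \<le> B" using B y by auto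
    then have "nrm y \<le> nrm x + B"
      using mdist_triangle[of \<one> "word_metric G A" x y] by (simp add: nrm_conv_mdist)
    then show False using y by simp
  qed
  then show ?thesis using assms(1) by (simp add: unbounded_sets_def)
qed

lemma orb_one_bounded: "orb b \<one> \<notin> unbounded_sets (word_metric G A)"
proof -
  interpret Metric_space "carrier G" "mdist (word_metric G A)"
    using Metric_space_mspace_mdist[of "word_metric G A"] by simp
  have "orb b \<one> \<subseteq> mcball \<one> 0" by (auto simp: orb_def)
  then show ?thesis by (auto simp: unbounded_sets_def mbounded_def)
qed

lemma in_thicken_word:
  assumes "R \<subseteq> carrier G" "y \<in> carrier G"
  shows "y \<in> thicken (word_metric G A) \<one> \<alpha> R a \<longleftrightarrow> (\<exists>x\<in>R. nrm (inv x \<otimes> y) \<le> \<alpha> * nrm x + a)"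
proof -
  have "y \<in> mcball_of (word_metric G A) x (\<alpha> * mdist (word_metric G A) \<one> x + a) \<longleftrightarrow> nrm (inv x \<otimes> y) \<le> \<alpha> * nrm x + a"
    if "x \<in> R" for x
    using that assms by (auto simp: mdist_word)
  then show ?thesis by (auto simp: thicken_def)
qed

lemma s_plus_orb_le:
  assumes "g \<in> carrier G" "h \<in> carrier G" "0 \<le> \<alpha>" "0 \<le> K"
    and "\<And>m. m \<in> exponents b \<Longrightarrow> \<exists>n\<in>exponents b. nrm (inv (g [^] n) \<otimes> h [^] m) \<le> \<alpha> * nrm (g [^] n) + K"
  shows "s_plus (word_metric G A) \<one> (orb b g) (orb b h) \<le> \<alpha>"
proof (rule s_plus_le[OF assms(3,4)])
  show "orb b h \<subseteq> thicken (word_metric G A) \<one> \<alpha> (orb b g) K"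
  proof
    fix y assume "y \<in> orb b h"
    then obtain m where m: "m \<in> exponents b" "y = h [^] m" by (auto simp: orb_def)
    have y: "y \<in> carrier G" using m assms(2) by simp
    show "y \<in> thicken (word_metric G A) \<one> \<alpha> (orb b g) K"
      unfolding in_thicken_word[OF orb_carrier[OF assms(1)] y] using assms(5)[OF m(1)] m(2) by (auto simp: orb_def)
  qed
qed

text \<open>Rounding the exponent to a multiple of \<open>k\<close> moves a power by a bounded distance.\<close>

lemma orb_pow_equiv:
  assumes g: "g \<in> carrier G" and k: "0 < k"
    and unb: "orb b g \<in> unbounded_sets (word_metric G A)" "orb b (g [^] (k::nat)) \<in> unbounded_sets (word_metric G A)"
  shows "(orb b g, orb b (g [^] k)) \<in> s_equiv (word_metric G A) \<one>"
proof -
  let ?m = "word_metric G A"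
  have gk: "g [^] k \<in> carrier G" using g by simp
  have pow: "(g [^] k) [^] (n::int) = g [^] (int k * n)" for n
    using g by (simp add: int_pow_pow flip: int_pow_int)
  have "s_plus ?m \<one> (orb b g) (orb b (g [^] k)) \<le> 0"
  proof (rule s_plus_orb_le[OF g gk, of 0 0])
    fix m :: int assume "m \<in> exponents b"
    then have "int k * m \<in> exponents b" by (auto simp: exponents_def split: if_splits)
    then show "\<exists>n\<in>exponents b. nrm (inv (g [^] n) \<otimes> (g [^] k) [^] m) \<le> 0 * nrm (g [^] n) + 0"
      using g by (intro bexI[of _ "int k * m"]) (simp_all add: pow)
  qed auto
  moreover have "s_plus ?m \<one> (orb b (g [^] k)) (orb b g) \<le> 0"
  proof (rule s_plus_orb_le[OF gk g, of 0 "\<Sum>t<k. nrm (g [^] t)"])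
    fix m :: int assume m: "m \<in> exponents b"
    define n t where "n = m div int k" and "t = nat (m mod int k)"
    have t: "t < k" "m = int k * n + int t" using k by (simp_all add: n_def t_def nat_less_iff)
    have "n \<in> exponents b" using m k by (auto simp: exponents_def n_def pos_imp_zdiv_nonneg_iff split: if_splits)
    moreover have "inv ((g [^] k) [^] n) \<otimes> g [^] m = g [^] t"
      unfolding t(2) pow using g by (simp add: int_pow_mult int_pow_int)
    moreover have "nrm (g [^] t) \<le> (\<Sum>t<k. nrm (g [^] t))" using t by (intro member_le_sum) auto
    ultimately show "\<exists>n\<in>exponents b. nrm (inv ((g [^] k) [^] n) \<otimes> g [^] m) \<le> 0 * nrm ((g [^] k) [^] n) + (\<Sum>t<k. nrm (g [^] t))"
      by (intro bexI[of _ n]) auto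
  qed (auto simp: sum_nonneg)
  ultimately show ?thesis
    using unb s_plus_nonneg[of \<one> ?m, OF _ unb] s_plus_nonneg[of \<one> ?m, OF _ unb(2,1)]
    by (simp add: s_equiv_def s_dist_def)
qed

end

context graded_coordinates
begin

lemma orb_unbounded:
  assumes "g \<in> \<Gamma>" "vnorm (lam g) > 0"
  shows "orb b g \<in> unbounded_sets (word_metric G A)"
proof (rule unbounded_word)
  show "orb b g \<subseteq> carrier G" using assms lower_central_carrier orb_carrier by blast
  show "\<exists>y\<in>orb b g. B < nrm y" for B using nrm_pow_unbounded[OF assms] nat_pow_in_orb by blast
qed

lemma s_plus_orb_near:
  assumes \<epsilon>: "\<epsilon> > 0"
  shows "\<exists>\<delta>>0. \<forall>g\<in>\<Gamma>. \<forall>h\<in>\<Gamma>. vnorm (lam g) > 0 \<longrightarrow> vnorm (lam h) > 0 \<longrightarrow>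
     vnorm (\<lambda>s. dir h s - dir g s) < \<delta> \<longrightarrow> s_plus (word_metric G A) \<one> (orb b g) (orb b h) \<le> \<epsilon>"
proof -
  obtain \<delta> where \<delta>: "\<delta> > 0" "\<And>g h. g \<in> \<Gamma> \<Longrightarrow> h \<in> \<Gamma> \<Longrightarrow> vnorm (lam g) > 0 \<Longrightarrow> vnorm (lam h) > 0 \<Longrightarrow>
     vnorm (\<lambda>s. dir h s - dir g s) < \<delta> \<Longrightarrow>
     \<exists>K\<ge>0. \<forall>m::nat. \<exists>n::nat. nrm (inv (g [^] n) \<otimes> h [^] m) \<le> \<epsilon> * nrm (g [^] n) + K"
    using shadow_powers[OF \<epsilon>] by blast
  have "s_plus (word_metric G A) \<one> (orb b g) (orb b h) \<le> \<epsilon>"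
    if gh: "g \<in> \<Gamma>" "h \<in> \<Gamma>" "vnorm (lam g) > 0" "vnorm (lam h) > 0" "vnorm (\<lambda>s. dir h s - dir g s) < \<delta>" for g h
  proof -
    have car: "g \<in> carrier G" "h \<in> carrier G" using gh lower_central_carrier by auto
    obtain K where K: "K \<ge> 0" "\<And>m. \<exists>n::nat. nrm (inv (g [^] n) \<otimes> h [^] (m::nat)) \<le> \<epsilon> * nrm (g [^] n) + K"
      using \<delta>(2)[OF gh] by blast
    \<comment> \<open>Negative exponents are those of the inverses, whose directions are just as close.\<close>
    have "vnorm (\<lambda>s. dir (inv h) s - dir (inv g) s) = vnorm (\<lambda>s. - (dir h s - dir g s))"
      using gh by (simp add: dir_inv)
    then have "vnorm (\<lambda>s. dir (inv h) s - dir (inv g) s) < \<delta>" using gh(5) by (simp only: vnorm_uminus)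
    then obtain K' where K': "K' \<ge> 0"
      "\<And>m. \<exists>n::nat. nrm (inv (inv g [^] n) \<otimes> inv h [^] (m::nat)) \<le> \<epsilon> * nrm (inv g [^] n) + K'"
      using \<delta>(2)[of "inv g" "inv h"] gh lower_central_inv vnorm_lam_inv by auto
    show ?thesis
    proof (rule s_plus_orb_le[OF car, of _ "K + K'"])
      fix m :: int assume m: "m \<in> exponents b"
      show "\<exists>n\<in>exponents b. nrm (inv (g [^] n) \<otimes> h [^] m) \<le> \<epsilon> * nrm (g [^] n) + (K + K')"
      proof (cases "0 \<le> m")
        case True
        then obtain m' where m': "m = int m'" using nonneg_int_cases by blast
        obtain n :: nat where n: "nrm (inv (g [^] n) \<otimes> h [^] m') \<le> \<epsilon> * nrm (g [^] n) + K" using K(2) by blast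
        have "int n \<in> exponents b" by (simp add: exponents_def)
        then show ?thesis using n K'(1) unfolding m' by (intro bexI[of _ "int n"]) (simp_all add: int_pow_int)
      next
        case False
        then have b: "b" using m by (auto simp: exponents_def split: if_splits)
        obtain m' where m': "m = - int m'" using False by (metis int_cases linorder_not_le neg_int_cases)
        obtain n :: nat where n: "nrm (inv (inv g [^] n) \<otimes> inv h [^] m') \<le> \<epsilon> * nrm (inv g [^] n) + K'" using K'(2) by blast
        have *: "a [^] (- int j) = inv a [^] j" if "a \<in> carrier G" for a j
          using that by (simp add: int_pow_neg int_pow_int nat_pow_inv)
        have "- int n \<in> exponents b" using b by (simp add: exponents_def)
        then show ?thesis using n K(1) car unfolding m' by (intro bexI[of _ "- int n"]) (simp_all add: *)
      qed
    qed (use \<epsilon> K K' in auto)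
  qed
  then show ?thesis using \<delta>(1) by blast
qed

lemma s_plus_orb_apart:
  assumes \<rho>: "\<rho> > 0"
  shows "\<exists>\<kappa>>0. \<forall>g\<in>\<Gamma>. \<forall>h\<in>\<Gamma>. vnorm (lam g) > 0 \<longrightarrow> orb b h \<in> unbounded_sets (word_metric G A) \<longrightarrow>
     (\<forall>m\<in>exponents b. \<forall>\<tau>\<ge>0. \<rho> \<le> vnorm (\<lambda>s. dir g s - \<tau> * real_of_int m * lam h s)) \<longrightarrow>
     \<kappa> \<le> s_plus (word_metric G A) \<one> (orb b h) (orb b g)"
proof -
  obtain \<kappa> where \<kappa>: "\<kappa> > 0" "\<And>g h Z \<alpha> K. g \<in> \<Gamma> \<Longrightarrow> h \<in> \<Gamma> \<Longrightarrow> vnorm (lam g) > 0 \<Longrightarrow>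
     (\<forall>m\<in>Z. \<forall>\<tau>\<ge>0. \<rho> \<le> vnorm (\<lambda>s. dir g s - \<tau> * real_of_int m * lam h s)) \<Longrightarrow> 0 \<le> \<alpha> \<Longrightarrow>
     (\<forall>n::nat. \<exists>m\<in>Z. nrm (inv (h [^] (m::int)) \<otimes> g [^] n) \<le> \<alpha> * nrm (h [^] m) + K) \<Longrightarrow> \<kappa> \<le> \<alpha>"
    using separated_powers[OF \<rho>] by (elim exE conjE) blast
  have "\<kappa> \<le> s_plus (word_metric G A) \<one> (orb b h) (orb b g)"
    if gh: "g \<in> \<Gamma>" "h \<in> \<Gamma>" "vnorm (lam g) > 0" and h: "orb b h \<in> unbounded_sets (word_metric G A)"
      and sep: "\<forall>m\<in>exponents b. \<forall>\<tau>\<ge>0. \<rho> \<le> vnorm (\<lambda>s. dir g s - \<tau> * real_of_int m * lam h s)" for g h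
    unfolding s_plus_def
  proof (rule cInf_greatest)
    show "{\<alpha>. 0 \<le> \<alpha> \<and> (\<exists>a\<ge>0. orb b g \<subseteq> thicken (word_metric G A) \<one> \<alpha> (orb b h) a)} \<noteq> {}"
      using orb_unbounded[OF gh(1,3)] h by (intro s_plus_ne) auto
    fix \<alpha> assume "\<alpha> \<in> {\<alpha>. 0 \<le> \<alpha> \<and> (\<exists>a\<ge>0. orb b g \<subseteq> thicken (word_metric G A) \<one> \<alpha> (orb b h) a)}"
    then obtain K where \<alpha>: "0 \<le> \<alpha>" "orb b g \<subseteq> thicken (word_metric G A) \<one> \<alpha> (orb b h) K" by blast
    have car: "g \<in> carrier G" "h \<in> carrier G" using gh lower_central_carrier by auto
    have "\<exists>m\<in>exponents b. nrm (inv (h [^] m) \<otimes> g [^] n) \<le> \<alpha> * nrm (h [^] m) + K" for n :: nat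
    proof -
      have gn: "g [^] n \<in> carrier G" using car by simp
      have "g [^] n \<in> thicken (word_metric G A) \<one> \<alpha> (orb b h) K" using \<alpha>(2) nat_pow_in_orb by blast
      then show ?thesis unfolding in_thicken_word[OF orb_carrier[OF car(2)] gn] by (auto simp: orb_def)
    qed
    then show "\<kappa> \<le> \<alpha>" using \<kappa>(2)[OF gh sep \<alpha>(1)] by blast
  qed
  then show ?thesis using \<kappa>(1) by blast
qed

end

section \<open>Spheres\<close>

lemma L2_set_less_iff: "0 < \<delta> \<Longrightarrow> L2_set f I < \<delta> \<longleftrightarrow> (\<Sum>s\<in>I. (f s)\<^sup>2) < \<delta>\<^sup>2"
proof -
  assume "0 < \<delta>"
  then have "sqrt (\<Sum>s\<in>I. (f s)\<^sup>2) < sqrt (\<delta>\<^sup>2) \<longleftrightarrow> (\<Sum>s\<in>I. (f s)\<^sup>2) < \<delta>\<^sup>2" by (simp only: real_sqrt_less_iff)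
  then show ?thesis using \<open>0 < \<delta>\<close> by (simp add: L2_set_def)
qed

text \<open>For \<open>r = 0\<close> both sides are empty, so that ranks need no case distinction.\<close>

lemma sphere_space_conv:
  "sphere_space (int r - 1) = subtopology (powertop_real UNIV) {x. (\<forall>s\<ge>r. x s = 0) \<and> (\<Sum>s<r. (x s)\<^sup>2) = 1}"
proof (cases r)
  case 0
  then show ?thesis by (simp add: sphere_space_def)
next
  case (Suc n)
  have "{..<r} = {..n}" using Suc by auto
  moreover have "(\<forall>s\<ge>r. x s = 0) \<longleftrightarrow> (\<forall>i>n. x i = (0::real))" for x using Suc by (simp add: Suc_le_eq)
  ultimately show ?thesis using Suc by (simp add: sphere_space_def nsphere conj_commute)
qed

lemma topspace_sphere_space:
  "topspace (sphere_space (int r - 1)) = {x. (\<forall>s\<ge>r. x s = 0) \<and> L2_set x {..<r} = 1}"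
  by (auto simp: sphere_space_conv L2_set_def)

lemma continuous_map_sum_squares:
  "continuous_map (powertop_real UNIV) euclideanreal (\<lambda>y. \<Sum>s<(r::nat). (y s - x s)\<^sup>2)"
  unfolding power2_eq_square
  by (intro continuous_map_sum continuous_map_real_mult continuous_map_diff continuous_map_product_projection) auto

lemma compact_sphere_space: "compact_space (sphere_space (int r - 1))"
proof -
  let ?P = "powertop_real (UNIV :: nat set)"
  let ?B = "PiE UNIV (\<lambda>s. if s < r then {-1..1} else {0::real})"
  have "compactin ?P ?B" by (auto simp: compactin_PiE)
  moreover have "closedin ?P {y \<in> topspace ?P. (\<Sum>s<r. (y s - 0)\<^sup>2) \<in> {1}}"
    by (rule closedin_continuous_map_preimage[OF continuous_map_sum_squares]) simp
  ultimately have "compactin ?P ({y \<in> topspace ?P. (\<Sum>s<r. (y s - 0)\<^sup>2) \<in> {1}} \<inter> ?B)"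
    by (intro closed_Int_compactin)
  moreover have "{y \<in> topspace ?P. (\<Sum>s<r. (y s - 0)\<^sup>2) \<in> {1}} \<inter> ?B = {x. (\<forall>s\<ge>r. x s = 0) \<and> (\<Sum>s<r. (x s)\<^sup>2) = 1}"
  proof -
    have "\<bar>x s\<bar> \<le> 1" if "(\<Sum>s<r. (x s)\<^sup>2) = 1" "s < r" for x :: "nat \<Rightarrow> real" and s
    proof -
      have "(x s)\<^sup>2 \<le> (\<Sum>s<r. (x s)\<^sup>2)" using that by (intro member_le_sum) auto
      then show ?thesis using that by (simp add: abs_square_le_1)
    qed
    then show ?thesis by (auto simp: PiE_iff abs_le_iff minus_le_iff not_less split: if_splits)
  qed
  ultimately show ?thesis by (simp add: sphere_space_conv compact_space_subtopology)
qed

lemma compact_space_sum_topology: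
  assumes "finite I" "\<And>i. i \<in> I \<Longrightarrow> compact_space (X i)"
  shows "compact_space (sum_topology X I)"
proof -
  have "compactin (sum_topology X I) (\<Union>i\<in>I. Pair i ` topspace (X i))"
  proof (rule compactin_Union)
    fix S assume "S \<in> (\<lambda>i. Pair i ` topspace (X i)) ` I"
    then obtain i where i: "i \<in> I" "S = Pair i ` topspace (X i)" by blast
    show "compactin (sum_topology X I) S"
      unfolding i(2) using assms(2)[OF i(1)] unfolding compact_space_def
      by (rule image_compactin[OF _ continuous_map_component_injection[OF i(1)]])
  qed (use assms(1) in simp)
  moreover have "(\<Union>i\<in>I. Pair i ` topspace (X i)) = topspace (sum_topology X I)"
    by auto
  ultimately show ?thesis by (simp add: compact_space_def)
qed

lemma quotient_map_sum_topology:
  assumes "\<And>i. i \<in> I \<Longrightarrow> quotient_map (X i) (Y i) (f i)"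
  shows "quotient_map (sum_topology X I) (sum_topology Y I) (\<lambda>(i, x). (i, f i x))"
proof -
  have img: "f i ` topspace (X i) = topspace (Y i)" if "i \<in> I" for i
    using assms[OF that] by (rule quotient_imp_surjective_map)
  have "openin (sum_topology X I) {z \<in> topspace (sum_topology X I). (case z of (i, x) \<Rightarrow> (i, f i x)) \<in> U}
      \<longleftrightarrow> openin (sum_topology Y I) U" if U: "U \<subseteq> topspace (sum_topology Y I)" for U
  proof -
    have eq: "{x. (i, x) \<in> {z \<in> topspace (sum_topology X I). (case z of (i, x) \<Rightarrow> (i, f i x)) \<in> U}}
      = {x \<in> topspace (X i). f i x \<in> {y. (i, y) \<in> U}}" if "i \<in> I" for i
      using that by auto
    have "openin (X i) {x \<in> topspace (X i). f i x \<in> {y. (i, y) \<in> U}} \<longleftrightarrow> openin (Y i) {y. (i, y) \<in> U}" if "i \<in> I" for i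
    proof -
      have "{y. (i, y) \<in> U} \<subseteq> topspace (Y i)" using U by auto
      then show ?thesis using assms[OF that] unfolding quotient_map_def by blast
    qed
    then have slices: "openin (X i) {x. (i, x) \<in> {z \<in> topspace (sum_topology X I). (case z of (i, x) \<Rightarrow> (i, f i x)) \<in> U}}
        \<longleftrightarrow> openin (Y i) {y. (i, y) \<in> U}" if "i \<in> I" for i
      unfolding eq[OF that] using that .
    show ?thesis
      unfolding openin_sum_topology[of X] openin_sum_topology[of Y] using slices U
      by (simp only: topspace_sum_topology Collect_restrict simp_thms cong: ball_cong)
  qed
  moreover have "(\<lambda>(i, x). (i, f i x)) ` topspace (sum_topology X I) = topspace (sum_topology Y I)"
    using img by (fastforce simp: image_iff)
  ultimately show ?thesis unfolding quotient_map_def by blast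
qed

section \<open>The boundaries of a torsion-free nilpotent group\<close>

locale nilpotent_strata = weighted_word_group +
  fixes E :: "nat \<Rightarrow> nat \<Rightarrow> 'a" and Lam :: "nat \<Rightarrow> 'a \<Rightarrow> nat \<Rightarrow> real"
  assumes strata: "i \<in> {1..c} \<Longrightarrow> graded_coordinates G x w M c A i (lower_central_rank G i) (E i) (Lam i)"
    and last: "lower_central G (Suc c) = {\<one>}" and torsion_free: "torsion_free G"
begin

abbreviation rk :: "nat \<Rightarrow> nat" where "rk i \<equiv> lower_central_rank G i"

definition len :: "nat \<Rightarrow> 'a \<Rightarrow> real" where
  "len i g = L2_set (Lam i g) {..<rk i}"

definition direction :: "nat \<Rightarrow> 'a \<Rightarrow> nat \<Rightarrow> real" where
  "direction i g s = Lam i g s / len i g"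

text \<open>No positive power of an element of this set lies in \<open>\<gamma>\<^sub>i\<^sub>+\<^sub>1\<close>.\<close>

definition stratum :: "nat \<Rightarrow> 'a set" where
  "stratum i = {g \<in> lower_central G i. 0 < len i g}"

definition vdist :: "nat \<Rightarrow> (nat \<Rightarrow> real) \<Rightarrow> (nat \<Rightarrow> real) \<Rightarrow> real" where
  "vdist r a b = L2_set (\<lambda>s. b s - a s) {..<r}"

lemma vdist_triangle: "vdist r a d \<le> vdist r a b + vdist r b d"
  using L2_set_triangle_ineq[of "\<lambda>s. b s - a s" "\<lambda>s. d s - b s" "{..<r}"] by (simp add: vdist_def)

lemma vdist_commute: "vdist r a b = vdist r b a"
  by (simp add: vdist_def L2_set_def power2_commute)

lemma vdist_uminus: "vdist r (\<lambda>s. - a s) (\<lambda>s. - b s) = vdist r a b"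
  by (simp add: vdist_def L2_set_def power2_commute)

lemma vdist_self [simp]: "vdist r a a = 0"
  by (simp add: vdist_def L2_set_def)

abbreviation W :: "'a metric" where "W \<equiv> word_metric G A"

context
  fixes i assumes i: "i \<in> {1..c}"
begin

interpretation S: graded_coordinates G x w M c A i "rk i" "E i" "Lam i"
  by (rule strata[OF i])

lemma len_conv: "len i g = S.vnorm (Lam i g)"
  by (simp add: len_def S.vnorm_def)

lemma direction_conv: "direction i g = S.dir g"
  by (simp add: fun_eq_iff direction_def S.dir_def len_conv)

lemma vdist_conv: "vdist (rk i) a b = S.vnorm (\<lambda>s. b s - a s)"
  by (simp add: vdist_def S.vnorm_def)

lemma stratum_conv: "g \<in> stratum i \<longleftrightarrow> g \<in> lower_central G i \<and> S.vnorm (Lam i g) > 0"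
  by (simp add: stratum_def len_conv)

lemma stratum_carrier: "g \<in> stratum i \<Longrightarrow> g \<in> carrier G"
  using lower_central_carrier by (auto simp: stratum_def)

lemma direction_in_sphere: "g \<in> stratum i \<Longrightarrow> direction i g \<in> topspace (sphere_space (int (rk i) - 1))"
  using S.vnorm_dir[of g] S.lam_beyond
  by (auto simp: topspace_sphere_space direction_conv stratum_conv S.dir_def S.vnorm_def)

lemma stratum_unbounded: "g \<in> stratum i \<Longrightarrow> orb b g \<in> unbounded_sets W"
  using S.orb_unbounded by (simp add: stratum_conv)

lemma stratum_dense:
  assumes "v \<in> topspace (sphere_space (int (rk i) - 1))" "0 < \<delta>"
  shows "\<exists>g\<in>stratum i. vdist (rk i) v (direction i g) < \<delta>"
  using S.dense_dir[of v \<delta>] assms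
  by (auto simp: topspace_sphere_space S.vnorm_def[symmetric] stratum_conv vdist_conv direction_conv)

lemma stratum_inv: "g \<in> stratum i \<Longrightarrow> inv g \<in> stratum i"
  and direction_inv: "g \<in> stratum i \<Longrightarrow> direction i (inv g) = (\<lambda>s. - direction i g s)"
  using S.vnorm_lam_inv S.dir_inv lower_central_inv by (auto simp: stratum_conv direction_conv)

lemma s_dist_orb_near:
  assumes "0 < \<epsilon>"
  shows "\<exists>\<delta>>0. \<forall>g\<in>stratum i. \<forall>h\<in>stratum i. vdist (rk i) (direction i g) (direction i h) < \<delta> \<longrightarrow>
     s_dist W \<one> (orb b g) (orb b h) \<le> \<epsilon>"
proof -
  obtain \<delta> where \<delta>: "\<delta> > 0" "\<And>g h. g \<in> stratum i \<Longrightarrow> h \<in> stratum i \<Longrightarrow>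
    vdist (rk i) (direction i g) (direction i h) < \<delta> \<Longrightarrow> s_plus W \<one> (orb b g) (orb b h) \<le> \<epsilon>"
    using S.s_plus_orb_near[OF assms, of b] by (auto simp: stratum_conv vdist_conv direction_conv)
  have "s_dist W \<one> (orb b g) (orb b h) \<le> \<epsilon>"
    if "g \<in> stratum i" "h \<in> stratum i" "vdist (rk i) (direction i g) (direction i h) < \<delta>" for g h
    using \<delta>(2)[OF that] \<delta>(2)[OF that(2,1)] that(3) vdist_commute by (simp add: s_dist_def)
  then show ?thesis using \<delta>(1) by blast
qed

text \<open>An element deeper in the central series has vanishing coordinates, so that it is
  separated from every direction.\<close>

lemma s_dist_orb_deeper:
  "\<exists>\<kappa>>0. \<forall>g\<in>stratum i. \<forall>h\<in>lower_central G (Suc i). orb b h \<in> unbounded_sets W \<longrightarrow>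
     \<kappa> \<le> s_dist W \<one> (orb b g) (orb b h)"
proof -
  obtain \<kappa> where \<kappa>: "\<kappa> > 0" "\<forall>g\<in>lower_central G i. \<forall>h\<in>lower_central G i. S.vnorm (Lam i g) > 0 \<longrightarrow> orb b h \<in> unbounded_sets W \<longrightarrow>
     (\<forall>m\<in>exponents b. \<forall>\<tau>\<ge>0. 1 \<le> S.vnorm (\<lambda>s. S.dir g s - \<tau> * real_of_int m * Lam i h s)) \<longrightarrow>
     \<kappa> \<le> s_plus W \<one> (orb b h) (orb b g)"
    using S.s_plus_orb_apart[of 1 b] by auto
  have "\<kappa> \<le> s_dist W \<one> (orb b g) (orb b h)"
    if g: "g \<in> stratum i" and h: "h \<in> lower_central G (Suc i)" "orb b h \<in> unbounded_sets W" for g h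
  proof -
    have "S.vnorm (\<lambda>s. S.dir g s - \<tau> * real_of_int m * Lam i h s) = 1" for m \<tau>
      using S.lam_deep[OF h(1)] S.vnorm_dir[of g] g by (simp add: stratum_conv)
    then have "\<kappa> \<le> s_plus W \<one> (orb b h) (orb b g)"
      using \<kappa>(2) g h lower_central_antimono[of i "Suc i"] by (auto simp: stratum_conv)
    then show ?thesis by (simp add: s_dist_def)
  qed
  then show ?thesis using \<kappa>(1) by blast
qed

lemma s_dist_orb_apart:
  assumes \<rho>: "0 < \<rho>"
  shows "\<exists>\<kappa>>0. \<forall>g\<in>stratum i. \<forall>h\<in>stratum i. \<rho> \<le> vdist (rk i) (direction i h) (direction i g) \<longrightarrow>
     (b \<longrightarrow> \<rho> \<le> vdist (rk i) (\<lambda>s. - direction i h s) (direction i g)) \<longrightarrow>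
     \<kappa> \<le> s_dist W \<one> (orb b g) (orb b h)"
proof -
  obtain \<kappa> where \<kappa>: "\<kappa> > 0" "\<forall>g\<in>lower_central G i. \<forall>h\<in>lower_central G i. S.vnorm (Lam i g) > 0 \<longrightarrow> orb b h \<in> unbounded_sets W \<longrightarrow>
     (\<forall>m\<in>exponents b. \<forall>\<tau>\<ge>0. \<rho> / 2 \<le> S.vnorm (\<lambda>s. S.dir g s - \<tau> * real_of_int m * Lam i h s)) \<longrightarrow>
     \<kappa> \<le> s_plus W \<one> (orb b h) (orb b g)"
    using S.s_plus_orb_apart[of "\<rho> / 2" b] \<rho> by auto
  have "\<kappa> \<le> s_dist W \<one> (orb b g) (orb b h)"
    if g: "g \<in> stratum i" and h: "h \<in> stratum i" and d: "\<rho> \<le> vdist (rk i) (direction i h) (direction i g)"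
      "b \<longrightarrow> \<rho> \<le> vdist (rk i) (\<lambda>s. - direction i h s) (direction i g)" for g h
  proof -
    have pos: "S.vnorm (Lam i g) > 0" "S.vnorm (Lam i h) > 0" using g h by (auto simp: stratum_conv)
    note unit = S.vnorm_dir[OF pos(1)] S.vnorm_dir[OF pos(2)]
    have "\<rho> / 2 \<le> S.vnorm (\<lambda>s. S.dir g s - \<tau> * real_of_int m * Lam i h s)" if m: "m \<in> exponents b" "0 \<le> \<tau>" for m \<tau>
    proof -
      \<comment> \<open>A multiple of the coordinates of \<open>h\<close> is a multiple of its direction, and negative only for two-sided orbits.\<close>
      define \<sigma> where "\<sigma> = \<tau> * real_of_int m * S.vnorm (Lam i h)"
      have eq: "S.vnorm (\<lambda>s. S.dir g s - \<tau> * real_of_int m * Lam i h s) = S.vnorm (\<lambda>s. S.dir g s - \<sigma> * S.dir h s)"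
        by (simp add: \<sigma>_def S.lam_dir[OF pos(2)] mult.assoc)
      show ?thesis
      proof (cases "0 \<le> \<sigma>")
        case True
        from S.ray_distance[OF unit True] d(1) show ?thesis
          unfolding eq by (simp add: vdist_conv direction_conv)
      next
        case False
        then have "m < 0" using m(2) pos(2) unfolding \<sigma>_def by (meson mult_nonneg_nonneg not_less of_int_0_le_iff less_imp_le)
        then have b using m(1) by (auto simp: exponents_def split: if_splits)
        have "S.vnorm (\<lambda>s. - S.dir h s) = 1" using unit(2) by (simp add: S.vnorm_uminus)
        from S.ray_distance[OF unit(1) this, of "- \<sigma>"] False d(2) \<open>b\<close> show ?thesis
          unfolding eq by (simp add: vdist_conv direction_conv)
      qed
    qed
    then have "\<kappa> \<le> s_plus W \<one> (orb b h) (orb b g)"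
      using \<kappa>(2) g h stratum_unbounded[OF h] by (auto simp: stratum_conv)
    then show ?thesis by (simp add: s_dist_def)
  qed
  then show ?thesis using \<kappa>(1) by blast
qed

lemma stratum_or_deeper:
  assumes g: "g \<in> lower_central G i" "g \<notin> stratum i"
  shows "\<exists>k>0. g [^] (k::nat) \<in> lower_central G (Suc i)"
proof -
  have "S.vnorm (Lam i g) = 0" using g S.vnorm_nonneg[of "Lam i g"] by (simp add: stratum_conv)
  then have 0: "Lam i g s = 0" if "s < rk i" for s using S.abs_le_vnorm[OF that, of "Lam i g"] by simp
  obtain p m where p: "p > 0" "cong_lc (Suc i) (g [^] (p::nat)) (oprod (E i) m (rk i))" 
    "\<forall>s<rk i. real_of_int (m s) = real p * Lam i g s" using S.lam_pow_ex[OF g(1)] by blast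
  have "oprod (E i) m k = \<one>" if "k \<le> rk i" for k
    using that
  proof (induction k)
    case (Suc k)
    then have "k < rk i" by simp
    then have "real_of_int (m k) = 0" using p(3) 0[of k] by (metis mult_zero_right)
    then have "m k = 0" by simp
    then show ?case using Suc by simp
  qed simp
  then have "cong_lc (Suc i) \<one> (g [^] p)" using cong_lc_sym[OF p(2)] by simp
  then show ?thesis using p(1) by (auto simp: cong_lc_def)
qed

end

text \<open>Otherwise suitable powers of \<open>g\<close> would lie deeper and deeper in the central series until they
  are trivial, and \<open>g\<close> would be a torsion element.\<close>

lemma ex_stratum:
  assumes g: "g \<in> carrier G" "g \<noteq> \<one>"
  shows "\<exists>i\<in>{1..c}. \<exists>k>0. g [^] (k::nat) \<in> stratum i"
proof (rule ccontr)
  assume none: "\<not> ?thesis"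
  have "\<exists>k>0. g [^] (k::nat) \<in> lower_central G (Suc j)" if "j \<le> c" for j
    using that
  proof (induction j)
    case 0
    then show ?case using g by (intro exI[of _ 1]) simp
  next
    case (Suc j)
    then obtain k :: nat where k: "k > 0" "g [^] k \<in> lower_central G (Suc j)" by auto
    have j: "Suc j \<in> {1..c}" using Suc.prems by simp
    have "g [^] k \<notin> stratum (Suc j)" using none j k(1) by blast
    then obtain l where l: "l > 0" "(g [^] k) [^] (l::nat) \<in> lower_central G (Suc (Suc j))"
      using stratum_or_deeper[OF j k(2)] by blast
    then show ?case using k(1) g by (intro exI[of _ "k * l"]) (simp add: nat_pow_pow)
  qed
  then obtain k where "k > 0" "g [^] (k::nat) = \<one>" using last by blast
  then show False using torsion_free g by (auto simp: torsion_free_def)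
qed

text \<open>The generators of the boundary sit at dense positions in the disjoint union of spheres, and the
  estimates above are the hypotheses for extending the map that sends a position to
  the class of the orbit. Linear and projective boundary differ only in which positions have the
  same limit, as described by \<open>q\<close>.\<close>

lemma boundary_orbits_homeomorphic:
  assumes q: "quotient_map (sum_topology (\<lambda>i. sphere_space (int (rk i) - 1)) {1..c}) Z q"
    and fibres: "\<And>i j u v. i \<in> {1..c} \<Longrightarrow> j \<in> {1..c} \<Longrightarrow> q (i, u) = q (j, v) \<longleftrightarrow> i = j \<and> (u = v \<or> b \<and> u = (\<lambda>s. - v s))"
  shows "mtopology_of (boundary W \<one> ({orb b g | g. g \<in> carrier G} \<inter> unbounded_sets W)) homeomorphic_space Z"
proof -
  let ?m = "class_metric W \<one>" and ?X = "sum_topology (\<lambda>i. sphere_space (int (rk i) - 1)) {1..c}"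
  have one: "\<one> \<in> mspace W" by simp
  define \<G> where "\<G> = (SIGMA i:{1..c}. stratum i)"
  define pos where "pos = (\<lambda>(i, g). (i, direction i g))"
  define \<phi> where "\<phi> = (\<lambda>(i::nat, g). s_equiv W \<one> `` {orb b g})"
  define nb where "nb z \<delta> = {(j, v) \<in> topspace ?X. j = fst z \<and> vdist (rk (fst z)) (snd z) v < \<delta>}"
    for z :: "nat \<times> (nat \<Rightarrow> real)" and \<delta>
  have d: "mdist ?m (\<phi> (i, g)) (\<phi> (j, h)) = sqrt (s_dist W \<one> (orb b g) (orb b h))"
    if "(i, g) \<in> \<G>" "(j, h) \<in> \<G>" for i g j h
  proof -
    have "orb b g \<in> unbounded_sets W" "orb b h \<in> unbounded_sets W"
      using that stratum_unbounded unfolding \<G>_def by blast+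
    from t_class[OF one this] show ?thesis
      by (simp add: class_metric_simps[OF one] \<phi>_def t_dist_def)
  qed
  \<comment> \<open>Passing to a power leaves the class of an orbit unchanged, so the strata represent all classes.\<close>
  have classes: "({orb b g | g. g \<in> carrier G} \<inter> unbounded_sets W) // s_equiv W \<one> = \<phi> ` \<G>"
  proof
    show "\<phi> ` \<G> \<subseteq> ({orb b g | g. g \<in> carrier G} \<inter> unbounded_sets W) // s_equiv W \<one>"
    proof clarify
      fix i g assume "(i, g) \<in> \<G>"
      then have "g \<in> carrier G" "orb b g \<in> unbounded_sets W"
        using stratum_carrier stratum_unbounded by (auto simp: \<G>_def)
      then show "\<phi> (i, g) \<in> ({orb b g | g. g \<in> carrier G} \<inter> unbounded_sets W) // s_equiv W \<one>"
        unfolding \<phi>_def by (auto intro!: quotientI)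
    qed
    show "({orb b g | g. g \<in> carrier G} \<inter> unbounded_sets W) // s_equiv W \<one> \<subseteq> \<phi> ` \<G>"
    proof
      fix P assume "P \<in> ({orb b g | g. g \<in> carrier G} \<inter> unbounded_sets W) // s_equiv W \<one>"
      then obtain g where g: "g \<in> carrier G" "orb b g \<in> unbounded_sets W" "P = s_equiv W \<one> `` {orb b g}"
        by (auto elim!: quotientE)
      have "g \<noteq> \<one>" using g(2) orb_one_bounded by auto
      then obtain i k where ik: "i \<in> {1..c}" "0 < k" "g [^] (k::nat) \<in> stratum i" using ex_stratum[OF g(1)] by blast
      have "(orb b g, orb b (g [^] k)) \<in> s_equiv W \<one>"
        using orb_pow_equiv[OF g(1) ik(2) g(2)] stratum_unbounded[OF ik(1,3)] by blast
      then have "P = \<phi> (i, g [^] k)" unfolding g(3) \<phi>_def using equiv_class_eq[OF equiv_s_equiv[OF one]] by simp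
      then show "P \<in> \<phi> ` \<G>" using ik by (auto simp: \<G>_def)
    qed
  qed
  have "subtopology (mtopology_of ?m) (mtopology_of ?m closure_of (\<phi> ` \<G>)) homeomorphic_space Z"
  proof (rule dense_map_closure_homeomorphic[of ?X ?m nb \<G> pos \<phi> Z q])
    show "compact_space ?X" by (intro compact_space_sum_topology compact_sphere_space) auto
    show "mcomplete_of ?m" by (rule mcomplete_class_metric[OF one])
    show "openin ?X (nb z \<delta>) \<and> z \<in> nb z \<delta>" if z: "z \<in> topspace ?X" and \<delta>: "0 < \<delta>" for z \<delta>
    proof
      obtain i u where iu: "z = (i, u)" "i \<in> {1..c}" "u \<in> topspace (sphere_space (int (rk i) - 1))" using z by auto
      show "z \<in> nb z \<delta>" using z \<delta> iu by (simp add: nb_def)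
      have "openin (sphere_space (int (rk j) - 1)) {v. (j, v) \<in> nb z \<delta>}" if j: "j \<in> {1..c}" for j
      proof (cases "j = i")
        case True
        have "continuous_map (sphere_space (int (rk i) - 1)) euclideanreal (\<lambda>y. \<Sum>s<rk i. (y s - u s)\<^sup>2)"
          unfolding sphere_space_conv by (intro continuous_map_from_subtopology continuous_map_sum_squares)
        then have "openin (sphere_space (int (rk i) - 1))
            {v \<in> topspace (sphere_space (int (rk i) - 1)). (\<Sum>s<rk i. (v s - u s)\<^sup>2) \<in> {..<\<delta>\<^sup>2}}"
          by (rule openin_continuous_map_preimage) simp
        moreover have "{v. (j, v) \<in> nb z \<delta>} = {v \<in> topspace (sphere_space (int (rk i) - 1)). (\<Sum>s<rk i. (v s - u s)\<^sup>2) \<in> {..<\<delta>\<^sup>2}}"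
          using True iu \<delta> by (auto simp: nb_def vdist_def L2_set_less_iff)
        ultimately show ?thesis using True by simp
      next
        case False
        then have "{v. (j, v) \<in> nb z \<delta>} = {}" using iu by (auto simp: nb_def)
        then show ?thesis by simp
      qed
      then show "openin ?X (nb z \<delta>)" by (auto simp: openin_sum_topology nb_def)
    qed
    show "nb z \<delta> \<subseteq> nb z \<delta>'" if "\<delta> \<le> \<delta>'" for z \<delta> \<delta>' using that by (auto simp: nb_def)
    show "\<exists>\<delta>'>0. nb y \<delta>' \<subseteq> nb z \<delta>" if "y \<in> nb z \<delta>" for z y \<delta>
    proof (intro exI[of _ "\<delta> - vdist (rk (fst z)) (snd z) (snd y)"] conjI)
      show "0 < \<delta> - vdist (rk (fst z)) (snd z) (snd y)" using that by (auto simp: nb_def)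
      show "nb y (\<delta> - vdist (rk (fst z)) (snd z) (snd y)) \<subseteq> nb z \<delta>"
      proof clarify
        fix j v assume v: "(j, v) \<in> nb y (\<delta> - vdist (rk (fst z)) (snd z) (snd y))"
        have "fst y = fst z" using that by (auto simp: nb_def)
        then show "(j, v) \<in> nb z \<delta>"
          using v vdist_triangle[of "rk (fst z)" "snd z" v "snd y"] by (auto simp: nb_def)
      qed
    qed
    show "pos a \<in> topspace ?X" if "a \<in> \<G>" for a
      using that direction_in_sphere by (auto simp: \<G>_def pos_def)
    show "\<phi> a \<in> mspace ?m" if "a \<in> \<G>" for a
      using that stratum_unbounded by (auto simp: \<G>_def \<phi>_def class_metric_simps[OF one] intro!: quotientI)
    show dense: "\<exists>a\<in>\<G>. pos a \<in> nb z \<delta>" if z: "z \<in> topspace ?X" and \<delta>: "0 < \<delta>" for z \<delta>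
    proof -
      obtain i u where iu: "z = (i, u)" "i \<in> {1..c}" "u \<in> topspace (sphere_space (int (rk i) - 1))" using z by auto
      obtain g where g: "g \<in> stratum i" "vdist (rk i) u (direction i g) < \<delta>" using stratum_dense[OF iu(2,3) \<delta>] by blast
      then have "(i, g) \<in> \<G>" "pos (i, g) \<in> nb z \<delta>"
        using iu direction_in_sphere[OF iu(2) g(1)] by (auto simp: \<G>_def pos_def nb_def)
      then show ?thesis by blast
    qed
    show "\<exists>\<delta>>0. \<forall>a\<in>\<G>. \<forall>a'\<in>\<G>. pos a \<in> nb z \<delta> \<longrightarrow> pos a' \<in> nb z \<delta> \<longrightarrow> mdist ?m (\<phi> a) (\<phi> a') \<le> \<epsilon>"
      if z: "z \<in> topspace ?X" and \<epsilon>: "0 < \<epsilon>" for z \<epsilon>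
    proof -
      obtain i u where iu: "z = (i, u)" "i \<in> {1..c}" using z by auto
      obtain \<delta> where \<delta>: "\<delta> > 0" "\<And>g h. g \<in> stratum i \<Longrightarrow> h \<in> stratum i \<Longrightarrow> vdist (rk i) (direction i g) (direction i h) < \<delta> \<Longrightarrow>
        s_dist W \<one> (orb b g) (orb b h) \<le> \<epsilon>\<^sup>2"
        using s_dist_orb_near[OF iu(2), of "\<epsilon>\<^sup>2" b] \<epsilon> by auto
      have "mdist ?m (\<phi> a) (\<phi> a') \<le> \<epsilon>"
        if a: "a \<in> \<G>" "a' \<in> \<G>" "pos a \<in> nb z (\<delta> / 2)" "pos a' \<in> nb z (\<delta> / 2)" for a a'
      proof -
        obtain g h where gh: "a = (i, g)" "a' = (i, h)" "vdist (rk i) u (direction i g) < \<delta> / 2" "vdist (rk i) u (direction i h) < \<delta> / 2"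
          using a iu by (auto simp: \<G>_def pos_def nb_def)
        have st: "g \<in> stratum i" "h \<in> stratum i" using a gh by (auto simp: \<G>_def)
        have "vdist (rk i) (direction i g) (direction i h) < \<delta>"
          using vdist_triangle[of "rk i" "direction i g" "direction i h" u] vdist_commute[of "rk i" u "direction i g"] gh by linarith
        then have "sqrt (s_dist W \<one> (orb b g) (orb b h)) \<le> sqrt (\<epsilon>\<^sup>2)" using \<delta>(2)[OF st] by (intro real_sqrt_le_mono)
        then show ?thesis using d a gh \<epsilon> by simp
      qed
      then show ?thesis using \<delta>(1) by (intro exI[of _ "\<delta> / 2"]) auto
    qed
    show "quotient_map ?X Z q" by (rule q)
    show "\<exists>a\<in>\<G>. \<exists>a'\<in>\<G>. pos a \<in> nb z \<delta> \<and> pos a' \<in> nb y \<delta> \<and> \<phi> a = \<phi> a'"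
      if zy: "z \<in> topspace ?X" "y \<in> topspace ?X" and eq: "q z = q y" and \<delta>: "0 < \<delta>" for z y \<delta>
    proof -
      obtain i u j v where ij: "z = (i, u)" "i \<in> {1..c}" "y = (j, v)" "j \<in> {1..c}" using zy by auto
      then have ji: "j = i" and uv: "u = v \<or> b \<and> u = (\<lambda>s. - v s)" using eq fibres by auto
      obtain a where a: "a \<in> \<G>" "pos a \<in> nb z \<delta>" using dense[OF zy(1) \<delta>] by blast
      show ?thesis
      proof (cases "u = v")
        case True
        then show ?thesis using a ij ji by auto
      next
        case False
        then have b and u: "u = (\<lambda>s. - v s)" using uv by auto
        obtain g where g: "a = (i, g)" "g \<in> stratum i" "vdist (rk i) u (direction i g) < \<delta>"
          using a ij by (auto simp: \<G>_def pos_def nb_def)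
        have "vdist (rk i) v (direction i (inv g)) = vdist (rk i) u (direction i g)"
          unfolding direction_inv[OF ij(2) g(2)] u using vdist_uminus[of "rk i" "\<lambda>s. - v s" "direction i g"] by simp
        then have "(i, inv g) \<in> \<G>" "pos (i, inv g) \<in> nb y \<delta>"
          using ij ji g stratum_inv[OF ij(2) g(2)] direction_in_sphere[OF ij(2)] by (auto simp: \<G>_def pos_def nb_def)
        moreover have "\<phi> a = \<phi> (i, inv g)"
          using orb_inv[OF stratum_carrier[OF ij(2) g(2)]] \<open>b\<close> by (simp add: \<phi>_def g(1))
        ultimately show ?thesis using a by blast
      qed
    qed
    show "\<exists>\<delta>>0. \<exists>\<kappa>>0. \<forall>a\<in>\<G>. \<forall>a'\<in>\<G>. pos a \<in> nb z \<delta> \<longrightarrow> pos a' \<in> nb y \<delta> \<longrightarrow> \<kappa> \<le> mdist ?m (\<phi> a) (\<phi> a')"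
      if zy: "z \<in> topspace ?X" "y \<in> topspace ?X" and ne: "q z \<noteq> q y" for z y
    proof -
      obtain i u j v where ij: "z = (i, u)" "i \<in> {1..c}" "y = (j, v)" "j \<in> {1..c}" using zy by auto
      have sphere: "u \<in> topspace (sphere_space (int (rk i) - 1))" "v \<in> topspace (sphere_space (int (rk j) - 1))"
        using zy ij by auto
      have deeper: "\<exists>\<kappa>>0. \<forall>g\<in>stratum i. \<forall>h\<in>stratum j. \<kappa> \<le> s_dist W \<one> (orb b g) (orb b h)"
        if "i \<in> {1..c}" "j \<in> {1..c}" "i < j" for i j
      proof -
        have "h \<in> lower_central G (Suc i)" if "h \<in> stratum j" for h
          using that lower_central_antimono[of "Suc i" j] \<open>i < j\<close> by (auto simp: stratum_def)
        then show ?thesis using s_dist_orb_deeper[OF that(1), of b] stratum_unbounded[OF that(2)] by meson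
      qed
      have "\<exists>\<delta>>0. \<exists>\<kappa>>0. \<forall>g\<in>stratum i. \<forall>h\<in>stratum j. vdist (rk i) u (direction i g) < \<delta> \<longrightarrow>
        vdist (rk j) v (direction j h) < \<delta> \<longrightarrow> \<kappa> \<le> s_dist W \<one> (orb b g) (orb b h)"
      proof (cases i j rule: linorder_cases)
        case less
        then show ?thesis using deeper[OF ij(2,4)] zero_less_one by meson
      next
        case greater
        then show ?thesis using deeper[OF ij(4,2)] zero_less_one s_dist_commute by metis
      next
        case equal
        have ext0: "u = v'" if "vdist (rk i) v' u = 0" "\<forall>s\<ge>rk i. v' s = 0" for v'
        proof
          fix s
          show "u s = v' s"
            using that sphere(1) by (cases "s < rk i") (auto simp: vdist_def L2_set_eq_0_iff topspace_sphere_space)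
        qed
        have uv: "u \<noteq> v" "b \<Longrightarrow> u \<noteq> (\<lambda>s. - v s)" using ne fibres ij equal by auto
        have vd0: "0 \<le> vdist r p p'" for r p p' by (simp add: vdist_def)
        have 1: "0 < vdist (rk i) v u" using ext0[of v] uv(1) sphere(2) equal vd0[of "rk i" v u]
          by (auto simp: topspace_sphere_space less_le)
        have 2: "0 < vdist (rk i) (\<lambda>s. - v s) u" if b
          using ext0[of "\<lambda>s. - v s"] uv(2)[OF that] sphere(2) equal vd0[of "rk i" "\<lambda>s. - v s" u]
          by (auto simp: topspace_sphere_space less_le)
        define \<rho> where "\<rho> = (if b then min (vdist (rk i) v u) (vdist (rk i) (\<lambda>s. - v s) u) else vdist (rk i) v u) / 4"
        have \<rho>: "0 < \<rho>" "4 * \<rho> \<le> vdist (rk i) v u" "b \<Longrightarrow> 4 * \<rho> \<le> vdist (rk i) (\<lambda>s. - v s) u"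
          using 1 2 by (auto simp: \<rho>_def)
        obtain \<kappa> where \<kappa>: "\<kappa> > 0" "\<And>g h. g \<in> stratum i \<Longrightarrow> h \<in> stratum i \<Longrightarrow> \<rho> \<le> vdist (rk i) (direction i h) (direction i g) \<Longrightarrow>
          (b \<longrightarrow> \<rho> \<le> vdist (rk i) (\<lambda>s. - direction i h s) (direction i g)) \<Longrightarrow> \<kappa> \<le> s_dist W \<one> (orb b g) (orb b h)"
          using s_dist_orb_apart[OF ij(2) \<rho>(1), of b] by blast
        have "\<kappa> \<le> s_dist W \<one> (orb b g) (orb b h)"
          if gh: "g \<in> stratum i" "h \<in> stratum i" "vdist (rk i) u (direction i g) < \<rho>" "vdist (rk i) v (direction i h) < \<rho>" for g h
        proof (rule \<kappa>(2)[OF gh(1,2)])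
          have far: "\<rho> \<le> vdist (rk i) v'' (direction i g)" if "4 * \<rho> \<le> vdist (rk i) v' u" "vdist (rk i) v' v'' < \<rho>" for v' v''
            using vdist_triangle[of "rk i" v' u v''] vdist_triangle[of "rk i" v'' u "direction i g"]
              vdist_commute[of "rk i" u "direction i g"] that gh(3) \<rho>(1) by linarith
          show "\<rho> \<le> vdist (rk i) (direction i h) (direction i g)" by (rule far[OF \<rho>(2) gh(4)])
          show "b \<longrightarrow> \<rho> \<le> vdist (rk i) (\<lambda>s. - direction i h s) (direction i g)"
            using far[OF \<rho>(3)] vdist_uminus gh(4) by simp
        qed
        then show ?thesis using \<kappa>(1) \<rho>(1) equal by blast
      qed
      then obtain \<delta> \<kappa> where \<delta>: "\<delta> > 0" "\<kappa> > 0" "\<And>g h. g \<in> stratum i \<Longrightarrow> h \<in> stratum j \<Longrightarrow> vdist (rk i) u (direction i g) < \<delta> \<Longrightarrow>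
        vdist (rk j) v (direction j h) < \<delta> \<Longrightarrow> \<kappa> \<le> s_dist W \<one> (orb b g) (orb b h)" by blast
      have "sqrt \<kappa> \<le> mdist ?m (\<phi> a) (\<phi> a')" if a: "a \<in> \<G>" "a' \<in> \<G>" "pos a \<in> nb z \<delta>" "pos a' \<in> nb y \<delta>" for a a'
      proof -
        obtain g h where gh: "a = (i, g)" "a' = (j, h)" "vdist (rk i) u (direction i g) < \<delta>" "vdist (rk j) v (direction j h) < \<delta>"
          using a ij by (auto simp: \<G>_def pos_def nb_def)
        have "g \<in> stratum i" "h \<in> stratum j" using a gh by (auto simp: \<G>_def)
        then have "\<kappa> \<le> s_dist W \<one> (orb b g) (orb b h)" using \<delta>(3) gh by blast
        then show ?thesis using d a gh by simp
      qed
      then show ?thesis using \<delta>(1,2) by (intro exI[of _ \<delta>] conjI exI[of _ "sqrt \<kappa>"]) auto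
    qed
  qed
  then show ?thesis by (simp add: boundary_def mtopology_of_submetric classes)
qed

end

lemma (in word_group) nilpotent_strata_exist:
  assumes c: "lower_central G (Suc c) = {\<one>}" and "torsion_free G"
  shows "\<exists>x w M E Lam. nilpotent_strata G x w M c A E Lam"
proof -
  obtain x w M where "weighted_letters G x w M c"
    using weighted_letters_exist[OF finite_gens gens_closed gens c] by blast
  then interpret L: weighted_letters G x w M c .
  have L: "weighted_word_group G x w M c A"
    by (simp add: weighted_word_group_def L.weighted_letters_axioms word_group_axioms)
  have "\<exists>e lam. graded_coordinates G x w M c A i (lower_central_rank G i) e lam" if "i \<in> {1..c}" for i
  proof -
    have i: "1 \<le> i" "1 \<le> c" using that by auto
    show ?thesis
      apply (rule L.lower_central_coordinates[OF i(1)])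
      subgoal premises prems for e lam
        by (intro exI[of _ e] exI[of _ lam] graded_coordinates.intro[OF L graded_coordinates_axioms.intro[OF i prems]])
      done
  qed
  then obtain E Lam where "\<And>i. i \<in> {1..c} \<Longrightarrow> graded_coordinates G x w M c A i (lower_central_rank G i) (E i) (Lam i)"
    by metis
  then have "nilpotent_strata G x w M c A E Lam"
    using L assms by (intro nilpotent_strata.intro nilpotent_strata_axioms.intro)
  then show ?thesis by blast
qed

lemma antipodal_class_eq_iff: "antipodal_class u = antipodal_class v \<longleftrightarrow> u = v \<or> u = (\<lambda>s. - v s)"
  by (auto simp: antipodal_class_def doubleton_eq_iff)

theorem corollary7p12:
  fixes V :: "'v set" and E :: "('v \<times> 'v) set" and p v :: 'v
    and N :: "('g, 'b) monoid_scheme" and A :: "'g set" and q :: 'g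
  assumes "simple_graph V E" and "infinite V" and "connected_graph V E"
    and "vertex_transitive V E" and "polynomial_growth (graph_metric V E)"
    and "p \<in> V" and "v \<in> V"
    and "group N" and "torsion_free N" and "nilpotent N"
    and "finite A" and "A \<subseteq> carrier N" and "generate N A = carrier N" and "q \<in> carrier N"
    and "growth_rate (word_metric N A) q = growth_rate (graph_metric V E) p"
    and "bilipschitz_equivalent
           (linear_boundary_group N A q) (linear_boundary_graph V E p v)"
    and "bilipschitz_equivalent
           (projective_boundary_group N A q) (projective_boundary_graph V E p v)"
  shows "mtopology_of (linear_boundary_graph V E p v) homeomorphic_space
           sum_topology (\<lambda>i. sphere_space (int (lower_central_rank N i) - 1))
             {1..nilpotency_class N} \<and>
         mtopology_of (projective_boundary_graph V E p v) homeomorphic_space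
           sum_topology (\<lambda>i. projective_space (int (lower_central_rank N i) - 1))
             {1..nilpotency_class N}"
proof -
  let ?c = "nilpotency_class N"
  interpret word_group N A
    using assms by (intro word_group.intro word_group_axioms.intro)
  have c: "lower_central N (Suc ?c) = {\<one>\<^bsub>N\<^esub>}"
    using LeastI_ex[OF \<open>nilpotent N\<close>[unfolded nilpotent_def]] by (simp add: nilpotency_class_def)
  obtain x w M F Lam where "nilpotent_strata N x w M ?c A F Lam"
    using nilpotent_strata_exist[OF c \<open>torsion_free N\<close>] by blast
  then interpret S: nilpotent_strata N x w M ?c A F Lam .
  let ?X = "sum_topology (\<lambda>i. sphere_space (int (lower_central_rank N i) - 1)) {1..?c}"
  have q: "q \<in> mspace (word_metric N A)" "\<one>\<^bsub>N\<^esub> \<in> mspace (word_metric N A)"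
    using \<open>q \<in> carrier N\<close> by simp_all
  have lin: "mtopology_of (linear_boundary_group N A q) homeomorphic_space ?X"
  proof -
    have "quotient_map ?X ?X id"
      using homeomorphic_map_id[of ?X ?X] unfolding homeomorphic_map_def by blast
    from S.boundary_orbits_homeomorphic[OF this, of False] show ?thesis
      by (simp add: linear_boundary_group_def boundary_basepoint[OF q] orb_False)
  qed
  have proj: "mtopology_of (projective_boundary_group N A q) homeomorphic_space
      sum_topology (\<lambda>i. projective_space (int (lower_central_rank N i) - 1)) {1..?c}"
    using S.boundary_orbits_homeomorphic[OF quotient_map_sum_topology[OF quotient_map_projective_space], of True]
    by (simp add: projective_boundary_group_def boundary_basepoint[OF q] orb_True antipodal_class_eq_iff)
  have "mtopology_of (linear_boundary_graph V E p v) homeomorphic_space mtopology_of (linear_boundary_group N A q)"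
    "mtopology_of (projective_boundary_graph V E p v) homeomorphic_space mtopology_of (projective_boundary_group N A q)"
    by (subst homeomorphic_space_sym, rule bilipschitz_homeomorphic, rule assms)+
  then show ?thesis
    by (intro conjI homeomorphic_space_trans[OF _ lin] homeomorphic_space_trans[OF _ proj])
qed

end
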